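(* Let $d\ge 2$ and let $G$ be a finite $d$-regular graph. Then $$\max_{\sigma:\ r_{A_\sigma}^2\le 2(d-1)}\rho(A_\sigma)<\frac{3+\sqrt5}{2}\sqrt{d-1},$$ where the maximum is over all edge signings $\sigma$ of $G$ with $r_{A_\sigma}^2\le 2(d-1)$. In particular, $G$ admits an edge signing $\sigma$ with $\rho(A_\sigma)<\frac{3+\sqrt5}{2}\sqrt{d-1}$.
   Context: All graphs are finite, simple and undirected, with vertex set $[n]$, $n\ge1$. An edge signing of $G=(V,E)$ is a map $\sigma:E\to\{-1,+1\}$; its signed adjacency matrix $A_\sigma$ is the real symmetric $n\times n$ matrix whose $(i,j)$ entry is $\sigma(\{i,j\})$ if $\{i,j\}\in E$ and $0$ otherwise. $\rho(A)=\|A\|_{\mathrm{op}}$ denotes the spectral radius of a symmetric matrix. For $S\subseteq[n]$, $A[S]$ is the principal submatrix indexed by $S$ (the characteristic polynomial of the empty submatrix is $1$). For Hermitian $n\times n$ matrices $A_1,\dots,A_k$ the normalized mixed determinantal polynomial is $$\chi[A_1,\dots,A_k](x)=k^{-n}\sum_{S_1\sqcup\cdots\sqcup S_k=[n]}\ \prod_{j=1}^k\det(xI-A_j[S_j]),$$ the sum being over ordered partitions of $[n]$ into $k$ possibly empty parts; it is monic of degree $n$ and real-rooted. For a real symmetric zero-diagonal matrix $A$, $r_A$ denotes the largest root of $\chi[A,-A]$. *)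

theory Defs
  imports
    "HOL-Library.FuncSet"
    "HOL-Library.Disjoint_Sets"
    "Jordan_Normal_Form.Char_Poly"
    "Jordan_Normal_Form.Spectral_Radius"
    "Jordan_Normal_Form.DL_Submatrix"
begin

text \<open>
  Graphs on \<open>n\<close> vertices have vertex set \<open>{..<n}\<close>, matching the 0-based matrix indices of
  \<^theory>\<open>Jordan_Normal_Form.Matrix\<close>, and are given by their set of edges, each a two-element
  set of vertices.
\<close>

definition simple_graph :: "nat \<Rightarrow> nat set set \<Rightarrow> bool" where
  "simple_graph n E \<longleftrightarrow> E \<subseteq> {e. e \<subseteq> {..<n} \<and> card e = 2}"

definition regular_graph :: "nat \<Rightarrow> nat \<Rightarrow> nat set set \<Rightarrow> bool" where
  "regular_graph d n E \<longleftrightarrow> simple_graph n E \<and> (\<forall>v<n. card {e \<in> E. v \<in> e} = d)"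

text \<open>
  Signings are extensional functions (\<open>undefined\<close> off \<open>E\<close>), so that they correspond exactly to the
  maps \<open>E \<rightarrow> {-1, 1}\<close> and there are finitely many of them.
\<close>

definition edge_signings :: "nat set set \<Rightarrow> (nat set \<Rightarrow> real) set" where
  "edge_signings E = E \<rightarrow>\<^sub>E {-1, 1}"

definition signed_adj_mat :: "nat \<Rightarrow> nat set set \<Rightarrow> (nat set \<Rightarrow> real) \<Rightarrow> real mat" where
  "signed_adj_mat n E \<sigma> = mat n n (\<lambda>(i, j). if {i, j} \<in> E then \<sigma> {i, j} else 0)"

text \<open>
  Ordered partitions of \<open>{..<n}\<close> into \<open>k\<close> possibly empty parts \<open>S 0, \<dots>, S (k - 1)\<close>.
\<close>

definition ordered_partitions :: "nat \<Rightarrow> nat \<Rightarrow> (nat \<Rightarrow> nat set) set" where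
  "ordered_partitions k n =
     {S \<in> {..<k} \<rightarrow>\<^sub>E Pow {..<n}. disjoint_family_on S {..<k} \<and> (\<Union>j<k. S j) = {..<n}}"

text \<open>
  The normalized mixed determinantal polynomial of a list of \<open>n \<times> n\<close> matrices. The term
  \<^term>\<open>submatrix A S S\<close> is the principal submatrix of \<open>A\<close> indexed by \<open>S\<close>; for empty \<open>S\<close> it is the
  \<open>0 \<times> 0\<close> matrix, whose characteristic polynomial is \<open>1\<close>.
\<close>

definition mixed_det_poly :: "nat \<Rightarrow> 'a :: field_char_0 mat list \<Rightarrow> 'a poly" where
  "mixed_det_poly n As =
     Polynomial.smult (inverse (of_nat (length As) ^ n))
       (\<Sum>S \<in> ordered_partitions (length As) n.
          \<Prod>j<length As. char_poly (submatrix (As ! j) (S j) (S j)))"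

definition max_root :: "real poly \<Rightarrow> real" where
  "max_root p = Max {x. poly p x = 0}"

definition mixed_root :: "nat \<Rightarrow> real mat \<Rightarrow> real" where
  "mixed_root n A = max_root (mixed_det_poly n [A, - A])"

text \<open>
  The library's spectral radius is defined for complex matrices.
\<close>

definition real_spectral_radius :: "real mat \<Rightarrow> real" where
  "real_spectral_radius A = spectral_radius (map_mat complex_of_real A)"

end

theory Submission
  imports "HOL-Complex_Analysis.Complex_Analysis" Defs
begin

text \<open>
  Let \<open>c(I)\<close> and \<open>c'(J)\<close> be the principal minors of \<open>-A\<close> and \<open>A\<close>. The polynomials
  \<open>p\<^sub>X(y) = \<Sum> c(I) c'(J) X\<^bsup>|I \<inter> J|\<^esup> y\<^bsup>2n - |I| - |J|\<^esup>\<close> interpolate between the rescaled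
  mixed determinantal polynomial (\<open>X = 0\<close>) and \<open>det(y - A) det(y + A)\<close> (\<open>X = 1\<close>). Isolating a vertex
  gives \<open>p\<^sub>X = y\<^sup>2 L - y N + X E\<close>, where stability makes \<open>N/E\<close> and \<open>L/N\<close> functions of Nevanlinna
  type; their first two moments at infinity, computed from walks of length at most four, bound \<open>E\<close>
  from below by a multiple of \<open>N\<close> above the largest root. This controls the derivative of
  \<open>p\<^sub>X(Y(X))\<close> along an explicit decreasing curve \<open>Y\<close> and shows that the largest root stays below
  \<open>Y\<close>, for degree at least 6; for smaller degrees the spectral radius is at most \<open>d\<close>.

  A signing with \<open>r\<^sup>2 \<le> 2(d - 1)\<close> is found edge by edge: the polynomial at \<open>X = 0\<close>, corrected by a
  term for the edge, is affine in the real value of that edge and stays real-rooted for values in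
  \<open>[-1, 1]\<close>. With all edges at 0 it is a weighted matching polynomial, to which the Heilmann-Lieb
  bound applies.
\<close>

section \<open>Nevanlinna functions and stability\<close>

text \<open>The obstacle is that the moments of \<open>N / E\<close> involve signed walk counts at a
  vertex, on which a signing gives no a priori control. The same stability, applied to
  \<open>L / N\<close>, bounds the main count \<open>w\<close> by the current \<open>y^2\<close>;
  then every graph-dependent term can be eliminated, and only \<open>D\<close>, \<open>X\<close> and
  \<open>y\<close> remain.

  Origin of the constants: roots of the mixed polynomial appear doubled, so
  \<open>r^2 <= 2 (d - 1)\<close> reads \<open>y^2 <= 8 (d - 1)\<close>. For
  \<open>q = Y^2 / (d - 1)\<close> and large degree the flow condition becomes
  \<open>- q' <= q / (q - 1)\<close>. Equality from \<open>q = 8\<close> ends near 6.844, slightly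
  below \<open>((3 + sqrt 5) / 2)^2 = 6.8541...\<close>, and a quadratic curve with rounded
  coefficients fits into this gap. The degree threshold is the first \<open>d\<close> at which
  \<open>d^2\<close> exceeds the target.

  In the search for a signing, an edge can sit in \<open>I\<close> or in \<open>J\<close>, so its
  quadratic term has weight 2. Pending edges therefore carry weight 2, and the Heilmann-Lieb radius
  for this weight is \<open>2 * sqrt (2 * (d - 1))\<close>, which is the same 8 again.\<close>

lemma Im_inverse_neg: "Im z > 0 \<Longrightarrow> Im (1 / z) < 0"
proof -
  assume "Im z > 0"
  then have "(Re z)\<^sup>2 + (Im z)\<^sup>2 > 0"
    by (simp add: add_nonneg_pos)
  with \<open>Im z > 0\<close> show ?thesis
    by (simp add: Im_divide divide_neg_pos)
qed

lemma Im_divide_of_real [simp]: "Im (z / of_real r) = Im z / r"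
  by (simp add: Im_divide power2_eq_square)

lemma Im_inverse_pos: "Im z < 0 \<Longrightarrow> Im (1 / z) > 0"
  using Im_inverse_neg[of "- z"] by simp

text \<open>Dividing by \<open>\<tau> * u * v\<close> gives
  \<open>1 / \<tau> + 1 / u + 1 / v\<close>. Reciprocals of points in the upper half-plane lie in
  the lower one, so these terms cannot cancel.\<close>

lemma parallel_sum_nonzero:
  fixes u v \<tau> :: complex
  assumes u: "Im u > 0" and v: "Im v > 0" and t: "\<tau> = 0 \<or> Im \<tau> > 0"
  shows "u * v + \<tau> * (u + v) \<noteq> 0"
proof
  assume eq: "u * v + \<tau> * (u + v) = 0"
  have u0: "u \<noteq> 0" and v0: "v \<noteq> 0" using u v by auto
  show False
  proof (cases "\<tau> = 0")
    case True
    then show ?thesis using eq u0 v0 by simp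
  next
    case False
    have "1 / \<tau> + 1 / u + 1 / v = (u * v + \<tau> * (u + v)) / (\<tau> * u * v)"
      using u0 v0 False by (simp add: field_simps)
    then have "Im (1 / \<tau>) + Im (1 / u) + Im (1 / v) = 0"
      using eq by (metis div_0 plus_complex.simps(2) zero_complex.simps(2))
    moreover have "Im (1 / \<tau>) < 0" "Im (1 / u) < 0" "Im (1 / v) < 0"
      using Im_inverse_neg u v t False by auto
    ultimately show False by linarith
  qed
qed

lemma quadratic_factor:
  fixes p q :: complex
  obtains a b where "\<And>z. z\<^sup>2 + p * z + q = (z - a) * (z - b)"
proof -
  define s where "s = csqrt (p\<^sup>2 - 4 * q)"
  have s: "s\<^sup>2 = p\<^sup>2 - 4 * q" by (simp add: s_def)
  have "z\<^sup>2 + p * z + q = (z - (- p + s) / 2) * (z - (- p - s) / 2)" for z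
  proof -
    have "(z - (- p + s) / 2) * (z - (- p - s) / 2) = z\<^sup>2 + p * z + (p\<^sup>2 - s\<^sup>2) / 4"
      by (simp add: field_simps power2_eq_square)
    then show ?thesis unfolding s by simp
  qed
  then show ?thesis using that by blast
qed

lemma sum_of_roots:
  fixes a b S :: "'a :: comm_ring_1"
  assumes "1 + S + a * b = (1 - a) * (1 - b)"
  shows "S = - (a + b)"
proof -
  have "S = (1 + S + a * b) - 1 - a * b" by simp
  also have "\<dots> = - (a + b)" unfolding assms by (simp add: algebra_simps)
  finally show ?thesis .
qed

text \<open>On the diagonal \<open>x = y\<close> the form is a quadratic whose roots
  \<open>a\<close>, \<open>b\<close> lie in the closed lower half-plane. With
  \<open>\<sigma> = sqrt (1 - X)\<close>, the substitution
  \<open>z = \<zeta> / (1 + \<sigma>)\<close>, \<open>\<tau> = \<zeta> * \<sigma> / X\<close>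
  satisfies \<open>z + \<tau> = \<zeta> / X\<close> and
  \<open>z^2 + 2 * \<tau> * z = \<zeta>^2 / X\<close>. It turns the claim, divided by
  \<open>X * L\<close>, into the parallel sum of \<open>z - a\<close>, \<open>z - b\<close> and
  \<open>\<tau>\<close>.\<close>

lemma contraction_nonzero:
  fixes L P Q B \<zeta> :: complex and X :: real
  assumes g: "\<And>x y. Im x > 0 \<Longrightarrow> Im y > 0 \<Longrightarrow> x * y * L + y * P + x * Q + B \<noteq> 0"
    and z: "Im \<zeta> > 0" and X: "0 < X" "X \<le> 1"
  shows "\<zeta>\<^sup>2 * L + \<zeta> * P + \<zeta> * Q + of_real X * B \<noteq> 0"
proof (cases "L = 0")
  case True
  \<comment> \<open>Without quadratic term the target is \<open>X\<close> times the form at the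
    rescaled point \<open>\<zeta> / X\<close>.\<close>
  have "Im (\<zeta> / of_real X) > 0" using z X by simp
  from g[OF this this] show ?thesis using True X by (auto simp: field_simps)
next
  case False
  obtain a b where ab: "\<And>z. z\<^sup>2 + ((P + Q) / L) * z + B / L = (z - a) * (z - b)"
    using quadratic_factor by blast
  have G: "z * z * L + z * P + z * Q + B = L * ((z - a) * (z - b))" for z
    using False by (simp add: ab[symmetric] field_simps power2_eq_square)
  have a: "Im a \<le> 0" using g[of a a] unfolding G by force
  have b: "Im b \<le> 0" using g[of b b] unfolding G by force
  have pq: "(P + Q) / L = - (a + b)" "B / L = a * b"
  proof -
    show q: "B / L = a * b" using ab[of 0] by simp
    have "1 + (P + Q) / L + a * b = (1 - a) * (1 - b)" using ab[of 1] q by simp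
    then show "(P + Q) / L = - (a + b)" by (rule sum_of_roots)
  qed
  define \<sigma> where "\<sigma> = sqrt (1 - X)"
  have s: "0 \<le> \<sigma>" "\<sigma> < 1" "\<sigma>\<^sup>2 = 1 - X" using X by (auto simp: \<sigma>_def)
  have X1: "X = (1 - \<sigma>) * (1 + \<sigma>)" using s(3) by (simp add: algebra_simps power2_eq_square)
  define z where "z = \<zeta> / of_real (1 + \<sigma>)"
  define \<tau> where "\<tau> = \<zeta> * of_real \<sigma> / of_real X"
  have zt: "z + \<tau> = \<zeta> / of_real X"
  proof -
    have "1 / (1 + \<sigma>) = (1 - \<sigma>) / X" unfolding X1 using s by simp
    then have "1 / (1 + \<sigma>) + \<sigma> / X = 1 / X" by (simp add: add_divide_distrib[symmetric])
    then have "(of_real (1 / (1 + \<sigma>)) + of_real (\<sigma> / X) :: complex) = of_real (1 / X)"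
      by (metis of_real_add)
    then have "\<zeta> * (of_real (1 / (1 + \<sigma>)) + of_real (\<sigma> / X)) = \<zeta> * of_real (1 / X)" by simp
    then show ?thesis by (simp add: z_def \<tau>_def algebra_simps)
  qed
  have "(z + \<tau>)\<^sup>2 - \<tau>\<^sup>2 = \<zeta>\<^sup>2 * of_real (1 - \<sigma>\<^sup>2) / of_real (X\<^sup>2)"
    unfolding zt by (simp add: \<tau>_def power_divide power_mult_distrib diff_divide_distrib algebra_simps)
  also have "\<dots> = \<zeta>\<^sup>2 / of_real X" using s X by (simp add: power2_eq_square)
  finally have zt2: "z\<^sup>2 + 2 * \<tau> * z = \<zeta>\<^sup>2 / of_real X" by (simp add: power2_sum mult_ac)
  have Imz: "Im z > 0" using z s by (simp add: z_def del: of_real_add)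
  have "(z - a) * (z - b) + \<tau> * ((z - a) + (z - b)) \<noteq> 0"
  proof (rule parallel_sum_nonzero)
    show "Im (z - a) > 0" "Im (z - b) > 0" using Imz a b by auto
    show "\<tau> = 0 \<or> Im \<tau> > 0"
      using s z X by (cases "\<sigma> = 0") (auto simp: \<tau>_def)
  qed
  also have "(z - a) * (z - b) + \<tau> * ((z - a) + (z - b))
      = (z\<^sup>2 + 2 * \<tau> * z) - (a + b) * (z + \<tau>) + a * b"
    by (simp add: algebra_simps power2_eq_square)
  also have "\<dots> = (\<zeta>\<^sup>2 * L + \<zeta> * P + \<zeta> * Q + of_real X * B) / (of_real X * L)"
  proof -
    have "P + Q = - (a + b) * L" and B: "B = a * b * L" using pq False by (simp_all add: divide_eq_eq)
    then have P: "P = - (a + b) * L - Q" by (simp only: eq_diff_eq)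
    show ?thesis unfolding zt zt2 P B using False X by (simp add: field_simps)
  qed
  finally show ?thesis by auto
qed

text \<open>The case \<open>X = 0\<close> after division by \<open>\<zeta>\<close>: the value is
  \<open>L * (\<zeta> - (a + b))\<close> with \<open>a\<close>, \<open>b\<close> in the closed lower
  half-plane. A constant form has \<open>L = P = Q = 0\<close>, so \<open>L \<noteq> 0\<close> is a
  real condition; it comes from the sum over one vertex less.\<close>

lemma contraction_nonzero_0:
  fixes L P Q B \<zeta> :: complex
  assumes g: "\<And>x y. Im x > 0 \<Longrightarrow> Im y > 0 \<Longrightarrow> x * y * L + y * P + x * Q + B \<noteq> 0"
    and z: "Im \<zeta> > 0" and L: "L \<noteq> 0"
  shows "\<zeta> * L + P + Q \<noteq> 0"
proof -
  obtain a b where ab: "\<And>z. z\<^sup>2 + ((P + Q) / L) * z + B / L = (z - a) * (z - b)"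
    using quadratic_factor by blast
  have G: "z * z * L + z * P + z * Q + B = L * ((z - a) * (z - b))" for z
    using L by (simp add: ab[symmetric] field_simps power2_eq_square)
  have a: "Im a \<le> 0" using g[of a a] unfolding G by force
  have b: "Im b \<le> 0" using g[of b b] unfolding G by force
  have q: "B / L = a * b" using ab[of 0] by simp
  have "1 + (P + Q) / L + a * b = (1 - a) * (1 - b)" using ab[of 1] q by simp
  then have "(P + Q) / L = - (a + b)" by (rule sum_of_roots)
  then have "P + Q = - (a + b) * L" using L by (simp add: divide_eq_eq)
  then have "\<zeta> * L + P + Q = L * (\<zeta> - (a + b))"
    by (simp only: add.assoc) (simp add: algebra_simps)
  moreover have "Im (\<zeta> - (a + b)) > 0" using a b z by simp
  ultimately show ?thesis using L by force
qed

text \<open>The derivative at a real point can be computed along the vertical direction. There the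
  increment of \<open>f\<close> has nonpositive imaginary part, and division by
  \<open>\<i> * \<epsilon>\<close> turns this into a nonpositive real part.\<close>

lemma nonincreasing_on_reals:
  fixes f :: "complex \<Rightarrow> complex" and a :: real
  assumes diff: "\<And>x. x > a \<Longrightarrow> f field_differentiable at (of_real x)"
    and re: "\<And>x. x > a \<Longrightarrow> Im (f (of_real x)) = 0"
    and im: "\<And>z. Im z > 0 \<Longrightarrow> Im (f z) \<le> 0"
    and xy: "a < x" "x \<le> y"
  shows "Re (f (of_real y)) \<le> Re (f (of_real x))"
proof -
  have D: "\<exists>D. ((\<lambda>t. Re (f (of_real t))) has_real_derivative D) (at t) \<and> D \<le> 0" if t: "t > a" for t
  proof -
    obtain D where D: "(f has_field_derivative D) (at (of_real t))"
      using diff[OF t] unfolding field_differentiable_def by blast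
    have "((\<lambda>h. (f (of_real t + h) - f (of_real t)) / h) \<longlongrightarrow> D) (at 0)"
      using D by (simp add: DERIV_def)
    moreover have "filterlim (\<lambda>\<epsilon>. \<i> * of_real \<epsilon>) (at (0::complex)) (at_right (0::real))"
      unfolding filterlim_at
    proof
      show "\<forall>\<^sub>F x in at_right (0::real). \<i> * complex_of_real x \<in> UNIV \<and> \<i> * complex_of_real x \<noteq> 0"
        by (auto simp: eventually_at_right_less eventually_at_filter)
      have "((\<lambda>x. \<i> * complex_of_real x) \<longlongrightarrow> \<i> * of_real 0) (at_right 0)"
        by (intro tendsto_intros)
      then show "((\<lambda>x. \<i> * complex_of_real x) \<longlongrightarrow> 0) (at_right 0)" by simp
    qed
    ultimately have "((\<lambda>\<epsilon>. (f (of_real t + \<i> * of_real \<epsilon>) - f (of_real t)) / (\<i> * of_real \<epsilon>)) \<longlongrightarrow> D) (at_right 0)"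
      by (rule filterlim_compose)
    then have lim: "((\<lambda>\<epsilon>. Re ((f (of_real t + \<i> * of_real \<epsilon>) - f (of_real t)) / (\<i> * of_real \<epsilon>))) \<longlongrightarrow> Re D) (at_right 0)"
      by (rule tendsto_Re)
    have "Re D \<le> 0"
    proof (rule tendsto_upperbound[OF lim])
      show "\<forall>\<^sub>F \<epsilon> in at_right 0. Re ((f (of_real t + \<i> * of_real \<epsilon>) - f (of_real t)) / (\<i> * of_real \<epsilon>)) \<le> 0"
        unfolding eventually_at_right_field
      proof (intro exI[of _ 1] conjI allI impI)
        fix \<epsilon> :: real assume e: "0 < \<epsilon>" "\<epsilon> < 1"
        define w where "w = f (of_real t + \<i> * of_real \<epsilon>) - f (of_real t)"
        have "Im w \<le> 0" using im[of "of_real t + \<i> * of_real \<epsilon>"] re[OF t] e by (simp add: w_def)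
        moreover have "w / (\<i> * of_real \<epsilon>) = (- \<i> * w) / of_real \<epsilon>"
          by (simp add: divide_inverse mult_ac)
        then have "Re (w / (\<i> * of_real \<epsilon>)) = Im w / \<epsilon>"
          by (simp add: Re_divide_of_real)
        ultimately show "Re ((f (of_real t + \<i> * of_real \<epsilon>) - f (of_real t)) / (\<i> * of_real \<epsilon>)) \<le> 0"
          using e by (simp add: w_def divide_nonpos_pos)
      qed simp
    qed simp
    moreover have "((\<lambda>t. Re (f (of_real t))) has_real_derivative Re D) (at t)"
    proof -
      have "((\<lambda>t. f (of_real t)) has_vector_derivative D) (at t)"
        using has_vector_derivative_real_field[OF D] .
      then have "((\<lambda>t. Re (f (of_real t))) has_vector_derivative Re D) (at t)"
        using bounded_linear.has_vector_derivative[OF bounded_linear_Re] by fastforce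
      then show ?thesis by (simp add: has_real_derivative_iff_has_vector_derivative)
    qed
    ultimately show ?thesis by blast
  qed
  show ?thesis
    by (rule DERIV_nonpos_imp_nonincreasing[OF xy(2)]) (use D xy in force)
qed

text \<open>The function \<open>exp (\<i> * (f z - z))\<close> has modulus
  \<open>exp (Im z - Im (f z))\<close>. On a disc cut off slightly above the real axis, the frontier
  is harmless: on the segment \<open>Im z\<close> is small and \<open>Im (f z)\<close> is
  nonnegative, on the arc \<open>f z - z\<close> is small. The maximum modulus principle carries the
  estimate inside.\<close>

lemma Nevanlinna_subtract:
  fixes f :: "complex \<Rightarrow> complex"
  assumes hol: "f holomorphic_on {z. Im z > 0}"
    and pos: "\<And>z. Im z > 0 \<Longrightarrow> Im (f z) \<ge> 0"
    and lim: "((\<lambda>z. f z - z) \<longlongrightarrow> 0) at_infinity"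
    and w: "Im w > 0"
  shows "Im (f w) \<ge> Im w"
proof (rule ccontr)
  assume "\<not> ?thesis"
  then have neg: "Im w - Im (f w) > 0" by simp
  define \<eta> where "\<eta> = (Im w - Im (f w)) / 2"
  have \<eta>: "\<eta> > 0" using neg by (simp add: \<eta>_def)
  define \<epsilon> where "\<epsilon> = min (Im w / 2) \<eta>"
  have \<epsilon>: "0 < \<epsilon>" "\<epsilon> < Im w" "\<epsilon> \<le> \<eta>" using w \<eta> by (auto simp: \<epsilon>_def)
  have "\<forall>\<^sub>F z in at_infinity. dist (f z - z) 0 < \<eta>" using lim \<eta> by (rule tendstoD)
  then obtain R where R: "\<And>z. norm z \<ge> R \<Longrightarrow> norm (f z - z) < \<eta>"
    by (auto simp: eventually_at_infinity)
  define M where "M = max R (norm w + 1)"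
  define S where "S = {z. Im z > \<epsilon>} \<inter> ball 0 M"
  define g where "g z = exp (\<i> * (f z - z))" for z
  have opS: "open S" unfolding S_def by (intro open_Int open_halfspace_Im_gt open_ball)
  have cl: "closure S \<subseteq> {z. Im z \<ge> \<epsilon>} \<inter> cball 0 M"
    unfolding S_def by (rule closure_minimal)
      (auto intro!: closed_Int closed_halfspace_Im_ge simp: less_imp_le)
  have holg: "g holomorphic_on {z. Im z > 0}" unfolding g_def by (intro holomorphic_intros hol)
  have "norm (g w) \<le> exp \<eta>"
  proof (rule maximum_modulus_frontier[where S = S and f = g and \<xi> = w])
    show "g holomorphic_on interior S"
      by (rule holomorphic_on_subset[OF holg]) (unfold interior_open[OF opS], use \<epsilon> in \<open>auto simp: S_def\<close>)
    show "continuous_on (closure S) g"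
      by (rule continuous_on_subset[OF holomorphic_on_imp_continuous_on[OF holg]]) (use cl \<epsilon> in auto)
    show "bounded S" by (rule bounded_subset[of "ball 0 M"]) (auto simp: S_def)
    show "w \<in> S" using \<epsilon> by (auto simp: S_def M_def)
    fix z assume "z \<in> frontier S"
    then have z1: "z \<in> closure S" and z2: "z \<notin> S" using opS by (auto simp: frontier_def interior_open)
    have zi: "Im z \<ge> \<epsilon>" "norm z \<le> M" using z1 cl by auto
    consider "Im z = \<epsilon>" | "norm z = M" using zi z2 by (force simp: S_def)
    then have "Im z - Im (f z) \<le> \<eta>"
    proof cases
      case 1
      then show ?thesis using pos[of z] \<epsilon> by simp
    next
      case 2
      then have "norm (f z - z) < \<eta>" using R by (simp add: M_def)
      then show ?thesis using abs_Im_le_cmod[of "f z - z"] by simp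
    qed
    then show "norm (g z) \<le> exp \<eta>" by (simp add: g_def)
  qed
  then have "Im w - Im (f w) \<le> \<eta>" by (simp add: g_def)
  then show False using neg by (simp add: \<eta>_def)
qed

lemma nonneg_if_nonincreasing:
  fixes f :: "real \<Rightarrow> real"
  assumes mono: "\<And>x y. a < x \<Longrightarrow> x \<le> y \<Longrightarrow> f y \<le> f x"
    and lim: "(f \<longlongrightarrow> l) at_top" and x: "a < x"
  shows "l \<le> f x"
  by (rule tendsto_upperbound[OF lim])
    (use mono x in \<open>auto intro!: eventually_at_top_linorderI[of x]\<close>)

text \<open>
  \<open>Nevanlinna_subtract\<close> is applied twice, to \<open>\<mu> Q/P\<close> and to the remainder of its continued fraction.
\<close>

lemma Nevanlinna_bound:
  fixes P Q :: "complex \<Rightarrow> complex" and p q :: "real \<Rightarrow> real"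
  assumes hol: "P holomorphic_on UNIV" "Q holomorphic_on UNIV"
    and re: "\<And>x. P (of_real x) = of_real (p x)" "\<And>x. Q (of_real x) = of_real (q x)"
    and im: "\<And>z. Im z > 0 \<Longrightarrow> Im (Q z / P z) > 0"
    and a: "a \<ge> 0" and pp: "\<And>x. x > a \<Longrightarrow> p x > 0" and qp: "\<And>x. x > a \<Longrightarrow> q x > 0"
    and \<mu>: "\<mu> > 0"
    and lim: "((\<lambda>z. z * (z * (z - of_real \<mu> * (Q z / P z)) - of_real v)) \<longlongrightarrow> 0) at_infinity"
    and x: "x > a" and v0: "v0 \<le> v"
  shows "\<mu> * x * q x \<le> (x\<^sup>2 - v0) * p x"
proof -
  define H where "H = {z. Im z > 0}"
  have H: "open H" "connected H" unfolding H_def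
    by (auto intro: open_halfspace_Im_gt convex_connected convex_halfspace_Im_gt)
  have P0: "P z \<noteq> 0" and Q0: "Q z \<noteq> 0" if "z \<in> H" for z using im[of z] that by (auto simp: H_def)
  define f1 where "f1 z = of_real \<mu> * (Q z / P z)" for z
  define g1 where "g1 z = z - f1 z" for z
  have hf1: "f1 holomorphic_on H" unfolding f1_def
    by (intro holomorphic_intros holomorphic_on_subset[OF hol(1)] holomorphic_on_subset[OF hol(2)]) (use P0 in auto)
  have inv: "((\<lambda>z::complex. 1 / z) \<longlongrightarrow> 0) at_infinity"
    using tendsto_inverse_0 by (simp add: divide_inverse)
  have nz: "\<forall>\<^sub>F z::complex in at_infinity. z \<noteq> 0" by (rule eventually_not_equal_at_infinity)
  have l2: "((\<lambda>z. z * g1 z) \<longlongrightarrow> of_real v) at_infinity"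
  proof -
    have "((\<lambda>z. (1 / z) * (z * (z * g1 z - of_real v)) + of_real v) \<longlongrightarrow> 0 * 0 + of_real v) at_infinity"
      using lim by (intro tendsto_intros inv) (simp add: g1_def f1_def)
    moreover have "\<forall>\<^sub>F z in at_infinity. (1 / z) * (z * (z * g1 z - of_real v)) + of_real v = z * g1 z"
      using nz by eventually_elim simp
    ultimately show ?thesis by (simp add: tendsto_cong)
  qed
  have l1: "(g1 \<longlongrightarrow> 0) at_infinity"
  proof -
    have "((\<lambda>z. (1 / z) * (z * g1 z)) \<longlongrightarrow> 0 * of_real v) at_infinity" by (intro tendsto_mult inv l2)
    moreover have "\<forall>\<^sub>F z in at_infinity. (1 / z) * (z * g1 z) = g1 z" using nz by eventually_elim simp
    ultimately show ?thesis by (simp add: tendsto_cong)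
  qed
  have im1: "Im (g1 z) \<le> 0" if "Im z > 0" for z
  proof -
    have "Im (f1 z) \<ge> Im z"
    proof (rule Nevanlinna_subtract)
      show "f1 holomorphic_on {z. Im z > 0}" using hf1 by (simp add: H_def)
      show "Im (f1 z) \<ge> 0" if "Im z > 0" for z using im[OF that] \<mu> by (simp add: f1_def less_imp_le del: times_divide_eq_right)
      have "((\<lambda>z. - g1 z) \<longlongrightarrow> - 0) at_infinity" by (intro tendsto_minus l1)
      then show "((\<lambda>z. f1 z - z) \<longlongrightarrow> 0) at_infinity" by (simp add: g1_def)
    qed (fact that)
    then show ?thesis by (simp add: g1_def)
  qed
  have dP: "P field_differentiable at z" "Q field_differentiable at z" for z
    using hol by (auto simp: holomorphic_on_def)
  have Pr: "P (of_real x) \<noteq> 0" if "x > a" for x using pp[OF that] re(1)[of x] by simp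
  have d1: "g1 field_differentiable at (of_real x)" if "x > a" for x
    unfolding g1_def f1_def by (intro derivative_intros dP) (use Pr that in auto)
  have r1: "g1 (of_real x) = of_real (x - \<mu> * q x / p x)" for x by (simp add: g1_def f1_def re)
  have top: "filterlim (of_real :: real \<Rightarrow> complex) at_infinity at_top"
    by (rule filterlim_of_real_at_infinity)
  have l1r: "((\<lambda>x. Re (g1 (of_real x))) \<longlongrightarrow> 0) at_top"
    using tendsto_Re[OF filterlim_compose[OF l1 top]] by simp
  have mono1: "Re (g1 (of_real y)) \<le> Re (g1 (of_real x))" if "a < x" "x \<le> y" for x y
    by (rule nonincreasing_on_reals[OF d1 _ im1 that]) (auto simp: r1)
  have first: "x - \<mu> * q x / p x \<ge> 0" if "x > a" for x
    using nonneg_if_nonincreasing[of a "\<lambda>x. Re (g1 (of_real x))", OF mono1 l1r that] by (simp add: r1)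
  show ?thesis
  proof (cases "v > 0")
    case False
    \<comment> \<open>For \<open>v \<le> 0\<close> the first of the two subtractions already
      suffices.\<close>
    have "\<mu> * q x \<le> x * p x" using first[OF x] pp[OF x] by (simp add: field_simps)
    then have "x * (\<mu> * q x) \<le> x * (x * p x)" using x a by (intro mult_left_mono) auto
    moreover have "v0 * p x \<le> 0" using v0 False pp[OF x] by (simp add: mult_nonpos_nonneg)
    ultimately show ?thesis by (simp add: algebra_simps power2_eq_square)
  next
    case True
    have l2r: "((\<lambda>x. x * Re (g1 (of_real x))) \<longlongrightarrow> v) at_top"
      using tendsto_Re[OF filterlim_compose[OF l2 top]] by simp
    have g1pos: "Re (g1 (of_real x)) > 0" if "x > a" for x
    proof -
      have "\<forall>\<^sub>F y in at_top. y * Re (g1 (of_real y)) > 0" using order_tendstoD(1)[OF l2r True] .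
      then have "\<forall>\<^sub>F y in at_top. y * Re (g1 (of_real y)) > 0 \<and> y \<ge> max x 1"
        using eventually_ge_at_top by (rule eventually_conj)
      then obtain y where "y * Re (g1 (of_real y)) > 0" "y \<ge> max x 1"
        using eventually_happens'[OF trivial_limit_at_top_linorder] by blast
      then have "Re (g1 (of_real y)) > 0" "y \<ge> x" by (auto simp: zero_less_mult_iff)
      then show ?thesis using mono1[OF that, of y] by linarith
    qed
    have hg1: "g1 holomorphic_on H" unfolding g1_def by (intro holomorphic_intros hf1)
    \<comment> \<open>A constant \<open>g1\<close> would be its limit 0, while
      \<open>z * g1 z\<close> tends to \<open>v > 0\<close>. Being nonconstant, \<open>g1\<close> is
      an open map, so \<open>Im (g1 z) \<le> 0\<close> becomes strict and \<open>1 / g1\<close> is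
      defined on the half-plane.\<close>
    have nc: "\<not> g1 constant_on H"
    proof
      assume "g1 constant_on H"
      then obtain c where c: "\<And>z. z \<in> H \<Longrightarrow> g1 z = c" by (auto simp: constant_on_def)
      have top': "filterlim (\<lambda>x::real. \<i> * of_real x) at_infinity at_top"
        unfolding filterlim_at_infinity_conv_norm_at_top
        by (simp add: norm_mult filterlim_abs_real)
      have ev: "\<forall>\<^sub>F x in at_top. g1 (\<i> * of_real x) = c"
        using eventually_gt_at_top[of "0::real"] by eventually_elim (rule c, simp add: H_def)
      have "((\<lambda>x. g1 (\<i> * of_real x)) \<longlongrightarrow> 0) at_top" using filterlim_compose[OF l1 top'] .
      then have "((\<lambda>x::real. c) \<longlongrightarrow> 0) at_top" using tendsto_cong[OF ev] by blast
      then have c0: "c = 0" by (simp add: tendsto_const_iff)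
      have lv: "((\<lambda>x. (\<i> * of_real x) * g1 (\<i> * of_real x)) \<longlongrightarrow> of_real v) at_top" using filterlim_compose[OF l2 top'] .
      have ev0: "\<forall>\<^sub>F x in at_top. (\<i> * of_real x) * g1 (\<i> * of_real x) = 0"
        using ev by eventually_elim (simp add: c0)
      have "((\<lambda>x::real. 0) \<longlongrightarrow> complex_of_real v) at_top" using lv tendsto_cong[OF ev0] by blast
      then show False using True by (simp add: tendsto_const_iff)
    qed
    have im1': "Im (g1 z) < 0" if "Im z > 0" for z
    proof (rule ccontr)
      assume "\<not> Im (g1 z) < 0"
      then have z0: "Im (g1 z) = 0" using im1[OF that] by simp
      have "open (g1 ` H)" by (rule open_mapping_thm[OF hg1 H H(1) _ nc]) auto
      moreover have "g1 z \<in> g1 ` H" using that by (auto simp: H_def)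
      ultimately obtain e where e: "e > 0" "ball (g1 z) e \<subseteq> g1 ` H" by (auto simp: open_contains_ball)
      have "g1 z + \<i> * of_real (e / 2) \<in> ball (g1 z) e" using e by (simp add: dist_norm norm_mult)
      then obtain u where "u \<in> H" "g1 u = g1 z + \<i> * of_real (e / 2)" using e by (metis imageE subsetD)
      then show False using im1[of u] z0 e by (simp add: H_def)
    qed
    \<comment> \<open>Second level of the continued fraction: \<open>g1 z\<close> behaves like
      \<open>v / z\<close>, so \<open>v / g1 z\<close> is asymptotic to \<open>z\<close>
      again.\<close>
    define f2 where "f2 z = of_real v * (1 / g1 z)" for z
    define g2 where "g2 z = z - f2 z" for z
    have g10: "g1 z \<noteq> 0" if "z \<in> H" for z using im1'[of z] that by (auto simp: H_def)
    have l3: "(g2 \<longlongrightarrow> 0) at_infinity"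
    proof -
      have "((\<lambda>z. (z * (z * g1 z - of_real v)) / (z * g1 z)) \<longlongrightarrow> 0 / of_real v) at_infinity"
        by (intro tendsto_divide l2) (use lim True in \<open>auto simp: g1_def f1_def\<close>)
      moreover have "\<forall>\<^sub>F z in at_infinity. (z * (z * g1 z - of_real v)) / (z * g1 z) = g2 z"
      proof -
        have "\<forall>\<^sub>F z in at_infinity. z * g1 z \<noteq> 0"
          using tendsto_imp_eventually_ne[OF l2, of 0] True by simp
        then show ?thesis by eventually_elim (simp add: g2_def f2_def field_simps)
      qed
      ultimately show ?thesis by (simp add: tendsto_cong)
    qed
    have im2: "Im (g2 z) \<le> 0" if "Im z > 0" for z
    proof -
      have "Im (f2 z) \<ge> Im z"
      proof (rule Nevanlinna_subtract)
        show "f2 holomorphic_on {z. Im z > 0}" unfolding f2_def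
          using hg1 g10 by (intro holomorphic_intros) (auto simp: H_def)
        show "Im (f2 z) \<ge> 0" if "Im z > 0" for z
          using Im_inverse_pos[OF im1'[OF that]] True by (simp add: f2_def less_imp_le del: times_divide_eq_right)
        have "((\<lambda>z. - g2 z) \<longlongrightarrow> - 0) at_infinity" by (intro tendsto_minus l3)
        then show "((\<lambda>z. f2 z - z) \<longlongrightarrow> 0) at_infinity" by (simp add: g2_def)
      qed (fact that)
      then show ?thesis by (simp add: g2_def)
    qed
    have d2: "g2 field_differentiable at (of_real x)" if "x > a" for x
      unfolding g2_def f2_def using g1pos[OF that]
      by (intro derivative_intros d1 that) auto
    have r2: "g2 (of_real x) = of_real (x - v / (x - \<mu> * q x / p x))" for x
      by (simp add: g2_def f2_def r1)
    have mono2: "Re (g2 (of_real y)) \<le> Re (g2 (of_real x))" if "a < x" "x \<le> y" for x y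
      by (rule nonincreasing_on_reals[OF d2 _ im2 that]) (auto simp: r2)
    have l3r: "((\<lambda>x. Re (g2 (of_real x))) \<longlongrightarrow> 0) at_top"
      using tendsto_Re[OF filterlim_compose[OF l3 top]] by simp
    have "x - v / (x - \<mu> * q x / p x) \<ge> 0"
      using nonneg_if_nonincreasing[of a "\<lambda>x. Re (g2 (of_real x))", OF mono2 l3r x] by (simp add: r2)
    moreover have g: "x - \<mu> * q x / p x > 0" using g1pos[OF x] by (simp add: r1)
    ultimately have "v \<le> x * (x - \<mu> * q x / p x)" by (simp add: field_simps)
    then have "v * p x \<le> x * (x - \<mu> * q x / p x) * p x" using pp[OF x] by (intro mult_right_mono) auto
    also have "\<dots> = x\<^sup>2 * p x - \<mu> * x * q x" using pp[OF x] by (simp add: field_simps power2_eq_square)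
    finally have "v * p x \<le> x\<^sup>2 * p x - \<mu> * x * q x" .
    moreover have "v0 * p x \<le> v * p x" using v0 pp[OF x] by (intro mult_right_mono) auto
    ultimately show ?thesis by (simp add: algebra_simps)
  qed
qed

text \<open>Let \<open>b\<close> be the largest zero of \<open>Q\<close>. To its right
  \<open>P / Q\<close> increases, hence is at most \<open>C = P (b + 1) / Q (b + 1)\<close> there;
  letting \<open>t\<close> decrease to \<open>b\<close> in \<open>P t \<le> C * Q t\<close> gives
  \<open>P b \<le> 0\<close>, a contradiction.\<close>

lemma interlacing_pos:
  fixes P Q :: "real \<Rightarrow> real"
  assumes cP: "continuous_on UNIV P" and cQ: "continuous_on UNIV Q"
    and P: "\<And>x. x > a \<Longrightarrow> P x > 0" and Q: "\<forall>\<^sub>F x in at_top. Q x > 0" and fin: "finite {x. Q x = 0}"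
    and mono: "\<And>b x y. b \<ge> a \<Longrightarrow> (\<And>t. t > b \<Longrightarrow> Q t > 0) \<Longrightarrow> b < x \<Longrightarrow> x \<le> y \<Longrightarrow> P x / Q x \<le> P y / Q y"
    and x: "x > a"
  shows "Q x > 0"
proof (rule ccontr)
  assume neg: "\<not> Q x > 0"
  obtain M where M: "\<And>t. t \<ge> M \<Longrightarrow> Q t > 0" using Q by (auto simp: eventually_at_top_linorder)
  define Z where "Z = {t. Q t = 0 \<and> t \<ge> x}"
  have "\<exists>t\<ge>x. t \<le> max M x \<and> Q t = 0"
  proof (rule IVT')
    show "Q x \<le> 0" using neg by simp
    show "0 \<le> Q (max M x)" using M[of "max M x"] by simp
    show "continuous_on {x..max M x} Q" using cQ continuous_on_subset by blast
  qed auto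
  then have Zne: "Z \<noteq> {}" by (auto simp: Z_def)
  have Zfin: "finite Z" by (rule finite_subset[OF _ fin]) (auto simp: Z_def)
  define b where "b = Max Z"
  have bZ: "b \<in> Z" using Zne Zfin by (simp add: b_def)
  then have b: "b \<ge> x" "Q b = 0" by (auto simp: Z_def)
  have Qp: "Q t > 0" if "t > b" for t
  proof (rule ccontr)
    assume "\<not> Q t > 0"
    then have "\<exists>s\<ge>t. s \<le> max M t \<and> Q s = 0"
      using M[of "max M t"] cQ continuous_on_subset by (intro IVT') (auto simp: less_imp_le)
    then obtain s where "s \<ge> t" "Q s = 0" by blast
    then have "s \<in> Z" using that b by (auto simp: Z_def)
    then have "s \<le> b" using Zfin by (simp add: b_def)
    then show False using \<open>s \<ge> t\<close> that by simp
  qed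
  have ba: "b \<ge> a" using b x by simp
  define C where "C = P (b + 1) / Q (b + 1)"
  have ineq: "P t \<le> C * Q t" if "b < t" "t \<le> b + 1" for t
    using mono[OF ba Qp that] Qp[OF that(1)] by (simp add: C_def field_simps)
  have lim: "((\<lambda>t. C * Q t - P t) \<longlongrightarrow> C * Q b - P b) (at_right b)"
  proof -
    have "continuous_on UNIV (\<lambda>t. C * Q t - P t)" using cP cQ by (intro continuous_intros)
    then have "isCont (\<lambda>t. C * Q t - P t) b" by (simp add: continuous_on_eq_continuous_at)
    then show ?thesis by (simp add: isCont_def filterlim_at_split)
  qed
  have "0 \<le> C * Q b - P b"
  proof (rule tendsto_lowerbound[OF lim])
    show "\<forall>\<^sub>F t in at_right b. 0 \<le> C * Q t - P t"
      unfolding eventually_at_right_field by (rule exI[of _ "b + 1"]) (use ineq in force)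
  qed simp
  then show False using b P[of b] x by simp
qed

section \<open>Principal minors and sums over pairs of subsets\<close>

text \<open>A determinant indexed directly by a set of vertices, so that minors on different sets
  can be compared without renumbering rows and columns.\<close>

definition mdet :: "nat set \<Rightarrow> (nat \<Rightarrow> nat \<Rightarrow> 'a :: comm_ring_1) \<Rightarrow> 'a" where
  "mdet S M = (\<Sum>p | p permutes S. of_int (sign p) * (\<Prod>i\<in>S. M i (p i)))"

lemma mdet_det:
  assumes S: "finite S" and f: "bij_betw f {0..<card S} S"
  shows "mdet S M = Determinant.det (mat (card S) (card S) (\<lambda>(i, j). M (f i) (f j)))"
proof -
  define n where "n = card S"
  have f': "bij_betw f {0..<n} S" using f by (simp add: n_def)
  have inj: "inj_on f {0..<n}" using f' by (simp add: bij_betw_def)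
  define g where "g p = map_permutation {0..<n} f p" for p
  have bij: "bij_betw g {p. p permutes {0..<n}} {p. p permutes S}"
  proof (rule bij_betwI[where g = "\<lambda>p. map_permutation S (inv_into {0..<n} f) p"])
    show "g \<in> {p. p permutes {0..<n}} \<rightarrow> {p. p permutes S}"
      using map_permutation_permutes[OF f'] by (auto simp: g_def)
    have f'': "bij_betw (inv_into {0..<n} f) S {0..<n}" using f' by (rule bij_betw_inv_into)
    show "map_permutation S (inv_into {0..<n} f) \<in> {p. p permutes S} \<rightarrow> {p. p permutes {0..<n}}"
      using map_permutation_permutes[OF f''] by auto
    show "map_permutation S (inv_into {0..<n} f) (g p) = p" if "p \<in> {p. p permutes {0..<n}}" for p
      unfolding g_def using that
      by (intro map_permutation_compose_inv[OF f']) (auto simp: inj inv_into_f_f)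
    show "g (map_permutation S (inv_into {0..<n} f) p) = p" if "p \<in> {p. p permutes S}" for p
      unfolding g_def using that f'
      by (intro map_permutation_compose_inv[OF f'']) (auto simp: bij_betw_def f_inv_into_f)
  qed
  have "mdet S M = (\<Sum>p | p permutes {0..<n}. of_int (sign (g p)) * (\<Prod>i\<in>S. M i (g p i)))"
    unfolding mdet_def by (rule sum.reindex_bij_betw[OF bij, symmetric])
  also have "\<dots> = (\<Sum>p | p permutes {0..<n}. of_int (sign p) * (\<Prod>i = 0..<n. M (f i) (f (p i))))"
  proof (rule sum.cong[OF refl])
    fix p assume p: "p \<in> {p. p permutes {0..<n}}"
    have "(\<Prod>i\<in>S. M i (g p i)) = (\<Prod>i = 0..<n. M (f i) (g p (f i)))"
      by (rule prod.reindex_bij_betw[OF f', symmetric])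
    also have "\<dots> = (\<Prod>i = 0..<n. M (f i) (f (p i)))"
      by (rule prod.cong) (auto simp: g_def map_permutation_apply[OF inj])
    finally show "of_int (sign (g p)) * (\<Prod>i\<in>S. M i (g p i)) = of_int (sign p) * (\<Prod>i = 0..<n. M (f i) (f (p i)))"
      using p by (simp add: g_def sign_map_permutation[OF inj])
  qed
  also have "\<dots> = Determinant.det (mat n n (\<lambda>(i, j). M (f i) (f j)))"
    unfolding Determinant.det_def dim_row_mat dim_col_mat if_True simp_thms
  proof (rule sum.cong[OF refl], rule arg_cong2[where f = "(*)", OF refl], rule prod.cong[OF refl])
    fix p i assume "p \<in> {p. p permutes {0..<n}}" "i \<in> {0..<n}"
    then have "p i < n" using permutes_in_image[of p "{0..<n}" i] by simp
    then show "M (f i) (f (p i)) = mat n n (\<lambda>(i, j). M (f i) (f j)) $$ (i, p i)"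
      using \<open>i \<in> {0..<n}\<close> by simp
  qed
  finally show ?thesis by (simp add: n_def)
qed

lemma mdet_empty [simp]: "mdet {} M = 1"
  by (simp add: mdet_def)

lemma mdet_cong: "(\<And>i j. i \<in> S \<Longrightarrow> j \<in> S \<Longrightarrow> M i j = M' i j) \<Longrightarrow> mdet S M = mdet S M'"
  unfolding mdet_def by (auto intro!: sum.cong prod.cong simp: permutes_in_image)

lemma mdet_of_real: "mdet S (\<lambda>i j. of_real (M i j) :: 'a :: {real_algebra_1, comm_ring_1}) = of_real (mdet S M)"
  by (simp add: mdet_def)

lemma mdet_uminus: "finite S \<Longrightarrow> mdet S (\<lambda>i j. - M i j) = (- 1) ^ card S * mdet S M"
  unfolding mdet_def by (simp add: prod_uminus sum_distrib_left mult_ac)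

text \<open>Each row contributes either its entry of \<open>M\<close> (rows in \<open>I\<close>) or
  its diagonal variable. A permutation survives only if it fixes every row outside \<open>I\<close>,
  and what remains is a permutation of \<open>I\<close>.\<close>

lemma mdet_diag_expand:
  assumes S: "finite S"
  shows "mdet S (\<lambda>i j. (if i = j then z i else 0) + M i j) = (\<Sum>I\<in>Pow S. mdet I M * (\<Prod>i\<in>S - I. z i))"
proof -
  have "mdet S (\<lambda>i j. (if i = j then z i else 0) + M i j)
    = (\<Sum>p | p permutes S. \<Sum>I\<in>Pow S. of_int (sign p) * ((\<Prod>i\<in>I. M i (p i)) * (\<Prod>i\<in>S - I. if i = p i then z i else 0)))"
  proof -
    have "(\<Prod>i\<in>S. (if i = p i then z i else 0) + M i (p i))
      = (\<Sum>I\<in>Pow S. (\<Prod>i\<in>I. M i (p i)) * (\<Prod>i\<in>S - I. if i = p i then z i else 0))" for p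
      using prod_add[OF S, of "\<lambda>i. M i (p i)" "\<lambda>i. if i = p i then z i else 0"]
      by (subst add.commute) assumption
    then show ?thesis unfolding mdet_def by (simp only: sum_distrib_left)
  qed
  also have "\<dots> = (\<Sum>I\<in>Pow S. \<Sum>p | p permutes S. of_int (sign p) * ((\<Prod>i\<in>I. M i (p i)) * (\<Prod>i\<in>S - I. if i = p i then z i else 0)))"
    by (rule sum.swap)
  also have "\<dots> = (\<Sum>I\<in>Pow S. mdet I M * (\<Prod>i\<in>S - I. z i))"
  proof (rule sum.cong[OF refl])
    fix I assume I: "I \<in> Pow S"
    have "(\<Sum>p | p permutes S. of_int (sign p) * ((\<Prod>i\<in>I. M i (p i)) * (\<Prod>i\<in>S - I. if i = p i then z i else 0)))
      = (\<Sum>p | p permutes I. of_int (sign p) * ((\<Prod>i\<in>I. M i (p i)) * (\<Prod>i\<in>S - I. if i = p i then z i else 0)))"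
    proof (rule sum.mono_neutral_right)
      show "finite {p. p permutes S}" using S by (rule finite_permutations)
      show "{p. p permutes I} \<subseteq> {p. p permutes S}" using I by (auto intro: permutes_subset)
      show "\<forall>p\<in>{p. p permutes S} - {p. p permutes I}.
          of_int (sign p) * ((\<Prod>i\<in>I. M i (p i)) * (\<Prod>i\<in>S - I. if i = p i then z i else 0)) = 0"
      proof
        fix p assume p: "p \<in> {p. p permutes S} - {p. p permutes I}"
        have "\<exists>i\<in>S - I. i \<noteq> p i"
        proof (rule ccontr)
          assume "\<not> ?thesis"
          then have "\<And>i. i \<in> S - I \<Longrightarrow> p i = i" by force
          then have "p permutes I" using p by (intro permutes_superset[of p S I]) auto
          then show False using p by simp
        qed
        then have "(\<Prod>i\<in>S - I. if i = p i then z i else 0) = 0"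
          using S by (intro prod_zero) auto
        then show "of_int (sign p) * ((\<Prod>i\<in>I. M i (p i)) * (\<Prod>i\<in>S - I. if i = p i then z i else 0)) = 0" by simp
      qed
    qed
    also have "\<dots> = (\<Sum>p | p permutes I. of_int (sign p) * (\<Prod>i\<in>I. M i (p i)) * (\<Prod>i\<in>S - I. z i))"
    proof (rule sum.cong[OF refl])
      fix p assume "p \<in> {p. p permutes I}"
      then have "(\<Prod>i\<in>S - I. if i = p i then z i else 0) = (\<Prod>i\<in>S - I. z i)"
        by (intro prod.cong) (auto simp: permutes_not_in)
      then show "of_int (sign p) * ((\<Prod>i\<in>I. M i (p i)) * (\<Prod>i\<in>S - I. if i = p i then z i else 0))
        = of_int (sign p) * (\<Prod>i\<in>I. M i (p i)) * (\<Prod>i\<in>S - I. z i)" by simp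
    qed
    also have "\<dots> = mdet I M * (\<Prod>i\<in>S - I. z i)" by (simp add: mdet_def sum_distrib_right)
    finally show "(\<Sum>p | p permutes S. of_int (sign p) * ((\<Prod>i\<in>I. M i (p i)) * (\<Prod>i\<in>S - I. if i = p i then z i else 0)))
      = mdet I M * (\<Prod>i\<in>S - I. z i)" .
  qed
  finally show ?thesis .
qed

text \<open>For a kernel vector \<open>u\<close>, the imaginary part of the Hermitian form is
  \<open>\<Sum> Im (z i) * |u i|^2\<close>, because the real symmetric part contributes a real
  number. So \<open>u\<close> is concentrated at \<open>k\<close>, the only index with a possibly
  real variable, and the whole column \<open>k\<close> vanishes, which \<open>k\<close>
  excludes.\<close>

lemma mdet_stable:
  fixes A :: "nat \<Rightarrow> nat \<Rightarrow> real" and z :: "nat \<Rightarrow> complex"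
  assumes S: "finite S" and sym: "\<And>i j. A i j = A j i"
    and z: "\<And>i. i \<in> S \<Longrightarrow> i \<noteq> k \<Longrightarrow> Im (z i) > 0" and zk: "Im (z k) \<ge> 0"
    and k: "z k + of_real (A k k) \<noteq> 0 \<or> (\<exists>j\<in>S. j \<noteq> k \<and> A j k \<noteq> 0)"
  shows "mdet S (\<lambda>i j. (if i = j then z i else 0) + of_real (A i j)) \<noteq> 0"
proof
  define M where "M i j = (if i = j then z i else 0) + complex_of_real (A i j)" for i j
  assume "mdet S (\<lambda>i j. (if i = j then z i else 0) + of_real (A i j)) = 0"
  then have det0: "mdet S M = 0" by (simp add: M_def[abs_def])
  define n where "n = card S"
  obtain f where f: "bij_betw f {0..<n} S" using ex_bij_betw_nat_finite[OF S] by (auto simp: n_def)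
  define B where "B = mat n n (\<lambda>(i, j). M (f i) (f j))"
  have "Determinant.det B = 0" using det0 mdet_det[OF S f[unfolded n_def], of M] by (simp add: B_def n_def)
  then obtain v where v: "v \<in> carrier_vec n" "v \<noteq> 0\<^sub>v n" "B *\<^sub>v v = 0\<^sub>v n"
    using det_0_iff_vec_prod_zero[of B n] by (auto simp: B_def)
  define u where "u i = vec_index v (inv_into {0..<n} f i)" for i
  have uf: "u (f i) = vec_index v i" if "i < n" for i
    using that f by (simp add: u_def bij_betw_def inv_into_f_f)
  have row: "(\<Sum>j\<in>S. M i j * u j) = 0" if iS: "i \<in> S" for i
  proof -
    obtain i' where i': "i' < n" "i = f i'" using iS f by (auto simp: bij_betw_def)
    have "(\<Sum>j\<in>S. M i j * u j) = (\<Sum>j = 0..<n. M i (f j) * u (f j))"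
      by (rule sum.reindex_bij_betw[OF f, symmetric])
    also have "\<dots> = vec_index (B *\<^sub>v v) i'"
      using i' v(1) by (auto simp: B_def scalar_prod_def uf intro!: sum.cong)
    also have "\<dots> = 0" using v(3) i' by simp
    finally show ?thesis .
  qed
  have "(\<Sum>i\<in>S. cnj (u i) * (\<Sum>j\<in>S. M i j * u j)) = 0" using row by simp
  also have "(\<Sum>i\<in>S. cnj (u i) * (\<Sum>j\<in>S. M i j * u j))
    = (\<Sum>i\<in>S. z i * (cnj (u i) * u i)) + (\<Sum>i\<in>S. \<Sum>j\<in>S. of_real (A i j) * (cnj (u i) * u j))"
  proof -
    have "cnj (u i) * (\<Sum>j\<in>S. M i j * u j) = z i * (cnj (u i) * u i) + (\<Sum>j\<in>S. of_real (A i j) * (cnj (u i) * u j))"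
      if "i \<in> S" for i
    proof -
      have "(\<Sum>j\<in>S. M i j * u j) = (\<Sum>j\<in>S. (if i = j then z i * u j else 0)) + (\<Sum>j\<in>S. of_real (A i j) * u j)"
        unfolding sum.distrib[symmetric] by (rule sum.cong) (auto simp: M_def algebra_simps)
      also have "(\<Sum>j\<in>S. (if i = j then z i * u j else 0)) = z i * u i" using S that by simp
      finally show ?thesis by (simp add: algebra_simps sum_distrib_left)
    qed
    then show ?thesis by (simp add: sum.distrib)
  qed
  finally have tot: "(\<Sum>i\<in>S. z i * (cnj (u i) * u i)) + (\<Sum>i\<in>S. \<Sum>j\<in>S. of_real (A i j) * (cnj (u i) * u j)) = 0" .
  define q where "q = (\<Sum>i\<in>S. \<Sum>j\<in>S. of_real (A i j) * (cnj (u i) * u j))"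
  have "cnj q = (\<Sum>i\<in>S. \<Sum>j\<in>S. of_real (A i j) * (u i * cnj (u j)))" by (simp add: q_def)
  also have "\<dots> = (\<Sum>j\<in>S. \<Sum>i\<in>S. of_real (A i j) * (u i * cnj (u j)))" by (rule sum.swap)
  also have "\<dots> = q" unfolding q_def by (intro sum.cong) (auto simp: sym mult_ac)
  finally have "Im q = 0" by (metis Reals_cnj_iff complex_is_Real_iff)
  have cu: "cnj (u i) * u i = of_real ((cmod (u i))\<^sup>2)" for i
    using complex_norm_square[of "u i"] by (simp add: mult.commute)
  have "(\<Sum>i\<in>S. Im (z i) * (cmod (u i))\<^sup>2) = Im (\<Sum>i\<in>S. z i * (cnj (u i) * u i))"
    by (simp add: cu)
  also have "\<dots> = 0" using tot \<open>Im q = 0\<close> by (metis add.right_neutral plus_complex.simps(2) q_def zero_complex.simps(2))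
  finally have s0: "(\<Sum>i\<in>S. Im (z i) * (cmod (u i))\<^sup>2) = 0" .
  have nn: "Im (z i) * (cmod (u i))\<^sup>2 \<ge> 0" if "i \<in> S" for i
    using z[OF that] zk by (cases "i = k") (auto intro: mult_nonneg_nonneg less_imp_le)
  have "Im (z i) * (cmod (u i))\<^sup>2 = 0" if "i \<in> S" for i
    using s0 sum_nonneg_eq_0_iff[OF S, of "\<lambda>i. Im (z i) * (cmod (u i))\<^sup>2"] nn that by blast
  then have u0: "u i = 0" if "i \<in> S" "i \<noteq> k" for i using z[OF that] that by force
  have "\<exists>i\<in>S. u i \<noteq> 0"
  proof (rule ccontr)
    assume "\<not> ?thesis"
    then have "vec_index v i = 0" if "i < n" for i using uf[OF that] f that by (auto simp: bij_betw_def)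
    then have "v = 0\<^sub>v n" using v(1) by (intro eq_vecI) auto
    then show False using v(2) by simp
  qed
  then have kS: "k \<in> S" and uk: "u k \<noteq> 0" using u0 by auto
  have Mk: "M i k = 0" if "i \<in> S" for i
  proof -
    have "(\<Sum>j\<in>S. M i j * u j) = M i k * u k"
      using kS S u0 by (subst sum.remove[OF S kS]) (auto intro!: sum.neutral)
    then show ?thesis using row[OF that] uk by simp
  qed
  show False
  proof (cases "z k + of_real (A k k) = 0")
    case True
    then obtain j where "j \<in> S" "j \<noteq> k" "A j k \<noteq> 0" using k by blast
    then show False using Mk[of j] by (simp add: M_def)
  next
    case False
    then show False using Mk[OF kS] by (simp add: M_def)
  qed
qed

text \<open>
  Each \<open>i\<close> has the weight \<open>n\<close>, \<open>a\<close>, \<open>b\<close> or \<open>m\<close> according to whether it lies in neither set, only in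
  \<open>I\<close>, only in \<open>J\<close>, or in both.
\<close>

definition pair_wt :: "(nat \<Rightarrow> 'a) \<Rightarrow> (nat \<Rightarrow> 'a) \<Rightarrow> (nat \<Rightarrow> 'a) \<Rightarrow> (nat \<Rightarrow> 'a) \<Rightarrow> nat set \<Rightarrow> nat set \<Rightarrow> nat \<Rightarrow> 'a" where
  "pair_wt n a b m I J i = (if i \<in> I then if i \<in> J then m i else a i else if i \<in> J then b i else n i)"

text \<open>Four independent weights per vertex make the sum affine in the weights of each single
  vertex. Contraction, differentiation and isolating a vertex all rest on this.\<close>

definition pair_sum :: "(nat set \<Rightarrow> real) \<Rightarrow> (nat set \<Rightarrow> real) \<Rightarrow> nat set \<Rightarrow>
    (nat \<Rightarrow> 'a) \<Rightarrow> (nat \<Rightarrow> 'a) \<Rightarrow> (nat \<Rightarrow> 'a) \<Rightarrow> (nat \<Rightarrow> 'a) \<Rightarrow> 'a :: real_field" where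
  "pair_sum c c' V n a b m = (\<Sum>I\<in>Pow V. \<Sum>J\<in>Pow V. of_real (c I * c' J) * (\<Prod>i\<in>V. pair_wt n a b m I J i))"

lemma pair_sum_cong:
  assumes "\<And>i. i \<in> V \<Longrightarrow> n i = n' i \<and> a i = a' i \<and> b i = b' i \<and> m i = m' i"
  shows "pair_sum c c' V n a b m = pair_sum c c' V n' a' b' m'"
  unfolding pair_sum_def
  by (intro sum.cong refl arg_cong2[where f = "(*)"] prod.cong) (auto simp: pair_wt_def assms)

lemma prod_pair_wt_upd:
  fixes n a b m :: "nat \<Rightarrow> 'a :: comm_monoid_mult"
  assumes V: "finite V" "j \<in> V"
  shows "(\<Prod>i\<in>V. pair_wt (n(j := n0)) (a(j := a0)) (b(j := b0)) (m(j := m0)) I J i)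
     = (if j \<in> I then if j \<in> J then m0 else a0 else if j \<in> J then b0 else n0) * (\<Prod>i\<in>V - {j}. pair_wt n a b m I J i)"
proof -
  have "(\<Prod>i\<in>V - {j}. pair_wt (n(j := n0)) (a(j := a0)) (b(j := b0)) (m(j := m0)) I J i) = (\<Prod>i\<in>V - {j}. pair_wt n a b m I J i)"
    by (rule prod.cong) (auto simp: pair_wt_def)
  then show ?thesis by (subst prod.remove[OF V]) (simp add: pair_wt_def)
qed

lemma pair_sum_split:
  assumes V: "finite V" "j \<in> V"
  shows "pair_sum c c' V n a b m =
    n j * pair_sum c c' V (n(j := 1)) (a(j := 0)) (b(j := 0)) (m(j := 0))
    + a j * pair_sum c c' V (n(j := 0)) (a(j := 1)) (b(j := 0)) (m(j := 0))
    + b j * pair_sum c c' V (n(j := 0)) (a(j := 0)) (b(j := 1)) (m(j := 0))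
    + m j * pair_sum c c' V (n(j := 0)) (a(j := 0)) (b(j := 0)) (m(j := 1))"
proof -
  have upd: "(\<Prod>i\<in>V. pair_wt (n(j := n0)) (a(j := a0)) (b(j := b0)) (m(j := m0)) I J i)
     = (if j \<in> I then if j \<in> J then m0 else a0 else if j \<in> J then b0 else n0) * (\<Prod>i\<in>V - {j}. pair_wt n a b m I J i)"
    for n0 a0 b0 m0 I J
    by (rule prod_pair_wt_upd[OF V])
  have orig: "(\<Prod>i\<in>V. pair_wt n a b m I J i)
     = (if j \<in> I then if j \<in> J then m j else a j else if j \<in> J then b j else n j) * (\<Prod>i\<in>V - {j}. pair_wt n a b m I J i)"
    for I J
    using upd[of "n j" "a j" "b j" "m j" I J] by simp
  show ?thesis
    unfolding pair_sum_def sum_distrib_left sum.distrib[symmetric] upd orig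
    by (intro sum.cong refl) auto
qed

lemma pair_sum_remove:
  assumes V: "finite V" "j \<in> V"
  shows "pair_sum c c' V (n(j := 1)) (a(j := 0)) (b(j := 0)) (m(j := 0)) = pair_sum c c' (V - {j}) n a b m"
proof -
  let ?w = "pair_wt (n(j := 1)) (a(j := 0)) (b(j := 0)) (m(j := 0))"
  have upd: "(\<Prod>i\<in>V. ?w I J i) = (if j \<in> I \<or> j \<in> J then 0 else (\<Prod>i\<in>V - {j}. pair_wt n a b m I J i))" for I J
    by (simp add: prod_pair_wt_upd[OF V])
  have fin: "finite (Pow V)" using V by simp
  have sub: "Pow (V - {j}) \<subseteq> Pow V" by auto
  have "pair_sum c c' V (n(j := 1)) (a(j := 0)) (b(j := 0)) (m(j := 0))
     = (\<Sum>I\<in>Pow (V - {j}). \<Sum>J\<in>Pow V. of_real (c I * c' J) * (\<Prod>i\<in>V. ?w I J i))"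
    unfolding pair_sum_def by (rule sum.mono_neutral_right[OF fin sub]) (auto simp: upd)
  also have "\<dots> = (\<Sum>I\<in>Pow (V - {j}). \<Sum>J\<in>Pow (V - {j}). of_real (c I * c' J) * (\<Prod>i\<in>V. ?w I J i))"
    by (intro sum.cong refl sum.mono_neutral_right[OF fin sub]) (auto simp: upd)
  also have "\<dots> = pair_sum c c' (V - {j}) n a b m"
    unfolding pair_sum_def by (intro sum.cong refl) (auto simp: upd)
  finally show ?thesis .
qed

text \<open>If \<open>c\<close> consists of the principal minors of \<open>M\<close>, this is the
  determinant of \<open>diag x + M\<close>.\<close>

definition subset_poly :: "(nat set \<Rightarrow> real) \<Rightarrow> nat set \<Rightarrow> (nat \<Rightarrow> 'a) \<Rightarrow> 'a :: real_field" where
  "subset_poly c V x = (\<Sum>I\<in>Pow V. of_real (c I) * (\<Prod>i\<in>V - I. x i))"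

text \<open>A vertex gives \<open>x i\<close> for missing \<open>I\<close> and \<open>y i\<close>
  for missing \<open>J\<close>. This is why the weight of a vertex lying only in \<open>I\<close> is
  \<open>y i\<close>, and that of one lying only in \<open>J\<close> is \<open>x i\<close>.\<close>

lemma pair_sum_product:
  assumes V: "finite V"
  shows "pair_sum c c' V (\<lambda>i. x i * y i) y x (\<lambda>_. 1) = subset_poly c V x * subset_poly c' V y"
proof -
  have "(\<Prod>i\<in>V. pair_wt (\<lambda>i. x i * y i) y x (\<lambda>_. 1) I J i) = (\<Prod>i\<in>V - I. x i) * (\<Prod>i\<in>V - J. y i)" for I J
  proof -
    have e: "(\<Prod>i\<in>V - I. x i) = (\<Prod>i\<in>V. if i \<in> I then 1 else x i)" for I and x :: "nat \<Rightarrow> 'a"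
      using V by (intro prod.mono_neutral_cong_left) auto
    show ?thesis
      unfolding e prod.distrib[symmetric] by (rule prod.cong) (simp_all add: pair_wt_def)
  qed
  then have "pair_sum c c' V (\<lambda>i. x i * y i) y x (\<lambda>_. 1) = (\<Sum>I\<in>Pow V. \<Sum>J\<in>Pow V.
      (of_real (c I) * (\<Prod>i\<in>V - I. x i)) * (of_real (c' J) * (\<Prod>i\<in>V - J. y i)))"
    unfolding pair_sum_def by (intro sum.cong refl) (simp add: mult_ac)
  then show ?thesis by (simp only: subset_poly_def sum_product)
qed

lemma pair_sum_of_real:
  "pair_sum c c' V (\<lambda>i. of_real (n i)) (\<lambda>i. of_real (a i)) (\<lambda>i. of_real (b i)) (\<lambda>i. of_real (m i))
   = (of_real (pair_sum c c' V n a b m) :: 'a :: real_field)"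
proof -
  have "pair_wt (\<lambda>i. of_real (n i)) (\<lambda>i. of_real (a i)) (\<lambda>i. of_real (b i)) (\<lambda>i. of_real (m i)) I J i
     = (of_real (pair_wt n a b m I J i) :: 'a)" for I J i
    by (simp add: pair_wt_def)
  then show ?thesis by (simp add: pair_sum_def)
qed

text \<open>
  The product at \<open>m = 1\<close> is contracted one vertex at a time: by the Grace-type lemma
  \<open>contraction_nonzero\<close>, both variables of a vertex are identified and the weight of \<open>I \<inter> J\<close> is lowered to \<open>X\<close>.
\<close>

lemma pair_sum_stable:
  fixes \<zeta> :: "nat \<Rightarrow> complex" and X :: real
  assumes V: "finite V" and X: "0 < X" "X \<le> 1" and W: "W \<subseteq> V"
    and base: "\<And>x y. (\<And>i. i \<in> V \<Longrightarrow> x i \<in> \<Omega> i \<and> y i \<in> \<Omega> i) \<Longrightarrow> pair_sum c c' V (\<lambda>i. x i * y i) y x (\<lambda>_. 1) \<noteq> 0"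
    and \<Omega>: "\<And>i. i \<in> W \<Longrightarrow> \<Omega> i = {z. Im z > 0}"
    and \<zeta>: "\<And>i. i \<in> W \<Longrightarrow> Im (\<zeta> i) > 0"
    and xy: "\<And>i. i \<in> V - W \<Longrightarrow> x i \<in> \<Omega> i \<and> y i \<in> \<Omega> i"
  shows "pair_sum c c' V (\<lambda>i. if i \<in> W then (\<zeta> i)\<^sup>2 else x i * y i) (\<lambda>i. if i \<in> W then \<zeta> i else y i)
    (\<lambda>i. if i \<in> W then \<zeta> i else x i) (\<lambda>i. if i \<in> W then of_real X else 1) \<noteq> 0"
  using finite_subset[OF W V] W \<Omega> \<zeta> xy
proof (induction W arbitrary: x y rule: finite_induct)
  case empty
  then show ?case using base[of x y] by simp
next
  case (insert j W)
  define n where "n i = (if i \<in> W then (\<zeta> i)\<^sup>2 else x i * y i)" for i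
  define a where "a i = (if i \<in> W then \<zeta> i else y i)" for i
  define b where "b i = (if i \<in> W then \<zeta> i else x i)" for i
  define m where "m i = (if i \<in> W then of_real X else 1 :: complex)" for i
  have j: "j \<in> V" "j \<notin> W" using insert by auto
  let ?L = "pair_sum c c' V (n(j := 1)) (a(j := 0)) (b(j := 0)) (m(j := 0))"
  let ?P = "pair_sum c c' V (n(j := 0)) (a(j := 1)) (b(j := 0)) (m(j := 0))"
  let ?Q = "pair_sum c c' V (n(j := 0)) (a(j := 0)) (b(j := 1)) (m(j := 0))"
  let ?B = "pair_sum c c' V (n(j := 0)) (a(j := 0)) (b(j := 0)) (m(j := 1))"
  have spl: "pair_sum c c' V n' a' b' m' = n' j * ?L + a' j * ?P + b' j * ?Q + m' j * ?B"
    if "\<And>i. i \<noteq> j \<Longrightarrow> n' i = n i \<and> a' i = a i \<and> b' i = b i \<and> m' i = m i" for n' a' b' m'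
  proof -
    have e: "n'(j := t) = n(j := t)" "a'(j := t) = a(j := t)" "b'(j := t) = b(j := t)" "m'(j := t) = m(j := t)" for t
      using that by (auto simp: fun_eq_iff)
    show ?thesis by (subst pair_sum_split[OF V j(1)]) (simp only: e)
  qed
  have g: "xj * yj * ?L + yj * ?P + xj * ?Q + ?B \<noteq> 0" if "Im xj > 0" "Im yj > 0" for xj yj
  proof -
    have "pair_sum c c' V (\<lambda>i. if i \<in> W then (\<zeta> i)\<^sup>2 else (x(j := xj)) i * (y(j := yj)) i) (\<lambda>i. if i \<in> W then \<zeta> i else (y(j := yj)) i)
      (\<lambda>i. if i \<in> W then \<zeta> i else (x(j := xj)) i) (\<lambda>i. if i \<in> W then of_real X else 1) \<noteq> 0"
    proof (rule insert.IH)
      fix i assume "i \<in> V - W"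
      then show "(x(j := xj)) i \<in> \<Omega> i \<and> (y(j := yj)) i \<in> \<Omega> i"
        using insert.prems that by (cases "i = j") auto
    qed (use insert.prems in auto)
    then show ?thesis
      by (subst (asm) spl) (use j in \<open>auto simp: n_def a_def b_def m_def\<close>)
  qed
  have "(\<zeta> j)\<^sup>2 * ?L + \<zeta> j * ?P + \<zeta> j * ?Q + of_real X * ?B \<noteq> 0"
    by (rule contraction_nonzero[OF g _ X]) (use insert.prems in auto)
  then show ?case
    by (subst spl) (use j in \<open>auto simp: n_def a_def b_def m_def\<close>)
qed

text \<open>Contraction at \<open>X = 0\<close>, with the common factor \<open>\<zeta> i\<close>
  divided out at each contracted vertex. Each contraction needs a nonzero leading coefficient,
  namely the sum over \<open>V - {j}\<close>. Hence the induction generalizes over \<open>V\<close>,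
  and \<open>base\<close> covers all subsets.\<close>

lemma pair_sum_stable_0:
  fixes \<zeta> :: "nat \<Rightarrow> complex"
  assumes V: "finite V" and W: "W \<subseteq> V"
    and base: "\<And>U x y. U \<subseteq> V \<Longrightarrow> (\<And>i. i \<in> U \<Longrightarrow> Im (x i) > 0 \<and> Im (y i) > 0) \<Longrightarrow> pair_sum c c' U (\<lambda>i. x i * y i) y x (\<lambda>_. 1) \<noteq> 0"
    and \<zeta>: "\<And>i. i \<in> V \<Longrightarrow> Im (\<zeta> i) > 0"
    and xy: "\<And>i. i \<in> V - W \<Longrightarrow> Im (x i) > 0 \<and> Im (y i) > 0"
  shows "pair_sum c c' V (\<lambda>i. if i \<in> W then \<zeta> i else x i * y i) (\<lambda>i. if i \<in> W then 1 else y i)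
    (\<lambda>i. if i \<in> W then 1 else x i) (\<lambda>i. if i \<in> W then 0 else 1) \<noteq> 0"
  using finite_subset[OF W V] V W base \<zeta> xy
proof (induction W arbitrary: V x y rule: finite_induct)
  case empty
  then show ?case using empty.prems(3)[of V x y] by simp
next
  case (insert j W)
  note V = insert.prems(1)
  define n where "n i = (if i \<in> W then \<zeta> i else x i * y i)" for i
  define a where "a i = (if i \<in> W then 1 else y i)" for i
  define b where "b i = (if i \<in> W then 1 else x i)" for i
  define m where "m i = (if i \<in> W then 0 else 1 :: complex)" for i
  have j: "j \<in> V" "j \<notin> W" using insert by auto
  let ?L = "pair_sum c c' V (n(j := 1)) (a(j := 0)) (b(j := 0)) (m(j := 0))"
  let ?P = "pair_sum c c' V (n(j := 0)) (a(j := 1)) (b(j := 0)) (m(j := 0))"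
  let ?Q = "pair_sum c c' V (n(j := 0)) (a(j := 0)) (b(j := 1)) (m(j := 0))"
  let ?B = "pair_sum c c' V (n(j := 0)) (a(j := 0)) (b(j := 0)) (m(j := 1))"
  have spl: "pair_sum c c' V n' a' b' m' = n' j * ?L + a' j * ?P + b' j * ?Q + m' j * ?B"
    if "\<And>i. i \<noteq> j \<Longrightarrow> n' i = n i \<and> a' i = a i \<and> b' i = b i \<and> m' i = m i" for n' a' b' m'
  proof -
    have e: "n'(j := t) = n(j := t)" "a'(j := t) = a(j := t)" "b'(j := t) = b(j := t)" "m'(j := t) = m(j := t)" for t
      using that by (auto simp: fun_eq_iff)
    show ?thesis by (subst pair_sum_split[OF V j(1)]) (simp only: e)
  qed
  have g: "xj * yj * ?L + yj * ?P + xj * ?Q + ?B \<noteq> 0" if "Im xj > 0" "Im yj > 0" for xj yj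
  proof -
    have "pair_sum c c' V (\<lambda>i. if i \<in> W then \<zeta> i else (x(j := xj)) i * (y(j := yj)) i) (\<lambda>i. if i \<in> W then 1 else (y(j := yj)) i)
      (\<lambda>i. if i \<in> W then 1 else (x(j := xj)) i) (\<lambda>i. if i \<in> W then 0 else 1) \<noteq> 0"
    proof (rule insert.IH)
      fix i assume "i \<in> V - W"
      then show "Im ((x(j := xj)) i) > 0 \<and> Im ((y(j := yj)) i) > 0"
        using insert.prems that by (cases "i = j") auto
    qed (use insert.prems in auto)
    then show ?thesis
      by (subst (asm) spl) (use j in \<open>auto simp: n_def a_def b_def m_def\<close>)
  qed
  have L: "?L \<noteq> 0"
  proof -
    have "pair_sum c c' (V - {j}) n a b m \<noteq> 0"
      unfolding n_def[abs_def] a_def[abs_def] b_def[abs_def] m_def[abs_def]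
    proof (rule insert.IH)
      show "pair_sum c c' U (\<lambda>i. x i * y i) y x (\<lambda>_. 1) \<noteq> 0"
        if "U \<subseteq> V - {j}" "\<And>i. i \<in> U \<Longrightarrow> Im (x i) > 0 \<and> Im (y i) > 0" for U x y
        by (rule insert.prems(3)) (use that in auto)
    qed (use insert.prems insert.hyps in auto)
    then show ?thesis unfolding pair_sum_remove[OF V j(1)] .
  qed
  have "\<zeta> j * ?L + ?P + ?Q \<noteq> 0"
    by (rule contraction_nonzero_0[OF g _ L]) (use insert.prems j in auto)
  then show ?case
    by (subst spl) (use j in \<open>auto simp: n_def a_def b_def m_def\<close>)
qed

text \<open>Product rule over the vertices. Differentiating the factor of one vertex
  \<open>k\<close> only replaces its four weights by their derivatives, so every term is again a
  \<open>pair_sum\<close>.\<close>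

lemma pair_sum_DERIV:
  fixes n a b m :: "real \<Rightarrow> nat \<Rightarrow> real"
  assumes V: "finite V"
    and d: "\<And>i. i \<in> V \<Longrightarrow> ((\<lambda>t. n t i) has_real_derivative n' i) (at t)"
      "\<And>i. i \<in> V \<Longrightarrow> ((\<lambda>t. a t i) has_real_derivative a' i) (at t)"
      "\<And>i. i \<in> V \<Longrightarrow> ((\<lambda>t. b t i) has_real_derivative b' i) (at t)"
      "\<And>i. i \<in> V \<Longrightarrow> ((\<lambda>t. m t i) has_real_derivative m' i) (at t)"
  shows "((\<lambda>t. pair_sum c c' V (n t) (a t) (b t) (m t)) has_real_derivative
    (\<Sum>k\<in>V. pair_sum c c' V ((n t)(k := n' k)) ((a t)(k := a' k)) ((b t)(k := b' k)) ((m t)(k := m' k)))) (at t)"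
proof -
  have w: "((\<lambda>t. pair_wt (n t) (a t) (b t) (m t) I J i) has_real_derivative pair_wt n' a' b' m' I J i) (at t)"
    if "i \<in> V" for I J i using d[OF that] by (simp add: pair_wt_def)
  have p: "((\<lambda>t. \<Prod>i\<in>V. pair_wt (n t) (a t) (b t) (m t) I J i) has_real_derivative
      (\<Sum>k\<in>V. pair_wt n' a' b' m' I J k * (\<Prod>i\<in>V - {k}. pair_wt (n t) (a t) (b t) (m t) I J i))) (at t)" for I J
    by (rule has_field_derivative_prod[OF w])
  have "((\<lambda>t. pair_sum c c' V (n t) (a t) (b t) (m t)) has_real_derivative
    (\<Sum>I\<in>Pow V. \<Sum>J\<in>Pow V. c I * c' J * (\<Sum>k\<in>V. pair_wt n' a' b' m' I J k * (\<Prod>i\<in>V - {k}. pair_wt (n t) (a t) (b t) (m t) I J i)))) (at t)"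
    unfolding pair_sum_def of_real_eq_id id_def by (intro DERIV_sum DERIV_cmult p)
  also have "(\<Sum>I\<in>Pow V. \<Sum>J\<in>Pow V. c I * c' J * (\<Sum>k\<in>V. pair_wt n' a' b' m' I J k * (\<Prod>i\<in>V - {k}. pair_wt (n t) (a t) (b t) (m t) I J i)))
    = (\<Sum>I\<in>Pow V. \<Sum>J\<in>Pow V. \<Sum>k\<in>V. c I * c' J * (pair_wt n' a' b' m' I J k * (\<Prod>i\<in>V - {k}. pair_wt (n t) (a t) (b t) (m t) I J i)))"
    by (simp add: sum_distrib_left)
  also have "\<dots> = (\<Sum>I\<in>Pow V. \<Sum>k\<in>V. \<Sum>J\<in>Pow V. c I * c' J * (pair_wt n' a' b' m' I J k * (\<Prod>i\<in>V - {k}. pair_wt (n t) (a t) (b t) (m t) I J i)))"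
    by (intro sum.cong refl sum.swap)
  also have "\<dots> = (\<Sum>k\<in>V. \<Sum>I\<in>Pow V. \<Sum>J\<in>Pow V. c I * c' J * (pair_wt n' a' b' m' I J k * (\<Prod>i\<in>V - {k}. pair_wt (n t) (a t) (b t) (m t) I J i)))"
    by (rule sum.swap)
  also have "\<dots> = (\<Sum>k\<in>V. pair_sum c c' V ((n t)(k := n' k)) ((a t)(k := a' k)) ((b t)(k := b' k)) ((m t)(k := m' k)))"
  proof (rule sum.cong[OF refl])
    fix k assume k: "k \<in> V"
    have "(\<Prod>i\<in>V. pair_wt ((n t)(k := n' k)) ((a t)(k := a' k)) ((b t)(k := b' k)) ((m t)(k := m' k)) I J i)
      = pair_wt n' a' b' m' I J k * (\<Prod>i\<in>V - {k}. pair_wt (n t) (a t) (b t) (m t) I J i)" for I J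
      by (simp add: prod_pair_wt_upd[OF V k]) (simp add: pair_wt_def)
    then show "(\<Sum>I\<in>Pow V. \<Sum>J\<in>Pow V. c I * c' J * (pair_wt n' a' b' m' I J k * (\<Prod>i\<in>V - {k}. pair_wt (n t) (a t) (b t) (m t) I J i)))
      = pair_sum c c' V ((n t)(k := n' k)) ((a t)(k := a' k)) ((b t)(k := b' k)) ((m t)(k := m' k))"
      by (simp add: pair_sum_def)
  qed
  finally show ?thesis .
qed

section \<open>Minors of size at most four and sums over small subsets\<close>

lemma mdet_1: "mdet {i} M = M i i"
  by (simp add: mdet_def permutes_sing)

text \<open>Laplace expansion along row \<open>k\<close>. A permutation of \<open>insert k S\<close>
  is a transposition of \<open>k\<close> with \<open>b\<close> after a permutation \<open>q\<close>
  of \<open>S\<close>; where \<open>q\<close> hits \<open>b\<close>, the composite hits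
  \<open>k\<close>, so column \<open>b\<close> takes over the entries of column
  \<open>k\<close>.\<close>

lemma mdet_insert:
  assumes S: "finite S" "k \<notin> S"
  shows "mdet (insert k S) M = M k k * mdet S M - (\<Sum>b\<in>S. M k b * mdet S (\<lambda>i j. if j = b then M i k else M i j))"
proof -
  have "mdet (insert k S) M = (\<Sum>b\<in>insert k S. \<Sum>q | q permutes S.
      of_int (sign (Transposition.transpose k b \<circ> q)) * (\<Prod>i\<in>insert k S. M i ((Transposition.transpose k b \<circ> q) i)))"
    unfolding mdet_def by (rule sum_over_permutations_insert[OF S])
  also have "\<dots> = (\<Sum>q | q permutes S. of_int (sign q) * (\<Prod>i\<in>insert k S. M i (q i)))
    + (\<Sum>b\<in>S. \<Sum>q | q permutes S. of_int (sign (Transposition.transpose k b \<circ> q)) * (\<Prod>i\<in>insert k S. M i ((Transposition.transpose k b \<circ> q) i)))"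
    using S by (subst sum.insert) auto
  also have "(\<Sum>q | q permutes S. of_int (sign q) * (\<Prod>i\<in>insert k S. M i (q i))) = M k k * mdet S M"
    unfolding mdet_def sum_distrib_left
    by (rule sum.cong) (use S in \<open>auto simp: permutes_not_in mult_ac\<close>)
  also have "(\<Sum>b\<in>S. \<Sum>q | q permutes S. of_int (sign (Transposition.transpose k b \<circ> q)) * (\<Prod>i\<in>insert k S. M i ((Transposition.transpose k b \<circ> q) i)))
    = (\<Sum>b\<in>S. - (M k b * mdet S (\<lambda>i j. if j = b then M i k else M i j)))"
  proof (rule sum.cong[OF refl])
    fix b assume b: "b \<in> S"
    have kb: "k \<noteq> b" using b S by auto
    show "(\<Sum>q | q permutes S. of_int (sign (Transposition.transpose k b \<circ> q)) * (\<Prod>i\<in>insert k S. M i ((Transposition.transpose k b \<circ> q) i)))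
      = - (M k b * mdet S (\<lambda>i j. if j = b then M i k else M i j))"
      unfolding mdet_def sum_distrib_left sum_negf[symmetric]
    proof (rule sum.cong[OF refl])
      fix q assume "q \<in> {q. q permutes S}"
      then have q: "q permutes S" by simp
      have sg: "sign (Transposition.transpose k b \<circ> q) = - sign q"
      proof -
        have "permutation q" using q S(1) permutation_permutes by blast
        then show ?thesis using kb by (simp add: sign_compose sign_swap_id permutation_swap_id)
      qed
      have "(\<Prod>i\<in>insert k S. M i ((Transposition.transpose k b \<circ> q) i)) = M k b * (\<Prod>i\<in>S. M i ((Transposition.transpose k b \<circ> q) i))"
        using S q by (simp add: permutes_not_in)
      also have "(\<Prod>i\<in>S. M i ((Transposition.transpose k b \<circ> q) i)) = (\<Prod>i\<in>S. if q i = b then M i k else M i (q i))"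
      proof (rule prod.cong[OF refl])
        fix i assume "i \<in> S"
        then have "q i \<noteq> k" using permutes_in_image[OF q, of i] S by auto
        then show "M i ((Transposition.transpose k b \<circ> q) i) = (if q i = b then M i k else M i (q i))"
          by (auto simp: swap_id_eq)
      qed
      finally show "of_int (sign (Transposition.transpose k b \<circ> q)) * (\<Prod>i\<in>insert k S. M i ((Transposition.transpose k b \<circ> q) i))
        = - (M k b * (of_int (sign q) * (\<Prod>i\<in>S. if q i = b then M i k else M i (q i))))"
        by (simp add: sg)
    qed
  qed
  finally show ?thesis by (simp add: sum_negf)
qed

lemma mdet_2:
  assumes "k \<noteq> i"
  shows "mdet {k, i} M = M k k * M i i - M k i * M i k"
  using assms by (simp add: mdet_insert mdet_1)

lemma mdet_3_gen:
  assumes "k \<noteq> i" "k \<noteq> j" "i \<noteq> j"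
  shows "mdet {k, i, j} M = M k k * (M i i * M j j - M i j * M j i)
    - M k i * (M i k * M j j - M i j * M j k) - M k j * (M i i * M j k - M i k * M j i)"
  using assms assms[symmetric] by (simp add: mdet_insert mdet_1 algebra_simps)

lemma mdet_3:
  fixes M :: "nat \<Rightarrow> nat \<Rightarrow> 'a :: comm_ring_1"
  assumes ne: "k \<noteq> i" "k \<noteq> j" "i \<noteq> j" and sym: "\<And>p q. M p q = M q p" and diag: "\<And>p. M p p = 0"
  shows "mdet {k, i, j} M = 2 * (M k i * M i j * M k j)"
  unfolding mdet_3_gen[OF ne] diag sym[of i k] sym[of j k] sym[of j i] by (simp add: algebra_simps)

text \<open>The zero diagonal leaves only derangements: three even products of two transpositions,
  and six odd 4-cycles, which agree in inverse pairs by symmetry.\<close>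

lemma mdet_4:
  fixes M :: "nat \<Rightarrow> nat \<Rightarrow> 'a :: comm_ring_1"
  assumes ne: "k \<noteq> i" "k \<noteq> j" "k \<noteq> l" "i \<noteq> j" "i \<noteq> l" "j \<noteq> l"
    and sym: "\<And>p q. M p q = M q p" and diag: "\<And>p. M p p = 0"
  shows "mdet {k, i, j, l} M = (M k i)\<^sup>2 * (M j l)\<^sup>2 + (M k j)\<^sup>2 * (M i l)\<^sup>2 + (M k l)\<^sup>2 * (M i j)\<^sup>2
    - 2 * (M k i * M i j * M j l * M k l + M k i * M i l * M l j * M k j + M k j * M j i * M i l * M k l)"
proof -
  have s: "M i k = M k i" "M j k = M k j" "M l k = M k l" "M j i = M i j" "M l i = M i l" "M l j = M j l"
    using sym by auto
  have f: "finite {i, j, l}" "k \<notin> {i, j, l}" using ne by auto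
  have 1: "(\<Sum>b\<in>{i, j, l}. g b) = g i + g j + g l" for g :: "nat \<Rightarrow> 'a"
    using ne by (simp add: add.assoc)
  show ?thesis
    unfolding mdet_insert[OF f] 1 mdet_3_gen[OF ne(4) ne(5) ne(6)] diag
    using ne ne[symmetric] by (simp add: s diag algebra_simps power2_eq_square)
qed

text \<open>Both sides count pairs of a set \<open>I\<close> of size \<open>r + 1\<close> and a
  marked element of it.\<close>

lemma sum_card_Suc:
  fixes f :: "nat set \<Rightarrow> 'a :: comm_semiring_1"
  assumes V: "finite V"
  shows "of_nat (Suc r) * (\<Sum>I | I \<subseteq> V \<and> card I = Suc r. f I) = (\<Sum>i\<in>V. \<Sum>I | I \<subseteq> V - {i} \<and> card I = r. f (insert i I))"
proof -
  have fin: "finite {I. I \<subseteq> V \<and> card I = Suc r}" using V by simp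
  have "of_nat (Suc r) * (\<Sum>I | I \<subseteq> V \<and> card I = Suc r. f I) = (\<Sum>I | I \<subseteq> V \<and> card I = Suc r. \<Sum>i\<in>I. f I)"
    by (simp add: sum_distrib_left)
  also have "\<dots> = (\<Sum>I | I \<subseteq> V \<and> card I = Suc r. \<Sum>i\<in>V. if i \<in> I then f I else 0)"
    using V by (intro sum.cong refl sum.mono_neutral_cong_left) auto
  also have "\<dots> = (\<Sum>i\<in>V. \<Sum>I | I \<subseteq> V \<and> card I = Suc r. if i \<in> I then f I else 0)"
    by (rule sum.swap)
  also have "\<dots> = (\<Sum>i\<in>V. \<Sum>I | I \<subseteq> V - {i} \<and> card I = r. f (insert i I))"
  proof (rule sum.cong[OF refl])
    fix i assume i: "i \<in> V"
    have "(\<Sum>I | I \<subseteq> V \<and> card I = Suc r. if i \<in> I then f I else 0) = (\<Sum>I | I \<subseteq> V \<and> card I = Suc r \<and> i \<in> I. f I)"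
      using fin by (simp add: sum.If_cases) (rule sum.cong, auto)
    also have "\<dots> = (\<Sum>I | I \<subseteq> V - {i} \<and> card I = r. f (insert i I))"
    proof (rule sum.reindex_bij_witness[where i = "insert i" and j = "\<lambda>I. I - {i}"])
      fix I assume I: "I \<in> {I. I \<subseteq> V \<and> card I = Suc r \<and> i \<in> I}"
      then show "I - {i} \<in> {I. I \<subseteq> V - {i} \<and> card I = r}"
        using V by auto
      show "insert i (I - {i}) = I" "f (insert i (I - {i})) = f I" using I by (auto simp: insert_absorb)
    next
      fix I assume I: "I \<in> {I. I \<subseteq> V - {i} \<and> card I = r}"
      then have "finite I" "i \<notin> I" using V finite_subset by blast+
      then show "insert i I \<in> {I. I \<subseteq> V \<and> card I = Suc r \<and> i \<in> I}" using I i by auto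
      show "insert i I - {i} = I" using \<open>i \<notin> I\<close> by simp
    qed
    finally show "(\<Sum>I | I \<subseteq> V \<and> card I = Suc r. if i \<in> I then f I else 0)
      = (\<Sum>I | I \<subseteq> V - {i} \<and> card I = r. f (insert i I))" .
  qed
  finally show ?thesis .
qed

lemma subsets_card_0: "finite V \<Longrightarrow> {I. I \<subseteq> V \<and> card I = 0} = {{}}"
  by (auto simp: card_eq_0_iff dest: finite_subset)

lemma sum_card_1:
  fixes f :: "nat set \<Rightarrow> real"
  assumes "finite V"
  shows "(\<Sum>I | I \<subseteq> V \<and> card I = 1. f I) = (\<Sum>i\<in>V. f {i})"
  using sum_card_Suc[OF assms, of 0 f] assms by (simp add: subsets_card_0)

lemma sum_card_2:
  fixes f :: "nat set \<Rightarrow> real"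
  assumes V: "finite V"
  shows "(\<Sum>I | I \<subseteq> V \<and> card I = 2. f I) = (\<Sum>i\<in>V. \<Sum>j\<in>V. if i \<noteq> j then f {i, j} else 0) / 2"
proof -
  have "2 * (\<Sum>I | I \<subseteq> V \<and> card I = 2. f I) = (\<Sum>i\<in>V. \<Sum>j\<in>V - {i}. f {i, j})"
  proof -
    have e: "of_nat (Suc 1) = (2 :: real)" "Suc 1 = 2" by simp_all
    show ?thesis using sum_card_Suc[OF V, of 1 f, unfolded e] V by (simp only: sum_card_1 finite_Diff)
  qed
  also have "\<dots> = (\<Sum>i\<in>V. \<Sum>j\<in>V. if i \<noteq> j then f {i, j} else 0)"
    using V by (intro sum.cong refl sum.mono_neutral_cong_left) auto
  finally show ?thesis by simp
qed

lemma sum_card_3: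
  fixes f :: "nat set \<Rightarrow> real"
  assumes V: "finite V"
  shows "(\<Sum>I | I \<subseteq> V \<and> card I = 3. f I)
    = (\<Sum>i\<in>V. \<Sum>j\<in>V. \<Sum>l\<in>V. if i \<noteq> j \<and> i \<noteq> l \<and> j \<noteq> l then f {i, j, l} else 0) / 6"
proof -
  have "3 * (\<Sum>I | I \<subseteq> V \<and> card I = 3. f I) = (\<Sum>i\<in>V. (\<Sum>j\<in>V - {i}. \<Sum>l\<in>V - {i}. if j \<noteq> l then f {i, j, l} else 0) / 2)"
  proof -
    have e: "of_nat (Suc 2) = (3 :: real)" "Suc 2 = 3" by simp_all
    show ?thesis using sum_card_Suc[OF V, of 2 f, unfolded e] V by (simp only: sum_card_2 finite_Diff)
  qed
  also have "\<dots> = (\<Sum>i\<in>V. (\<Sum>j\<in>V. \<Sum>l\<in>V. if i \<noteq> j \<and> i \<noteq> l \<and> j \<noteq> l then f {i, j, l} else 0) / 2)"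
  proof (rule sum.cong[OF refl])
    fix i assume "i \<in> V"
    have "(\<Sum>j\<in>V - {i}. \<Sum>l\<in>V - {i}. if j \<noteq> l then f {i, j, l} else 0)
      = (\<Sum>j\<in>V - {i}. \<Sum>l\<in>V. if i \<noteq> j \<and> i \<noteq> l \<and> j \<noteq> l then f {i, j, l} else 0)"
      using V by (intro sum.cong refl sum.mono_neutral_cong_left) auto
    also have "\<dots> = (\<Sum>j\<in>V. \<Sum>l\<in>V. if i \<noteq> j \<and> i \<noteq> l \<and> j \<noteq> l then f {i, j, l} else 0)"
      using V by (intro sum.mono_neutral_left) (auto intro!: sum.neutral)
    finally show "(\<Sum>j\<in>V - {i}. \<Sum>l\<in>V - {i}. if j \<noteq> l then f {i, j, l} else 0) / 2
      = (\<Sum>j\<in>V. \<Sum>l\<in>V. if i \<noteq> j \<and> i \<noteq> l \<and> j \<noteq> l then f {i, j, l} else 0) / 2" by simp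
  qed
  finally show ?thesis by (simp add: sum_divide_distrib[symmetric])
qed

section \<open>Expansion at infinity\<close>

text \<open>In terms of \<open>u = 1 / z\<close>, the factor \<open>e / n\<close> cancels the
  constant coefficient of the numerator, and \<open>v = e' / e - n' / n\<close> cancels the
  coefficient of \<open>u^2\<close>. As \<open>P\<close> and \<open>Q\<close> have a gap at the next
  order too, the rest is \<open>u\<close> times a function continuous at 0.\<close>

lemma Nevanlinna_expansion_limit:
  fixes P Q R1 R2 :: "complex \<Rightarrow> complex" and e e' n n' :: real
  assumes e: "e \<noteq> 0" and n: "n \<noteq> 0"
    and c: "continuous_on UNIV R1" "continuous_on UNIV R2"
    and P: "\<And>z. z \<noteq> 0 \<Longrightarrow> P z = z ^ m * ((1 / z) ^ Suc s * (of_real e + of_real e' * (1 / z)\<^sup>2 + (1 / z) ^ 4 * R1 (1 / z)))"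
    and Q: "\<And>z. z \<noteq> 0 \<Longrightarrow> Q z = z ^ m * ((1 / z) ^ s * (of_real n + of_real n' * (1 / z)\<^sup>2 + (1 / z) ^ 4 * R2 (1 / z)))"
  shows "((\<lambda>z. z * (z * (z - of_real (e / n) * (Q z / P z)) - of_real (e' / e - n' / n))) \<longlongrightarrow> 0) at_infinity"
proof -
  define \<mu> v where "\<mu> = e / n" and "v = e' / e - n' / n"
  have ev: "e * v = e' - \<mu> * n'" using e by (simp add: \<mu>_def v_def field_simps)
  have \<mu>n: "\<mu> * n = e" using n by (simp add: \<mu>_def)
  define E where "E w = of_real e + of_real e' * w\<^sup>2 + w ^ 4 * R1 w" for w
  define N where "N w = of_real n + of_real n' * w\<^sup>2 + w ^ 4 * R2 w" for w
  define K where "K w = w * (- of_real v * of_real e' - of_real v * w\<^sup>2 * R1 w + R1 w - of_real \<mu> * R2 w) / E w" for w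
  have inv: "filterlim (\<lambda>z::complex. 1 / z) (nhds 0) at_infinity"
    using tendsto_inverse_0 by (simp add: divide_inverse)
  have "isCont R1 0" "isCont R2 0" using c by (auto simp: continuous_on_eq_continuous_at)
  then have "isCont K 0"
    unfolding K_def E_def using e by (intro continuous_intros) auto
  then have "(K \<longlongrightarrow> K 0) (nhds 0)"
    using isCont_def tendsto_at_iff_tendsto_nhds by blast
  then have "((\<lambda>z. K (1 / z)) \<longlongrightarrow> K 0) at_infinity" using inv by (rule filterlim_compose)
  then have lim: "((\<lambda>z. K (1 / z)) \<longlongrightarrow> 0) at_infinity" by (simp add: K_def)
  have "isCont E 0" unfolding E_def using \<open>isCont R1 0\<close> by (intro continuous_intros)
  then have "((\<lambda>z. E (1 / z)) \<longlongrightarrow> E 0) at_infinity"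
    using inv isCont_def tendsto_at_iff_tendsto_nhds filterlim_compose by blast
  then have evE: "\<forall>\<^sub>F z in at_infinity. E (1 / z) \<noteq> 0"
    using tendsto_imp_eventually_ne[of _ "E 0" _ 0] e by (simp add: E_def)
  have "\<forall>\<^sub>F z in at_infinity. K (1 / z) = z * (z * (z - of_real \<mu> * (Q z / P z)) - of_real v)"
    using evE eventually_not_equal_at_infinity[of "0::complex"]
  proof eventually_elim
    case (elim z)
    define w where "w = 1 / z"
    have w: "w \<noteq> 0" "z = 1 / w" using elim by (auto simp: w_def)
    have Ew: "E w \<noteq> 0" using elim by (simp add: w_def)
    have QP: "Q z / P z = N w / (w * E w)"
      using elim(2) w(1) Ew unfolding P[OF elim(2)] Q[OF elim(2)] w_def[symmetric] E_def[symmetric] N_def[symmetric]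
      by (simp add: field_simps)
    have num: "E w - of_real \<mu> * N w - of_real v * w\<^sup>2 * E w
      = w ^ 4 * (- of_real v * of_real e' - of_real v * w\<^sup>2 * R1 w + R1 w - of_real \<mu> * R2 w)"
    proof -
      have "of_real \<mu> * complex_of_real n = of_real e" "of_real v * complex_of_real e = of_real e' - of_real \<mu> * of_real n'"
        using \<mu>n ev by (metis of_real_mult, metis mult.commute of_real_diff of_real_mult)
      moreover have "E w - of_real \<mu> * N w - of_real v * w\<^sup>2 * E w
        = (of_real e - of_real \<mu> * complex_of_real n) + (of_real e' - of_real \<mu> * of_real n' - of_real v * complex_of_real e) * w\<^sup>2
          + w ^ 4 * (- of_real v * of_real e' - of_real v * w\<^sup>2 * R1 w + R1 w - of_real \<mu> * R2 w)"
        by (simp add: E_def N_def power4_eq_xxxx power2_eq_square algebra_simps)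
      ultimately show ?thesis by simp
    qed
    have "z * (z * (z - of_real \<mu> * (Q z / P z)) - of_real v) = (E w - of_real \<mu> * N w - of_real v * w\<^sup>2 * E w) / (w ^ 3 * E w)"
      unfolding QP using w Ew by (simp add: w(2) field_simps power2_eq_square power3_eq_cube)
    also have "\<dots> = K w" unfolding num K_def using w(1) Ew by (simp add: field_simps eval_nat_numeral)
    finally show ?case by (simp add: w_def)
  qed
  then show ?thesis using lim unfolding \<mu>_def v_def by (rule tendsto_cong[THEN iffD1])
qed

text \<open>The coefficient of total degree \<open>r\<close> in the double generating sum of
  \<open>Q\<close>.\<close>

definition coef :: "(nat \<Rightarrow> nat \<Rightarrow> real) \<Rightarrow> nat \<Rightarrow> real" where
  "coef Q r = (\<Sum>s\<le>r. Q s (r - s))"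

lemma coef_antisym:
  assumes "\<And>s t. Q t s = (- 1) ^ (s + t + e) * Q s t" and "odd (r + e)"
  shows "coef Q r = 0"
proof -
  have "coef Q r = (\<Sum>s\<le>r. Q (r - s) s)"
    unfolding coef_def by (rule sum.reindex_bij_witness[of _ "\<lambda>s. r - s" "\<lambda>s. r - s"]) auto
  also have "\<dots> = (\<Sum>s\<le>r. - Q s (r - s))"
  proof (rule sum.cong[OF refl])
    fix s assume "s \<in> {..r}"
    then have "s + (r - s) + e = r + e" by simp
    then show "Q (r - s) s = - Q s (r - s)" using assms(1)[of "r - s" s] assms(2) by simp
  qed
  also have "\<dots> = - coef Q r" by (simp add: coef_def sum_negf)
  finally show ?thesis by simp
qed

lemma double_sum_expansion:
  fixes Q :: "nat \<Rightarrow> nat \<Rightarrow> real"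
  assumes Q: "\<And>s t. s > n \<or> t > n \<Longrightarrow> Q s t = 0"
  obtains R :: "complex \<Rightarrow> complex" where "continuous_on UNIV R"
    "\<And>w. (\<Sum>s\<le>n. \<Sum>t\<le>n. of_real (Q s t) * w ^ (s + t)) = (\<Sum>r<6. of_real (coef Q r) * w ^ r) + w ^ 6 * R w"
proof
  define N where "N = 2 * n + 6"
  define R where "R w = (\<Sum>r = 6..N. of_real (coef Q r) * w ^ (r - 6))" for w :: complex
  show "continuous_on UNIV R" unfolding R_def by (intro continuous_intros)
  fix w :: complex
  have "(\<Sum>s\<le>n. \<Sum>t\<le>n. of_real (Q s t) * w ^ (s + t)) = (\<Sum>(s, t)\<in>{..n} \<times> {..n}. of_real (Q s t) * w ^ (s + t))"
    by (simp add: sum.cartesian_product)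
  also have "\<dots> = (\<Sum>(s, t)\<in>{(s, t). s + t \<le> N}. of_real (Q s t) * w ^ (s + t))"
  proof (rule sum.mono_neutral_left)
    have "{(s, t). s + t \<le> N} \<subseteq> {..N} \<times> {..N}" by auto
    then show "finite {(s, t). s + t \<le> N}" using finite_subset by blast
    show "\<forall>p\<in>{(s, t). s + t \<le> N} - {..n} \<times> {..n}. (case p of (s, t) \<Rightarrow> complex_of_real (Q s t) * w ^ (s + t)) = 0"
    proof
      fix p assume "p \<in> {(s, t). s + t \<le> N} - {..n} \<times> {..n}"
      then obtain s t where "p = (s, t)" "s > n \<or> t > n" by (cases p) auto
      then show "(case p of (s, t) \<Rightarrow> complex_of_real (Q s t) * w ^ (s + t)) = 0" using Q[of s t] by simp
    qed
  qed (auto simp: N_def)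
  also have "\<dots> = (\<Sum>r\<le>N. \<Sum>s\<le>r. of_real (Q s (r - s)) * w ^ (s + (r - s)))"
    using sum.triangle_reindex_eq[of "\<lambda>s t. of_real (Q s t) * w ^ (s + t)" N] by simp
  also have "\<dots> = (\<Sum>r\<le>N. of_real (coef Q r) * w ^ r)"
    by (rule sum.cong) (auto simp: coef_def sum_distrib_right)
  also have "\<dots> = (\<Sum>r\<in>{..<6} \<union> {6..N}. of_real (coef Q r) * w ^ r)"
    by (rule sum.cong) (auto simp: N_def)
  also have "\<dots> = (\<Sum>r<6. of_real (coef Q r) * w ^ r) + (\<Sum>r = 6..N. of_real (coef Q r) * w ^ r)"
    by (rule sum.union_disjoint) auto
  also have "(\<Sum>r = 6..N. of_real (coef Q r) * w ^ r) = w ^ 6 * R w"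
    unfolding R_def sum_distrib_left
    by (rule sum.cong) (auto simp: mult.left_commute simp flip: power_add)
  finally show "(\<Sum>s\<le>n. \<Sum>t\<le>n. of_real (Q s t) * w ^ (s + t)) = (\<Sum>r<6. of_real (coef Q r) * w ^ r) + w ^ 6 * R w" .
qed

lemma sum_Pow_card:
  fixes f :: "nat set \<Rightarrow> 'a :: comm_monoid_add"
  assumes "finite U"
  shows "(\<Sum>I\<in>Pow U. f I) = (\<Sum>s\<le>card U. \<Sum>I | I \<subseteq> U \<and> card I = s. f I)"
proof -
  have "(\<Sum>s\<le>card U. \<Sum>I | I \<in> Pow U \<and> card I = s. f I) = (\<Sum>I\<in>Pow U. f I)"
    by (rule sum.group) (use assms in \<open>auto intro: card_mono\<close>)
  then show ?thesis by (simp add: Pow_def)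
qed

definition level :: "nat set \<Rightarrow> (nat set \<Rightarrow> nat set \<Rightarrow> real) \<Rightarrow> nat \<Rightarrow> nat \<Rightarrow> real" where
  "level U g s t = (\<Sum>I | I \<subseteq> U \<and> card I = s. \<Sum>J | J \<subseteq> U \<and> card J = t. g I J)"

lemma level_swap:
  assumes "\<And>I J. I \<subseteq> U \<Longrightarrow> J \<subseteq> U \<Longrightarrow> g J I = (- 1) ^ (card I + card J + e) * g I J"
  shows "level U g t s = (- 1) ^ (s + t + e) * level U g s t"
proof -
  have "level U g t s = (\<Sum>I | I \<subseteq> U \<and> card I = s. \<Sum>J | J \<subseteq> U \<and> card J = t. g J I)"
    unfolding level_def by (rule sum.swap)
  also have "\<dots> = (\<Sum>I | I \<subseteq> U \<and> card I = s. \<Sum>J | J \<subseteq> U \<and> card J = t. (- 1) ^ (s + t + e) * g I J)"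
  proof (intro sum.cong refl)
    fix I J assume "I \<in> {I. I \<subseteq> U \<and> card I = s}" "J \<in> {J. J \<subseteq> U \<and> card J = t}"
    then show "g J I = (- 1) ^ (s + t + e) * g I J" using assms[of I J] by simp
  qed
  finally show ?thesis by (simp add: level_def sum_distrib_left)
qed

text \<open>Exchanging \<open>I\<close> and \<open>J\<close> changes the sign of every term of the
  wrong parity, so these coefficients vanish; \<open>e\<close> records the parity, which is even for
  \<open>gL\<close> and \<open>gE\<close> and odd for \<open>gN\<close>. Six explicit coefficients
  are taken because \<open>gE\<close> starts in degree 2: two terms of it followed by a remainder
  require exactly the cut at \<open>w ^ 6\<close>.\<close>

lemma level_expansion:
  assumes U: "finite U"
    and sym: "\<And>I J. I \<subseteq> U \<Longrightarrow> J \<subseteq> U \<Longrightarrow> g J I = (- 1) ^ (card I + card J + e) * g I J"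
  obtains R :: "complex \<Rightarrow> complex" where "continuous_on UNIV R"
    "\<And>w. (\<Sum>I\<in>Pow U. \<Sum>J\<in>Pow U. of_real (g I J) * w ^ (card I + card J))
      = (\<Sum>r<6. of_real (if odd (r + e) then 0 else coef (level U g) r) * w ^ r) + w ^ 6 * R w"
proof -
  have "level U g s t = 0" if "s > card U \<or> t > card U" for s t
  proof -
    have e: "{I. I \<subseteq> U \<and> card I = r} = {}" if r: "r > card U" for r
    proof -
      have "card I \<noteq> r" if "I \<subseteq> U" for I using card_mono[OF U that] r by linarith
      then show ?thesis by blast
    qed
    from that show ?thesis
    proof
      assume "s > card U"
      then show ?thesis unfolding level_def by (simp only: e sum.empty)
    next
      assume "t > card U"
      then show ?thesis unfolding level_def by (simp only: e sum.empty sum.neutral_const)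
    qed
  qed
  then show ?thesis
  proof (rule double_sum_expansion)
    fix R :: "complex \<Rightarrow> complex"
    assume R: "continuous_on UNIV R"
      "\<And>w. (\<Sum>s\<le>card U. \<Sum>t\<le>card U. of_real (level U g s t) * w ^ (s + t)) = (\<Sum>r<6. of_real (coef (level U g) r) * w ^ r) + w ^ 6 * R w"
    show ?thesis
    proof (rule that[OF R(1)])
      fix w :: complex
      have "(\<Sum>I\<in>Pow U. \<Sum>J\<in>Pow U. of_real (g I J) * w ^ (card I + card J))
        = (\<Sum>s\<le>card U. \<Sum>I | I \<subseteq> U \<and> card I = s. \<Sum>t\<le>card U. \<Sum>J | J \<subseteq> U \<and> card J = t. of_real (g I J) * w ^ (card I + card J))"
        unfolding sum_Pow_card[OF U] ..
      also have "\<dots> = (\<Sum>s\<le>card U. \<Sum>t\<le>card U. \<Sum>I | I \<subseteq> U \<and> card I = s. \<Sum>J | J \<subseteq> U \<and> card J = t. of_real (g I J) * w ^ (card I + card J))"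
        by (rule sum.cong[OF refl]) (rule sum.swap)
      also have "\<dots> = (\<Sum>s\<le>card U. \<Sum>t\<le>card U. of_real (level U g s t) * w ^ (s + t))"
        unfolding level_def of_real_sum sum_distrib_right by (auto intro!: sum.cong)
      also have "\<dots> = (\<Sum>r<6. of_real (coef (level U g) r) * w ^ r) + w ^ 6 * R w" by (rule R(2))
      also have "(\<Sum>r<6. of_real (coef (level U g) r) * w ^ r) = (\<Sum>r<6. of_real (if odd (r + e) then 0 else coef (level U g) r) * w ^ r)"
      proof (rule sum.cong[OF refl])
        fix r
        have "coef (level U g) r = 0" if "odd (r + e)"
          by (rule coef_antisym[OF level_swap that]) (rule sym)
        then show "of_real (coef (level U g) r) * w ^ r = of_real (if odd (r + e) then 0 else coef (level U g) r) * w ^ r" by simp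
      qed
      finally show "(\<Sum>I\<in>Pow U. \<Sum>J\<in>Pow U. of_real (g I J) * w ^ (card I + card J))
        = (\<Sum>r<6. of_real (if odd (r + e) then 0 else coef (level U g) r) * w ^ r) + w ^ 6 * R w" .
    qed
  qed
qed

text \<open>Inclusion and exclusion over the three coincidences; the full diagonal is removed three
  times and has to be restored twice.\<close>

lemma sum_distinct3:
  fixes f :: "nat \<Rightarrow> nat \<Rightarrow> nat \<Rightarrow> real"
  assumes U: "finite U"
  shows "(\<Sum>i\<in>U. \<Sum>j\<in>U. \<Sum>l\<in>U. if i \<noteq> j \<and> i \<noteq> l \<and> j \<noteq> l then f i j l else 0)
    = (\<Sum>i\<in>U. \<Sum>j\<in>U. \<Sum>l\<in>U. f i j l) - (\<Sum>i\<in>U. \<Sum>l\<in>U. f i i l) - (\<Sum>i\<in>U. \<Sum>j\<in>U. f i j i)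
      - (\<Sum>i\<in>U. \<Sum>j\<in>U. f i j j) + 2 * (\<Sum>i\<in>U. f i i i)"
proof -
  have "(if i \<noteq> j \<and> i \<noteq> l \<and> j \<noteq> l then f i j l else 0)
    = f i j l - (if i = j then f i i l else 0) - (if i = l then f i j i else 0) - (if j = l then f i j j else 0)
      + 2 * (if i = j then if i = l then f i i i else 0 else 0)" for i j l by auto
  moreover have "(\<Sum>j\<in>U. \<Sum>l\<in>U. if i = j then f i i l else 0) = (\<Sum>l\<in>U. f i i l)" if "i \<in> U" for i
    using U that by (subst sum.swap) simp
  moreover have "(\<Sum>j\<in>U. \<Sum>l\<in>U. if i = j then if i = l then f i i i else 0 else 0) = f i i i" if "i \<in> U" for i
    using U that by (subst sum.swap) simp
  ultimately show ?thesis
    using U by (simp add: sum.distrib sum_subtractf flip: sum_distrib_left)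
qed

lemma sum_Pow_insert:
  fixes f :: "'b set \<Rightarrow> 'a :: comm_monoid_add"
  assumes "finite U" "k \<notin> U"
  shows "(\<Sum>I\<in>Pow (insert k U). f I) = (\<Sum>I\<in>Pow U. f I) + (\<Sum>I\<in>Pow U. f (insert k I))"
proof -
  have "inj_on (insert k) (Pow U)" using assms(2) by (intro inj_onI) (auto simp: insert_ident)
  then have "(\<Sum>I\<in>insert k ` Pow U. f I) = (\<Sum>I\<in>Pow U. f (insert k I))" by (simp add: sum.reindex)
  moreover have "Pow U \<inter> insert k ` Pow U = {}" using assms(2) by auto
  ultimately show ?thesis unfolding Pow_insert using assms(1) by (subst sum.union_disjoint) auto
qed

lemma pair_sum_insert:
  assumes U: "finite U" "k \<notin> U"
  shows "pair_sum c c' (insert k U) n a b m =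
    n k * pair_sum c c' U n a b m + a k * pair_sum (\<lambda>I. c (insert k I)) c' U n a b m
    + b k * pair_sum c (\<lambda>J. c' (insert k J)) U n a b m
    + m k * pair_sum (\<lambda>I. c (insert k I)) (\<lambda>J. c' (insert k J)) U n a b m"
proof -
  have w: "(\<Prod>i\<in>U. pair_wt n a b m I' J' i) = (\<Prod>i\<in>U. pair_wt n a b m I J i)" if "I' - {k} = I - {k}" "J' - {k} = J - {k}" for I I' J J'
  proof (rule prod.cong[OF refl])
    fix i assume "i \<in> U"
    then have "i \<in> I' \<longleftrightarrow> i \<in> I" "i \<in> J' \<longleftrightarrow> i \<in> J" using that U(2) by blast+
    then show "pair_wt n a b m I' J' i = pair_wt n a b m I J i" by (simp add: pair_wt_def)
  qed
  have w1: "(\<Prod>i\<in>insert k U. pair_wt n a b m I J i) = n k * (\<Prod>i\<in>U. pair_wt n a b m I J i)"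
    and w2: "(\<Prod>i\<in>insert k U. pair_wt n a b m (insert k I) J i) = a k * (\<Prod>i\<in>U. pair_wt n a b m I J i)"
    and w3: "(\<Prod>i\<in>insert k U. pair_wt n a b m I (insert k J) i) = b k * (\<Prod>i\<in>U. pair_wt n a b m I J i)"
    and w4: "(\<Prod>i\<in>insert k U. pair_wt n a b m (insert k I) (insert k J) i) = m k * (\<Prod>i\<in>U. pair_wt n a b m I J i)"
    if "I \<in> Pow U" "J \<in> Pow U" for I J
  proof -
    have k: "k \<notin> I" "k \<notin> J" using that U(2) by auto
    show "(\<Prod>i\<in>insert k U. pair_wt n a b m I J i) = n k * (\<Prod>i\<in>U. pair_wt n a b m I J i)"
      using U k by (simp add: pair_wt_def[of n a b m I J k])
    show "(\<Prod>i\<in>insert k U. pair_wt n a b m (insert k I) J i) = a k * (\<Prod>i\<in>U. pair_wt n a b m I J i)"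
      using U k w[of "insert k I" I J J] by (simp add: pair_wt_def[of n a b m "insert k I" J k])
    show "(\<Prod>i\<in>insert k U. pair_wt n a b m I (insert k J) i) = b k * (\<Prod>i\<in>U. pair_wt n a b m I J i)"
      using U k w[of I I "insert k J" J] by (simp add: pair_wt_def[of n a b m I "insert k J" k])
    show "(\<Prod>i\<in>insert k U. pair_wt n a b m (insert k I) (insert k J) i) = m k * (\<Prod>i\<in>U. pair_wt n a b m I J i)"
      using U k w[of "insert k I" I "insert k J" J] by (simp add: pair_wt_def[of n a b m "insert k I" "insert k J" k])
  qed
  have "pair_sum c c' (insert k U) n a b m = (\<Sum>I\<in>Pow U. \<Sum>J\<in>Pow U.
      of_real (c I * c' J) * (n k * (\<Prod>i\<in>U. pair_wt n a b m I J i))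
      + of_real (c I * c' (insert k J)) * (b k * (\<Prod>i\<in>U. pair_wt n a b m I J i))
      + (of_real (c (insert k I) * c' J) * (a k * (\<Prod>i\<in>U. pair_wt n a b m I J i))
      + of_real (c (insert k I) * c' (insert k J)) * (m k * (\<Prod>i\<in>U. pair_wt n a b m I J i))))"
    unfolding pair_sum_def sum_Pow_insert[OF U] sum.distrib[symmetric]
    by (intro sum.cong refl) (simp only: w1 w2 w3 w4)
  then show ?thesis
    unfolding pair_sum_def sum_distrib_left sum.distrib[symmetric] by (simp add: algebra_simps)
qed

text \<open>This is \<open>\<Sum> f I * g J * X ^ card (I \<inter> J) * y ^ (2 * card U - card I -
  card J)\<close>. The coefficient functions stay arguments so that minors enlarged by a fixed
  vertex can be inserted.\<close>

definition pair_poly :: "(nat set \<Rightarrow> real) \<Rightarrow> (nat set \<Rightarrow> real) \<Rightarrow> nat set \<Rightarrow> real \<Rightarrow> 'a \<Rightarrow> 'a :: real_field" where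
  "pair_poly f g U X y = pair_sum f g U (\<lambda>_. y\<^sup>2) (\<lambda>_. y) (\<lambda>_. y) (\<lambda>_. of_real X)"

lemma pair_poly_of_real: "pair_poly f g U X (of_real y) = of_real (pair_poly f g U X y)"
  unfolding pair_poly_def pair_sum_of_real[symmetric] by simp

lemma pair_poly_insert:
  assumes "finite U" "k \<notin> U"
  shows "pair_poly f g (insert k U) X y = y\<^sup>2 * pair_poly f g U X y
    + y * (pair_poly (\<lambda>I. f (insert k I)) g U X y + pair_poly f (\<lambda>J. g (insert k J)) U X y)
    + of_real X * pair_poly (\<lambda>I. f (insert k I)) (\<lambda>J. g (insert k J)) U X y"
  unfolding pair_poly_def pair_sum_insert[OF assms] by (simp add: algebra_simps)

lemma prod_pair_wt_const:
  fixes y :: "'a :: field"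
  assumes U: "finite U" and IJ: "I \<subseteq> U" "J \<subseteq> U" and y: "y \<noteq> 0"
  shows "(\<Prod>i\<in>U. pair_wt (\<lambda>_. y\<^sup>2) (\<lambda>_. y) (\<lambda>_. y) (\<lambda>_. X) I J i)
    = y ^ (2 * card U) * (X ^ card (I \<inter> J) * (1 / y) ^ (card I + card J))"
proof -
  have pc: "(\<Prod>i\<in>U. if i \<in> S then z else 1) = z ^ card S" if "S \<subseteq> U" for S and z :: 'a
    using U that by (simp add: prod.If_cases Int_absorb1)
  have "(\<Prod>i\<in>U. pair_wt (\<lambda>_. y\<^sup>2) (\<lambda>_. y) (\<lambda>_. y) (\<lambda>_. X) I J i)
    = (\<Prod>i\<in>U. y\<^sup>2 * ((if i \<in> I \<inter> J then X else 1) * ((if i \<in> I then 1 / y else 1) * (if i \<in> J then 1 / y else 1))))"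
    by (rule prod.cong) (use y in \<open>auto simp: pair_wt_def power2_eq_square\<close>)
  also have "\<dots> = y ^ (2 * card U) * (X ^ card (I \<inter> J) * ((1 / y) ^ card I * (1 / y) ^ card J))"
    unfolding prod.distrib using IJ pc[of "I \<inter> J" X] by (simp add: pc power_mult le_infI1)
  finally show ?thesis by (simp only: power_add)
qed

lemma pair_poly_expand:
  fixes y :: "'a :: real_field"
  assumes U: "finite U" and y: "y \<noteq> 0"
  shows "pair_poly f g U X y = y ^ (2 * card U) *
    (\<Sum>I\<in>Pow U. \<Sum>J\<in>Pow U. of_real (f I * g J * X ^ card (I \<inter> J)) * (1 / y) ^ (card I + card J))"
proof -
  have "pair_poly f g U X y = (\<Sum>I\<in>Pow U. \<Sum>J\<in>Pow U. y ^ (2 * card U) * (of_real (f I * g J * X ^ card (I \<inter> J)) * (1 / y) ^ (card I + card J)))"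
    unfolding pair_poly_def pair_sum_def
    by (intro sum.cong refl) (subst prod_pair_wt_const[OF U], use y in auto)
  then show ?thesis by (simp only: sum_distrib_left)
qed

definition sum3 :: "nat set \<Rightarrow> (nat \<Rightarrow> nat \<Rightarrow> nat \<Rightarrow> real) \<Rightarrow> real" where
  "sum3 U f = (\<Sum>i\<in>U. \<Sum>j\<in>U. \<Sum>l\<in>U. if i \<noteq> j \<and> i \<noteq> l \<and> j \<noteq> l then f i j l else 0)"

lemma sum3_swap12: "sum3 U (\<lambda>i j l. f j i l) = sum3 U f"
  unfolding sum3_def by (subst sum.swap) (auto intro!: sum.cong)

lemma sum3_swap23: "sum3 U (\<lambda>i j l. f i l j) = sum3 U f"
  unfolding sum3_def by (rule sum.cong[OF refl], subst sum.swap) (auto intro!: sum.cong)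

lemma sum3_add: "sum3 U (\<lambda>i j l. f i j l + g i j l) = sum3 U f + sum3 U g"
  unfolding sum3_def sum.distrib[symmetric] by (intro sum.cong refl) simp

lemma sum3_cmult: "sum3 U (\<lambda>i j l. c * f i j l) = c * sum3 U f"
  unfolding sum3_def sum_distrib_left by (auto intro!: sum.cong)

lemma sum3_cong:
  "(\<And>i j l. i \<in> U \<Longrightarrow> j \<in> U \<Longrightarrow> l \<in> U \<Longrightarrow> i \<noteq> j \<Longrightarrow> i \<noteq> l \<Longrightarrow> j \<noteq> l \<Longrightarrow> f i j l = g i j l) \<Longrightarrow> sum3 U f = sum3 U g"
  unfolding sum3_def by (auto intro!: sum.cong)

lemma sum_card_3':
  fixes f :: "nat set \<Rightarrow> real"
  assumes "finite V"
  shows "(\<Sum>I | I \<subseteq> V \<and> card I = 3. f I) = sum3 V (\<lambda>i j l. f {i, j, l}) / 6"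
  using sum_card_3[OF assms] by (simp add: sum3_def)

lemma sum3_eq:
  assumes "finite U"
  shows "sum3 U f = (\<Sum>i\<in>U. \<Sum>j\<in>U. \<Sum>l\<in>U. f i j l) - (\<Sum>i\<in>U. \<Sum>l\<in>U. f i i l) - (\<Sum>i\<in>U. \<Sum>j\<in>U. f i j i)
      - (\<Sum>i\<in>U. \<Sum>j\<in>U. f i j j) + 2 * (\<Sum>i\<in>U. f i i i)"
  unfolding sum3_def by (rule sum_distinct3[OF assms])

text \<open>The squared entries are the unsigned adjacency matrix, so the row condition is
  \<open>D\<close>-regularity; \<open>D\<close> is real because it enters real inequalities
  only.\<close>

locale signed_regular =
  fixes A :: "nat \<Rightarrow> nat \<Rightarrow> real" and V :: "nat set" and D :: real
  assumes finV: "finite V" and sym: "A i j = A j i" and diag [simp]: "A i i = 0"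
    and signs: "A i j \<in> {-1, 0, 1}" and row: "i \<in> V \<Longrightarrow> (\<Sum>j\<in>V. (A i j)\<^sup>2) = D"
begin

definition cm :: "nat set \<Rightarrow> real" where "cm I = mdet I (\<lambda>i j. - A i j)"
definition cp :: "nat set \<Rightarrow> real" where "cp I = mdet I A"

lemma cp_cm: "finite I \<Longrightarrow> cp I = (- 1) ^ card I * cm I"
  by (simp add: cm_def cp_def mdet_uminus)

lemma cm_0 [simp]: "cm {} = 1" by (simp add: cm_def)
lemma cp_0 [simp]: "cp {} = 1" by (simp add: cp_def)
lemma cm_1 [simp]: "cm {i} = 0" by (simp add: cm_def mdet_1)
lemma cp_1 [simp]: "cp {i} = 0" by (simp add: cp_def mdet_1)

lemma cm_2: "i \<noteq> j \<Longrightarrow> cm {i, j} = - (A i j)\<^sup>2"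
  by (simp add: cm_def mdet_2 power2_eq_square sym[of j i])

lemma cp_2: "i \<noteq> j \<Longrightarrow> cp {i, j} = - (A i j)\<^sup>2"
  by (simp add: cp_cm cm_2)

lemma cp_3: "k \<noteq> i \<Longrightarrow> k \<noteq> j \<Longrightarrow> i \<noteq> j \<Longrightarrow> cp {k, i, j} = 2 * (A k i * A i j * A k j)"
  unfolding cp_def by (rule mdet_3[OF _ _ _ sym diag])

lemma cm_3: "k \<noteq> i \<Longrightarrow> k \<noteq> j \<Longrightarrow> i \<noteq> j \<Longrightarrow> cm {k, i, j} = - 2 * (A k i * A i j * A k j)"
  using cp_3[of k i j] cp_cm[of "{k, i, j}"] by simp

lemma cp_4:
  assumes "k \<noteq> i" "k \<noteq> j" "k \<noteq> l" "i \<noteq> j" "i \<noteq> l" "j \<noteq> l"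
  shows "cp {k, i, j, l} = (A k i)\<^sup>2 * (A j l)\<^sup>2 + (A k j)\<^sup>2 * (A i l)\<^sup>2 + (A k l)\<^sup>2 * (A i j)\<^sup>2
    - 2 * (A k i * A i j * A j l * A k l + A k i * A i l * A l j * A k j + A k j * A j i * A i l * A k l)"
  unfolding cp_def by (rule mdet_4[OF assms sym diag])

end

section \<open>Coefficients for a signed regular graph\<close>

locale signed_regular_vertex = signed_regular +
  fixes k :: nat
  assumes kV: "k \<in> V"
begin

definition U :: "nat set" where "U = V - {k}"
definition a :: "nat \<Rightarrow> real" where "a i = A k i"
definition Aa :: "nat \<Rightarrow> real" where "Aa i = (\<Sum>j\<in>U. A i j * a j)"
text \<open>\<open>B\<close> is twice the number of edges avoiding \<open>k\<close>.
  \<open>w\<close> counts, with signs, the closed walks of length four from \<open>k\<close> whose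
  middle vertex is not \<open>k\<close>, and \<open>wN\<close> those whose middle vertex is a
  neighbour of \<open>k\<close>. \<open>\<tau>\<close> and \<open>t\<close> are twice the signed and
  the unsigned number of triangles at \<open>k\<close>.\<close>

definition B :: real where "B = (\<Sum>i\<in>U. \<Sum>j\<in>U. (A i j)\<^sup>2)"
definition w :: real where "w = (\<Sum>i\<in>U. (Aa i)\<^sup>2)"
definition wN :: real where "wN = (\<Sum>i\<in>U. (a i)\<^sup>2 * (Aa i)\<^sup>2)"
definition \<tau> :: real where "\<tau> = (\<Sum>i\<in>U. a i * Aa i)"
definition t :: real where "t = (\<Sum>i\<in>U. \<Sum>j\<in>U. (a i)\<^sup>2 * (a j)\<^sup>2 * (A i j)\<^sup>2)"

lemma finU: "finite U" using finV by (simp add: U_def)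
lemma kU: "k \<notin> U" "V = insert k U" using kV by (auto simp: U_def)

lemma a_signs: "a i \<in> {-1, 0, 1}"
  using signs[of k i] by (simp add: a_def)

lemma sum_a: "(\<Sum>i\<in>U. (a i)\<^sup>2) = D"
  using row[OF kV] by (simp add: sum.remove[OF finV kV] a_def U_def)

lemma sum_row: "i \<in> U \<Longrightarrow> (\<Sum>j\<in>U. (A i j)\<^sup>2) = D - (a i)\<^sup>2"
  using row[of i] sym[of i k] by (simp add: sum.remove[OF finV kV] a_def U_def)

lemma sum_aA: "(\<Sum>i\<in>U. \<Sum>j\<in>U. (a i)\<^sup>2 * (A i j)\<^sup>2) = D * (D - 1)"
proof -
  have "(\<Sum>i\<in>U. \<Sum>j\<in>U. (a i)\<^sup>2 * (A i j)\<^sup>2) = (\<Sum>i\<in>U. D * (a i)\<^sup>2 - (a i)\<^sup>2)"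
  proof (rule sum.cong[OF refl])
    fix i assume "i \<in> U"
    then have "(\<Sum>j\<in>U. (a i)\<^sup>2 * (A i j)\<^sup>2) = (a i)\<^sup>2 * (D - (a i)\<^sup>2)"
      by (simp only: sum_distrib_left[symmetric] sum_row)
    then show "(\<Sum>j\<in>U. (a i)\<^sup>2 * (A i j)\<^sup>2) = D * (a i)\<^sup>2 - (a i)\<^sup>2" using a_signs[of i] by auto
  qed
  also have "\<dots> = D * (D - 1)"
    by (simp add: sum_subtractf sum_distrib_left[symmetric] sum_a right_diff_distrib)
  finally show ?thesis .
qed

lemma sum_aA': "(\<Sum>i\<in>U. (a i)\<^sup>2 * (\<Sum>j\<in>U. (A i j)\<^sup>2)) = D * (D - 1)"
  using sum_aA by (simp only: sum_distrib_left)

lemma w_eq: "(\<Sum>i\<in>U. \<Sum>j\<in>U. \<Sum>l\<in>U. a i * A i j * A j l * a l) = w"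
proof -
  have "w = (\<Sum>j\<in>U. \<Sum>i\<in>U. \<Sum>l\<in>U. (A j i * a i) * (A j l * a l))"
    unfolding w_def Aa_def power2_eq_square sum_product ..
  also have "\<dots> = (\<Sum>i\<in>U. \<Sum>j\<in>U. \<Sum>l\<in>U. (A j i * a i) * (A j l * a l))" by (rule sum.swap)
  also have "\<dots> = (\<Sum>i\<in>U. \<Sum>j\<in>U. \<Sum>l\<in>U. a i * A i j * A j l * a l)"
  proof (intro sum.cong refl)
    fix i j l show "(A j i * a i) * (A j l * a l) = a i * A i j * A j l * a l" using sym[of j i] by simp
  qed
  finally show ?thesis by simp
qed

lemma wN_eq: "(\<Sum>i\<in>U. \<Sum>j\<in>U. \<Sum>l\<in>U. a i * A i j * A j l * a l * (a j)\<^sup>2) = wN"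
proof -
  have "wN = (\<Sum>j\<in>U. (a j)\<^sup>2 * (\<Sum>i\<in>U. \<Sum>l\<in>U. (A j i * a i) * (A j l * a l)))"
    unfolding wN_def Aa_def power2_eq_square[of "sum _ _"] sum_product ..
  also have "\<dots> = (\<Sum>j\<in>U. \<Sum>i\<in>U. \<Sum>l\<in>U. (a j)\<^sup>2 * ((A j i * a i) * (A j l * a l)))"
    by (simp only: sum_distrib_left)
  also have "\<dots> = (\<Sum>i\<in>U. \<Sum>j\<in>U. \<Sum>l\<in>U. (a j)\<^sup>2 * ((A j i * a i) * (A j l * a l)))" by (rule sum.swap)
  also have "\<dots> = (\<Sum>i\<in>U. \<Sum>j\<in>U. \<Sum>l\<in>U. a i * A i j * A j l * a l * (a j)\<^sup>2)"
  proof (intro sum.cong refl)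
    fix i j l show "(a j)\<^sup>2 * ((A j i * a i) * (A j l * a l)) = a i * A i j * A j l * a l * (a j)\<^sup>2"
      using sym[of j i] by simp
  qed
  finally show ?thesis by simp
qed

lemma sum_Aa: "(\<Sum>i\<in>U. \<Sum>j\<in>U. (a j)\<^sup>2 * (A i j)\<^sup>2) = D * (D - 1)"
proof -
  have "(\<Sum>i\<in>U. \<Sum>j\<in>U. (a j)\<^sup>2 * (A i j)\<^sup>2) = (\<Sum>j\<in>U. \<Sum>i\<in>U. (a j)\<^sup>2 * (A j i)\<^sup>2)"
    by (subst sum.swap) (simp add: sym)
  then show ?thesis using sum_aA by simp
qed

lemma sum3_P1: "sum3 U (\<lambda>i j l. (a i)\<^sup>2 * (A j l)\<^sup>2) = D * B - 2 * (D * (D - 1))"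
proof -
  have "(\<Sum>i\<in>U. \<Sum>j\<in>U. \<Sum>l\<in>U. (a i)\<^sup>2 * (A j l)\<^sup>2) = D * B"
    by (simp only: B_def sum_distrib_left[symmetric] sum_distrib_right[symmetric] sum_a)
  moreover have "(\<Sum>i\<in>U. \<Sum>j\<in>U. (a i)\<^sup>2 * (A j i)\<^sup>2) = D * (D - 1)"
    using sum_aA by (simp add: sym[of _ i for i])
  ultimately show ?thesis unfolding sum3_eq[OF finU] by (simp add: sum_aA)
qed

lemma sum3_P2: "sum3 U (\<lambda>i j l. a i * A i j * A j l * a l) = w - D * (D - 1)"
proof -
  have "(\<Sum>i\<in>U. \<Sum>j\<in>U. a i * A i j * A j i * a i) = (\<Sum>i\<in>U. \<Sum>j\<in>U. (a i)\<^sup>2 * (A i j)\<^sup>2)"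
  proof (intro sum.cong refl)
    fix i j show "a i * A i j * A j i * a i = (a i)\<^sup>2 * (A i j)\<^sup>2"
      using sym[of j i] by (simp add: power2_eq_square)
  qed
  then show ?thesis unfolding sum3_eq[OF finU] w_eq by (simp add: sum_aA)
qed

lemma sum3_P1_weighted:
  "sum3 U (\<lambda>i j l. (a i)\<^sup>2 * (A j l)\<^sup>2 * ((a i)\<^sup>2 + (a j)\<^sup>2 + (a l)\<^sup>2)) = D * B + 2 * (D * (D * (D - 1))) - 4 * (D * (D - 1)) - 2 * t"
proof -
  have "(a i)\<^sup>2 * (A j l)\<^sup>2 * ((a i)\<^sup>2 + (a j)\<^sup>2 + (a l)\<^sup>2)
      = (a i)\<^sup>2 * (A j l)\<^sup>2 + (a i)\<^sup>2 * ((a j)\<^sup>2 * (A j l)\<^sup>2) + (a i)\<^sup>2 * ((a l)\<^sup>2 * (A j l)\<^sup>2)" for i j l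
    using a_signs[of i] by (auto simp: algebra_simps)
  then have 1: "(\<Sum>i\<in>U. \<Sum>j\<in>U. \<Sum>l\<in>U. (a i)\<^sup>2 * (A j l)\<^sup>2 * ((a i)\<^sup>2 + (a j)\<^sup>2 + (a l)\<^sup>2))
      = D * B + D * (D * (D - 1)) + D * (D * (D - 1))"
    by (simp only: sum.distrib B_def sum_distrib_left[symmetric] sum_distrib_right[symmetric] sum_a sum_aA' sum_Aa)
  have "(a i)\<^sup>2 * (A i l)\<^sup>2 * ((a i)\<^sup>2 + (a i)\<^sup>2 + (a l)\<^sup>2) = 2 * ((a i)\<^sup>2 * (A i l)\<^sup>2) + (a i)\<^sup>2 * (a l)\<^sup>2 * (A i l)\<^sup>2" for i l
    using a_signs[of i] by (auto simp: algebra_simps)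
  then have 2: "(\<Sum>i\<in>U. \<Sum>l\<in>U. (a i)\<^sup>2 * (A i l)\<^sup>2 * ((a i)\<^sup>2 + (a i)\<^sup>2 + (a l)\<^sup>2)) = 2 * (D * (D - 1)) + t"
    by (simp only: sum.distrib sum_distrib_left[symmetric] sum_aA' t_def)
  have "(a i)\<^sup>2 * (A j i)\<^sup>2 * ((a i)\<^sup>2 + (a j)\<^sup>2 + (a i)\<^sup>2) = 2 * ((a i)\<^sup>2 * (A i j)\<^sup>2) + (a i)\<^sup>2 * (a j)\<^sup>2 * (A i j)\<^sup>2" for i j
    unfolding sym[of j i] using a_signs[of i] by (auto simp: algebra_simps)
  then have 3: "(\<Sum>i\<in>U. \<Sum>j\<in>U. (a i)\<^sup>2 * (A j i)\<^sup>2 * ((a i)\<^sup>2 + (a j)\<^sup>2 + (a i)\<^sup>2)) = 2 * (D * (D - 1)) + t"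
    by (simp only: sum.distrib sum_distrib_left[symmetric] sum_aA' t_def)
  show ?thesis unfolding sum3_eq[OF finU] 1 2 3 by simp
qed

lemma sum3_P2_weighted:
  "sum3 U (\<lambda>i j l. a i * A i j * A j l * a l * ((a i)\<^sup>2 + (a j)\<^sup>2 + (a l)\<^sup>2)) = 2 * w + wN - 2 * (D * (D - 1)) - t"
proof -
  have "a i * A i j * A j l * a l * ((a i)\<^sup>2 + (a j)\<^sup>2 + (a l)\<^sup>2)
      = 2 * (a i * A i j * A j l * a l) + a i * A i j * A j l * a l * (a j)\<^sup>2" for i j l
    using a_signs[of i] a_signs[of l] by (auto simp: algebra_simps)
  then have 1: "(\<Sum>i\<in>U. \<Sum>j\<in>U. \<Sum>l\<in>U. a i * A i j * A j l * a l * ((a i)\<^sup>2 + (a j)\<^sup>2 + (a l)\<^sup>2)) = 2 * w + wN"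
    by (simp only: sum.distrib sum_distrib_left[symmetric] w_eq wN_eq)
  have "a i * A i j * A j i * a i * ((a i)\<^sup>2 + (a j)\<^sup>2 + (a i)\<^sup>2) = 2 * ((a i)\<^sup>2 * (A i j)\<^sup>2) + (a i)\<^sup>2 * (a j)\<^sup>2 * (A i j)\<^sup>2" for i j
    unfolding sym[of j i] using a_signs[of i] by (auto simp: algebra_simps power2_eq_square)
  then have 2: "(\<Sum>i\<in>U. \<Sum>j\<in>U. a i * A i j * A j i * a i * ((a i)\<^sup>2 + (a j)\<^sup>2 + (a i)\<^sup>2)) = 2 * (D * (D - 1)) + t"
    by (simp only: sum.distrib sum_distrib_left[symmetric] sum_aA' t_def)
  show ?thesis unfolding sum3_eq[OF finU] 1 2 by simp
qed

text \<open>The three pairs of disjoint edges on \<open>{k, i, j, l}\<close> are relabellings of one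
  another, as are the three 4-cycles. Since \<open>s\<close> is symmetric, the division by 6 for
  unordered triples leaves \<open>3 / 6\<close> of the edge pairs and \<open>2 * 3 / 6\<close> of
  the cycles.\<close>

lemma sum_quadruples:
  assumes s: "\<And>i j l. s i j l = s j i l" "\<And>i j l. s i j l = s i l j"
    and S: "\<And>i j l. i \<noteq> j \<Longrightarrow> i \<noteq> l \<Longrightarrow> j \<noteq> l \<Longrightarrow> S {i, j, l} = s i j l"
  shows "(\<Sum>J | J \<subseteq> U \<and> card J = 3. cp (insert k J) * S J)
    = sum3 U (\<lambda>i j l. (a i)\<^sup>2 * (A j l)\<^sup>2 * s i j l) / 2 - sum3 U (\<lambda>i j l. a i * A i j * A j l * a l * s i j l)"
proof -
  define p where "p i j l = (a i)\<^sup>2 * (A j l)\<^sup>2 * s i j l" for i j l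
  define q where "q i j l = a i * A i j * A j l * a l * s i j l" for i j l
  have pt: "cp (insert k {i, j, l}) * S {i, j, l}
      = (p i j l + p j i l + p l i j) + (- 2) * (q i j l + q i l j + q j i l)"
    if "i \<in> U" "j \<in> U" "l \<in> U" "i \<noteq> j" "i \<noteq> l" "j \<noteq> l" for i j l
  proof -
    have "k \<noteq> i" "k \<noteq> j" "k \<noteq> l" using that kU(1) by auto
    then have "cp (insert k {i, j, l}) * S {i, j, l} = ((a i)\<^sup>2 * (A j l)\<^sup>2 + (a j)\<^sup>2 * (A i l)\<^sup>2 + (a l)\<^sup>2 * (A i j)\<^sup>2
      - 2 * (a i * A i j * A j l * a l + a i * A i l * A l j * a j + a j * A j i * A i l * a l)) * s i j l"
      using that by (simp add: cp_4 S a_def)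
    moreover have "s j i l = s i j l" "s l i j = s i j l" "s i l j = s i j l" using s by metis+
    ultimately show ?thesis by (simp add: p_def q_def algebra_simps)
  qed
  have "(\<Sum>J | J \<subseteq> U \<and> card J = 3. cp (insert k J) * S J)
      = sum3 U (\<lambda>i j l. (p i j l + p j i l + p l i j) + (- 2) * (q i j l + q i l j + q j i l)) / 6"
    unfolding sum_card_3'[OF finU] using pt by (intro arg_cong2[where f = "(/)"] sum3_cong refl)
  also have "\<dots> = (sum3 U p + sum3 U (\<lambda>i j l. p j i l) + sum3 U (\<lambda>i j l. p l i j)
      - 2 * (sum3 U q + sum3 U (\<lambda>i j l. q i l j) + sum3 U (\<lambda>i j l. q j i l))) / 6"
    unfolding sum3_add sum3_cmult by simp
  also have "\<dots> = sum3 U p / 2 - sum3 U q"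
    using sum3_swap12[of U p] sum3_swap23[of U "\<lambda>i j l. p j i l"] sum3_swap12[of U q] sum3_swap23[of U q] by simp
  finally show ?thesis by (simp add: p_def[abs_def] q_def[abs_def])
qed

definition S4 :: real where "S4 = (\<Sum>J | J \<subseteq> U \<and> card J = 3. cp (insert k J))"
text \<open>The extra weight counts neighbours of \<open>k\<close> in \<open>J\<close>; it arises
  from pairs \<open>({i}, J)\<close> that overlap.\<close>

definition S4' :: real where "S4' = (\<Sum>J | J \<subseteq> U \<and> card J = 3. cp (insert k J) * (\<Sum>i\<in>J. (a i)\<^sup>2))"

lemma S4_eq: "S4 = D * B / 2 - w"
  using sum_quadruples[of "\<lambda>_ _ _. 1" "\<lambda>_. 1"] by (simp add: S4_def sum3_P1 sum3_P2 diff_divide_distrib)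

lemma S4'_eq: "S4' = D * B / 2 + D * (D * (D - 1)) - 2 * w - wN"
proof -
  have "S4' = (D * B + 2 * (D * (D * (D - 1))) - 4 * (D * (D - 1)) - 2 * t) / 2 - (2 * w + wN - 2 * (D * (D - 1)) - t)"
    unfolding S4'_def sum3_P1_weighted[symmetric] sum3_P2_weighted[symmetric]
    by (rule sum_quadruples) (simp_all add: ac_simps)
  then show ?thesis by (simp add: field_simps)
qed

end

lemma coef_0: "coef Q 0 = Q 0 0" by (simp add: coef_def)
lemma coef_1: "coef Q 1 = Q 0 1 + Q 1 0" by (simp add: coef_def)
lemma coef_2: "coef Q 2 = Q 0 2 + Q 1 1 + Q 2 0" by (simp add: coef_def eval_nat_numeral)
lemma coef_3: "coef Q 3 = Q 0 3 + Q 1 2 + Q 2 1 + Q 3 0" by (simp add: coef_def eval_nat_numeral)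
lemma coef_4: "coef Q 4 = Q 0 4 + Q 1 3 + Q 2 2 + Q 3 1 + Q 4 0" by (simp add: coef_def eval_nat_numeral)

lemma level_0: "finite U \<Longrightarrow> level U g 0 t = (\<Sum>J | J \<subseteq> U \<and> card J = t. g {} J)"
  unfolding level_def by (simp only: subsets_card_0) simp

lemma level_1: "finite U \<Longrightarrow> level U g 1 t = (\<Sum>i\<in>U. \<Sum>J | J \<subseteq> U \<and> card J = t. g {i} J)"
  unfolding level_def by (simp only: sum_card_1)

context signed_regular_vertex
begin

definition gL :: "real \<Rightarrow> nat set \<Rightarrow> nat set \<Rightarrow> real" where
  "gL X I J = cm I * cp J * X ^ card (I \<inter> J)"
text \<open>A minor on \<open>k\<close> and one neighbour equals \<open>-1\<close>; the leading sign
  therefore makes the first coefficient \<open>2 * D\<close> positive.\<close>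

definition gN :: "real \<Rightarrow> nat set \<Rightarrow> nat set \<Rightarrow> real" where
  "gN X I J = - (cm (insert k I) * cp J + cm I * cp (insert k J)) * X ^ card (I \<inter> J)"
definition gE :: "real \<Rightarrow> nat set \<Rightarrow> nat set \<Rightarrow> real" where
  "gE X I J = cm (insert k I) * cp (insert k J) * X ^ card (I \<inter> J)"

lemma cp_cm_insert: "I \<subseteq> U \<Longrightarrow> cp (insert k I) = - ((- 1) ^ card I * cm (insert k I))"
proof -
  assume I: "I \<subseteq> U"
  then have "finite I" "k \<notin> I" using kU(1) finite_subset[OF _ finU] by auto
  then show ?thesis using cp_cm[of "insert k I"] by simp
qed

lemma cp_cm_U: "I \<subseteq> U \<Longrightarrow> cp I = (- 1) ^ card I * cm I"
  using cp_cm finite_subset[OF _ finU] by blast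

lemma gL_swap: "I \<subseteq> U \<Longrightarrow> J \<subseteq> U \<Longrightarrow> gL X J I = (- 1) ^ (card I + card J + 0) * gL X I J"
  by (simp add: gL_def cp_cm_U Int_commute power_add flip: power_mult_distrib)

lemma gE_swap: "I \<subseteq> U \<Longrightarrow> J \<subseteq> U \<Longrightarrow> gE X J I = (- 1) ^ (card I + card J + 0) * gE X I J"
  by (simp add: gE_def cp_cm_insert Int_commute power_add flip: power_mult_distrib)

lemma gN_swap: "I \<subseteq> U \<Longrightarrow> J \<subseteq> U \<Longrightarrow> gN X J I = (- 1) ^ (card I + card J + 1) * gN X I J"
  by (simp add: gN_def cp_cm_insert cp_cm_U Int_commute[of J I] power_add algebra_simps flip: power_mult_distrib)

lemma level_swaps:
  "level U (gL X) q p = (- 1) ^ (p + q + 0) * level U (gL X) p q"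
  "level U (gE X) q p = (- 1) ^ (p + q + 0) * level U (gE X) p q"
  "level U (gN X) q p = (- 1) ^ (p + q + 1) * level U (gN X) p q"
  by (rule level_swap, rule gL_swap gE_swap gN_swap, assumption+)+

lemma coef_L: "coef (level U (gL X)) 0 = 1" "coef (level U (gL X)) 2 = - B"
proof -
  show "coef (level U (gL X)) 0 = 1"
    by (simp add: coef_0 level_0 finU subsets_card_0 gL_def)
  have "(\<Sum>i\<in>U. \<Sum>j\<in>U. if i \<noteq> j then gL X {} {i, j} else 0) = - B"
    unfolding B_def sum_negf[symmetric] by (intro sum.cong refl) (auto simp: cp_2 gL_def)
  then have "level U (gL X) 0 2 = - B / 2"
    unfolding level_0[OF finU] sum_card_2[OF finU] by simp
  moreover have "level U (gL X) 2 0 = level U (gL X) 0 2"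
    using level_swaps(1)[where p = 0 and q = 2 and X = X] by simp
  moreover have "level U (gL X) 1 1 = 0"
    unfolding level_1[OF finU] sum_card_1[OF finU] by (simp add: gL_def)
  ultimately show "coef (level U (gL X)) 2 = - B" by (simp add: coef_2)
qed

lemma sum_pow_singleton:
  assumes "J \<subseteq> U"
  shows "(\<Sum>i\<in>U. (a i)\<^sup>2 * X ^ card (J \<inter> {i})) = D - (1 - X) * (\<Sum>i\<in>J. (a i)\<^sup>2)"
proof -
  have "(\<Sum>i\<in>U. (a i)\<^sup>2 * X ^ card (J \<inter> {i})) = (\<Sum>i\<in>U. (a i)\<^sup>2 - (1 - X) * (if i \<in> J then (a i)\<^sup>2 else 0))"
    by (rule sum.cong) (auto simp: algebra_simps)
  also have "\<dots> = D - (1 - X) * (\<Sum>i\<in>U. if i \<in> J then (a i)\<^sup>2 else 0)"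
    by (simp only: sum_subtractf sum_a sum_distrib_left)
  also have "(\<Sum>i\<in>U. if i \<in> J then (a i)\<^sup>2 else 0) = (\<Sum>i\<in>J. (a i)\<^sup>2)"
    using assms finU by (simp add: sum.If_cases Int_absorb1)
  finally show ?thesis .
qed

lemma ne_k: "i \<in> U \<Longrightarrow> k \<noteq> i" using kU(1) by auto

lemma coef_N: "coef (level U (gN X)) 1 = 2 * D"
  "coef (level U (gN X)) 3 = 2 * (w - D * B + (1 - X) * (D * (D - 1)))"
proof -
  let ?l = "level U (gN X)"
  have "?l 1 0 = (\<Sum>i\<in>U. (a i)\<^sup>2)"
    unfolding level_1[OF finU] subsets_card_0[OF finU]
    by (rule sum.cong) (auto simp: gN_def cm_2 ne_k a_def)
  then have 10: "?l 1 0 = D" by (simp only: sum_a)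
  have "?l 0 1 = ?l 1 0" using level_swaps(3)[where p = 1 and q = 0 and X = X] by simp
  then show "coef ?l 1 = 2 * D" using 10 unfolding coef_1 by simp
  have "cp (insert k I) = cm (insert k I)" if "I \<subseteq> U" "card I = 3" for I
    using cp_cm_insert[OF that(1)] that(2) by simp
  then have "?l 0 3 = (\<Sum>I | I \<subseteq> U \<and> card I = 3. - cp (insert k I))"
    unfolding level_0[OF finU] by (intro sum.cong) (auto simp: gN_def)
  then have 03: "?l 0 3 = - S4" by (simp add: S4_def sum_negf)
  have 30: "?l 3 0 = ?l 0 3" using level_swaps(3)[where p = 0 and q = 3 and X = X] by simp
  have 12: "?l 1 2 = ?l 2 1" using level_swaps(3)[where p = 2 and q = 1 and X = X] by simp
  have "?l 2 1 = (\<Sum>i\<in>U. \<Sum>l\<in>U. if i \<noteq> l then (\<Sum>j\<in>U. gN X {i, l} {j}) else 0) / 2"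
    unfolding level_def sum_card_2[OF finU] sum_card_1[OF finU] ..
  also have "(\<Sum>i\<in>U. \<Sum>l\<in>U. if i \<noteq> l then (\<Sum>j\<in>U. gN X {i, l} {j}) else 0)
    = (\<Sum>i\<in>U. \<Sum>l\<in>U. - (A i l)\<^sup>2 * D + (1 - X) * ((a i)\<^sup>2 * (A i l)\<^sup>2 + (a l)\<^sup>2 * (A i l)\<^sup>2))"
  proof (intro sum.cong refl)
    fix i l assume il: "i \<in> U" "l \<in> U"
    show "(if i \<noteq> l then (\<Sum>j\<in>U. gN X {i, l} {j}) else 0)
      = - (A i l)\<^sup>2 * D + (1 - X) * ((a i)\<^sup>2 * (A i l)\<^sup>2 + (a l)\<^sup>2 * (A i l)\<^sup>2)"
    proof (cases "i = l")
      case False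
      have "(\<Sum>j\<in>U. gN X {i, l} {j}) = (\<Sum>j\<in>U. - (A i l)\<^sup>2 * ((a j)\<^sup>2 * X ^ card ({i, l} \<inter> {j})))"
        by (rule sum.cong) (auto simp: gN_def cm_2 cp_2 False ne_k a_def)
      also have "\<dots> = - (A i l)\<^sup>2 * (D - (1 - X) * ((a i)\<^sup>2 + (a l)\<^sup>2))"
        using sum_pow_singleton[of "{i, l}" X] il False
        by (simp only: sum_distrib_left[symmetric]) simp
      finally show ?thesis using False by (simp add: algebra_simps)
    qed simp
  qed
  also have "\<dots> = - B * D + (1 - X) * (2 * (D * (D - 1)))"
    unfolding B_def sum.distrib sum_distrib_left[symmetric] sum_distrib_right[symmetric] sum_negf sum_aA' sum_Aa by simp
  finally have "?l 2 1 = - (D * B) / 2 + (1 - X) * (D * (D - 1))" by (simp add: field_simps)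
  then show "coef ?l 3 = 2 * (w - D * B + (1 - X) * (D * (D - 1)))"
    unfolding coef_3 12 30 03 S4_eq by (simp add: field_simps)
qed

text \<open>For \<open>i \<noteq> l\<close> and \<open>j \<noteq> m\<close> the bracket is
  \<open>(1 - h) ^ card ({i, l} \<inter> {j, m})\<close>, and \<open>u\<close> vanishes in the other
  cases. Expanding in \<open>h\<close> sorts by common vertices: each of the four single
  coincidences yields the squared row sums, and the two double ones yield the squared
  entries.\<close>

lemma sum_pairs_product:
  fixes u :: "nat \<Rightarrow> nat \<Rightarrow> real"
  assumes u: "\<And>i j. u i j = u j i" "\<And>i. u i i = 0" and W: "finite W"
  shows "(\<Sum>i\<in>W. \<Sum>l\<in>W. \<Sum>j\<in>W. \<Sum>m\<in>W. u i l * u j m *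
      ((1 - h * (of_bool (i = j) + of_bool (i = m))) * (1 - h * (of_bool (l = j) + of_bool (l = m)))))
    = (\<Sum>i\<in>W. \<Sum>l\<in>W. u i l)\<^sup>2 - 4 * h * (\<Sum>i\<in>W. (\<Sum>l\<in>W. u i l)\<^sup>2) + 2 * h\<^sup>2 * (\<Sum>i\<in>W. \<Sum>l\<in>W. (u i l)\<^sup>2)"
proof -
  define T where "T = (\<Sum>i\<in>W. \<Sum>l\<in>W. u i l)"
  define r where "r i = (\<Sum>l\<in>W. u i l)" for i
  have inner: "(\<Sum>j\<in>W. \<Sum>m\<in>W. u i l * u j m *
      ((1 - h * (of_bool (i = j) + of_bool (i = m))) * (1 - h * (of_bool (l = j) + of_bool (l = m)))))
    = u i l * T - 2 * h * (u i l * r i) - 2 * h * (u i l * r l) + 2 * h\<^sup>2 * (u i l)\<^sup>2" if il: "i \<in> W" "l \<in> W" for i l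
  proof (cases "i = l")
    case False
    have row: "(\<Sum>j\<in>W. \<Sum>m\<in>W. u j m * of_bool (x = j)) = r x" "(\<Sum>j\<in>W. \<Sum>m\<in>W. u j m * of_bool (x = m)) = r x"
      if "x \<in> W" for x
    proof -
      show "(\<Sum>j\<in>W. \<Sum>m\<in>W. u j m * of_bool (x = j)) = r x"
        using that W by (simp add: sum_distrib_right[symmetric] r_def[symmetric])
      show "(\<Sum>j\<in>W. \<Sum>m\<in>W. u j m * of_bool (x = m)) = r x"
        using that W u(1) by (simp add: r_def of_bool_def if_distrib cong: if_cong)
    qed
    have cross: "(\<Sum>j\<in>W. \<Sum>m\<in>W. u j m * of_bool (x = j \<and> z = m)) = u x z" if "x \<in> W" "z \<in> W" for x z
    proof -
      have "(\<Sum>m\<in>W. u j m * of_bool (x = j \<and> z = m)) = (if x = j then u x z else 0)" for j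
        using that W by (auto simp: of_bool_def if_distrib cong: if_cong)
      then show ?thesis using that W by simp
    qed
    have "u j m * ((1 - h * (of_bool (i = j) + of_bool (i = m))) * (1 - h * (of_bool (l = j) + of_bool (l = m))))
      = u j m + (- h) * (u j m * of_bool (i = j)) + (- h) * (u j m * of_bool (i = m)) + (- h) * (u j m * of_bool (l = j)) + (- h) * (u j m * of_bool (l = m))
        + h\<^sup>2 * (u j m * of_bool (i = j \<and> l = m)) + h\<^sup>2 * (u j m * of_bool (l = j \<and> i = m))" for j m
      using False u(2) by (auto simp: of_bool_def algebra_simps power2_eq_square)
    then have 1: "(\<Sum>j\<in>W. \<Sum>m\<in>W. u j m *
      ((1 - h * (of_bool (i = j) + of_bool (i = m))) * (1 - h * (of_bool (l = j) + of_bool (l = m)))))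
      = T + (- h) * r i + (- h) * r i + (- h) * r l + (- h) * r l + h\<^sup>2 * u i l + h\<^sup>2 * u l i"
      by (simp only: sum.distrib sum_distrib_left[symmetric] row cross il T_def)
    have 2: "(\<Sum>j\<in>W. \<Sum>m\<in>W. u i l * u j m *
      ((1 - h * (of_bool (i = j) + of_bool (i = m))) * (1 - h * (of_bool (l = j) + of_bool (l = m)))))
      = u i l * (\<Sum>j\<in>W. \<Sum>m\<in>W. u j m *
      ((1 - h * (of_bool (i = j) + of_bool (i = m))) * (1 - h * (of_bool (l = j) + of_bool (l = m)))))"
      by (simp only: mult.assoc sum_distrib_left)
    show ?thesis unfolding 1 2 using u(1)[of l i] by (simp add: algebra_simps power2_eq_square)
  qed (simp add: u)
  have "(\<Sum>i\<in>W. \<Sum>l\<in>W. \<Sum>j\<in>W. \<Sum>m\<in>W. u i l * u j m *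
      ((1 - h * (of_bool (i = j) + of_bool (i = m))) * (1 - h * (of_bool (l = j) + of_bool (l = m)))))
    = (\<Sum>i\<in>W. \<Sum>l\<in>W. T * u i l - 2 * h * (r i * u i l) - 2 * h * (r l * u i l) + 2 * h\<^sup>2 * (u i l)\<^sup>2)"
    by (intro sum.cong refl) (simp only: inner mult.commute)
  also have "\<dots> = T * T - 2 * h * (\<Sum>i\<in>W. r i * r i) - 2 * h * (\<Sum>i\<in>W. \<Sum>l\<in>W. r l * u i l) + 2 * h\<^sup>2 * (\<Sum>i\<in>W. \<Sum>l\<in>W. (u i l)\<^sup>2)"
    by (simp only: sum.distrib sum_subtractf sum_distrib_left[symmetric]) (simp only: T_def r_def)
  also have "(\<Sum>i\<in>W. \<Sum>l\<in>W. r l * u i l) = (\<Sum>l\<in>W. r l * r l)"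
    by (subst sum.swap) (simp add: sum_distrib_left[symmetric] r_def u(1))
  finally show ?thesis unfolding T_def r_def power2_eq_square by simp
qed

lemma coef_E: "coef (level U (gE X)) 0 = 0" "coef (level U (gE X)) 2 = D * (D - (1 - X))"
  "coef (level U (gE X)) 4 = - 2 * D * S4 + 2 * (1 - X) * S4' - \<tau>\<^sup>2 + 4 * (1 - X) * wN - 2 * (1 - X)\<^sup>2 * t"
proof -
  let ?l = "level U (gE X)"
  have z0: "?l 0 s = 0" for s unfolding level_0[OF finU] by (simp add: gE_def)
  have z1: "?l s 0 = 0" for s using level_swaps(2)[where p = 0 and q = s and X = X] z0 by simp
  show "coef ?l 0 = 0" by (simp add: coef_0 z0)
  have "?l 1 1 = (\<Sum>i\<in>U. (a i)\<^sup>2 * (\<Sum>j\<in>U. (a j)\<^sup>2 * X ^ card ({i} \<inter> {j})))"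
    unfolding level_1[OF finU] sum_card_1[OF finU] sum_distrib_left
    by (intro sum.cong refl) (simp add: gE_def cm_2 cp_2 ne_k a_def)
  also have "\<dots> = (\<Sum>i\<in>U. (a i)\<^sup>2 * (D - (1 - X) * (a i)\<^sup>2))"
    by (intro sum.cong refl, subst sum_pow_singleton) auto
  also have "\<dots> = (\<Sum>i\<in>U. (a i)\<^sup>2 * (D - (1 - X)))"
  proof (rule sum.cong[OF refl])
    fix i show "(a i)\<^sup>2 * (D - (1 - X) * (a i)\<^sup>2) = (a i)\<^sup>2 * (D - (1 - X))" using a_signs[of i] by auto
  qed
  finally have 11: "?l 1 1 = D * (D - (1 - X))" by (simp only: sum_distrib_right[symmetric] sum_a)
  then show "coef ?l 2 = D * (D - (1 - X))" by (simp add: coef_2 z0 z1)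
  have "?l 1 3 = (\<Sum>J | J \<subseteq> U \<and> card J = 3. \<Sum>i\<in>U. gE X {i} J)"
    unfolding level_1[OF finU] by (rule sum.swap)
  also have "\<dots> = (\<Sum>J | J \<subseteq> U \<and> card J = 3. - cp (insert k J) * (\<Sum>i\<in>U. (a i)\<^sup>2 * X ^ card (J \<inter> {i})))"
    unfolding sum_distrib_left by (intro sum.cong refl) (simp add: gE_def cm_2 ne_k a_def Int_commute)
  also have "\<dots> = (\<Sum>J | J \<subseteq> U \<and> card J = 3. - D * cp (insert k J) + (1 - X) * (cp (insert k J) * (\<Sum>i\<in>J. (a i)\<^sup>2)))"
    by (intro sum.cong refl, subst sum_pow_singleton) (auto simp: algebra_simps)
  finally have 13: "?l 1 3 = - D * S4 + (1 - X) * S4'"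
    by (simp only: sum.distrib sum_distrib_left[symmetric] S4_def S4'_def)
  have 31: "?l 3 1 = ?l 1 3" using level_swaps(2)[where p = 1 and q = 3 and X = X] by simp
  define u where "u i l = a i * A i l * a l" for i l
  have u: "u i l = u l i" "u i i = 0" for i l using sym[of i l] by (simp_all add: u_def)
  have "?l 2 2 = (\<Sum>i\<in>U. \<Sum>l\<in>U. if i \<noteq> l then (\<Sum>j\<in>U. \<Sum>m\<in>U. if j \<noteq> m then gE X {i, l} {j, m} else 0) / 2 else 0) / 2"
    unfolding level_def sum_card_2[OF finU] ..
  also have "\<dots> = (\<Sum>i\<in>U. \<Sum>l\<in>U. - 2 * (\<Sum>j\<in>U. \<Sum>m\<in>U. u i l * u j m *
      ((1 - (1 - X) * (of_bool (i = j) + of_bool (i = m))) * (1 - (1 - X) * (of_bool (l = j) + of_bool (l = m)))))) / 2"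
  proof (intro arg_cong2[where f = "(/)"] sum.cong refl)
    fix i l assume il: "i \<in> U" "l \<in> U"
    show "(if i \<noteq> l then (\<Sum>j\<in>U. \<Sum>m\<in>U. if j \<noteq> m then gE X {i, l} {j, m} else 0) / 2 else 0)
      = - 2 * (\<Sum>j\<in>U. \<Sum>m\<in>U. u i l * u j m *
      ((1 - (1 - X) * (of_bool (i = j) + of_bool (i = m))) * (1 - (1 - X) * (of_bool (l = j) + of_bool (l = m)))))"
    proof (cases "i = l")
      case False
      have "(\<Sum>j\<in>U. \<Sum>m\<in>U. if j \<noteq> m then gE X {i, l} {j, m} else 0)
        = (\<Sum>j\<in>U. \<Sum>m\<in>U. - 4 * (u i l * u j m *
      ((1 - (1 - X) * (of_bool (i = j) + of_bool (i = m))) * (1 - (1 - X) * (of_bool (l = j) + of_bool (l = m))))))"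
      proof (intro sum.cong refl)
        fix j m assume jm: "j \<in> U" "m \<in> U"
        show "(if j \<noteq> m then gE X {i, l} {j, m} else 0) = - 4 * (u i l * u j m *
      ((1 - (1 - X) * (of_bool (i = j) + of_bool (i = m))) * (1 - (1 - X) * (of_bool (l = j) + of_bool (l = m)))))"
        proof (cases "j = m")
          case jm': False
          have "X ^ card ({i, l} \<inter> {j, m})
            = (1 - (1 - X) * (of_bool (i = j) + of_bool (i = m))) * (1 - (1 - X) * (of_bool (l = j) + of_bool (l = m)))"
            using False jm' by (auto simp: power2_eq_square)
          moreover have "cm (insert k {i, l}) = - 2 * u i l" "cp (insert k {j, m}) = 2 * u j m"
            using cm_3[of k i l] cp_3[of k j m] ne_k il jm False jm' by (simp_all add: u_def a_def)
          ultimately show ?thesis using jm' by (simp add: gE_def)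
        qed (simp add: u)
      qed
      then show ?thesis using False by (simp only: sum_distrib_left[symmetric]) simp
    qed (simp add: u)
  qed
  also have "\<dots> = - (\<Sum>i\<in>U. \<Sum>l\<in>U. (\<Sum>j\<in>U. \<Sum>m\<in>U. u i l * u j m *
      ((1 - (1 - X) * (of_bool (i = j) + of_bool (i = m))) * (1 - (1 - X) * (of_bool (l = j) + of_bool (l = m))))))"
    by (simp only: sum_distrib_left[symmetric])
  also have "\<dots> = - ((\<Sum>i\<in>U. \<Sum>l\<in>U. u i l)\<^sup>2 - 4 * (1 - X) * (\<Sum>i\<in>U. (\<Sum>l\<in>U. u i l)\<^sup>2)
      + 2 * (1 - X)\<^sup>2 * (\<Sum>i\<in>U. \<Sum>l\<in>U. (u i l)\<^sup>2))"
    unfolding sum_pairs_product[OF u finU] ..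
  also have "\<dots> = - ((\<Sum>i\<in>U. a i * Aa i)\<^sup>2 - 4 * (1 - X) * (\<Sum>i\<in>U. (a i * Aa i)\<^sup>2)
      + 2 * (1 - X)\<^sup>2 * (\<Sum>i\<in>U. \<Sum>l\<in>U. (u i l)\<^sup>2))"
    by (simp only: u_def Aa_def sum_distrib_left mult.assoc)
  finally have 22: "?l 2 2 = - (\<tau>\<^sup>2 - 4 * (1 - X) * wN + 2 * (1 - X)\<^sup>2 * t)"
    by (simp add: \<tau>_def wN_def t_def u_def power_mult_distrib mult_ac)
  show "coef ?l 4 = - 2 * D * S4 + 2 * (1 - X) * S4' - \<tau>\<^sup>2 + 4 * (1 - X) * wN - 2 * (1 - X)\<^sup>2 * t"
    unfolding coef_4 z0 z1 31 13 22 by (simp add: algebra_simps)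
qed

end

text \<open>The same sum as a formal polynomial, from which finiteness of the zero set and
  holomorphy are read off.\<close>

definition pair_poly_rep :: "(nat set \<Rightarrow> real) \<Rightarrow> (nat set \<Rightarrow> real) \<Rightarrow> nat set \<Rightarrow> real \<Rightarrow> 'a :: real_field poly" where
  "pair_poly_rep f g U X = (\<Sum>I\<in>Pow U. \<Sum>J\<in>Pow U. [:of_real (f I * g J):] *
     (\<Prod>i\<in>U. pair_wt (\<lambda>_. [:0, 0, 1:]) (\<lambda>_. [:0, 1:]) (\<lambda>_. [:0, 1:]) (\<lambda>_. [:of_real X:]) I J i))"

lemma poly_pair_poly_rep: "poly (pair_poly_rep f g U X) y = pair_poly f g U X y"
proof -
  have "poly (pair_wt (\<lambda>_. [:0, 0, 1:]) (\<lambda>_. [:0, 1:]) (\<lambda>_. [:0, 1:]) (\<lambda>_. [:of_real X:]) I J i) y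
    = pair_wt (\<lambda>_. y\<^sup>2) (\<lambda>_. y) (\<lambda>_. y) (\<lambda>_. of_real X) I J i" for I J i
    by (simp add: pair_wt_def power2_eq_square)
  then show ?thesis by (simp add: pair_poly_rep_def pair_poly_def pair_sum_def poly_sum poly_prod)
qed

lemma pair_poly_holomorphic: "pair_poly f g U X holomorphic_on S"
proof -
  have "poly (pair_poly_rep f g U X) holomorphic_on S" by (intro holomorphic_intros)
  then show ?thesis by (simp add: poly_pair_poly_rep[abs_def])
qed

section \<open>Limits and signs on the real axis\<close>

lemma expansion_real_limit:
  fixes P R :: "complex \<Rightarrow> complex" and p :: "real \<Rightarrow> real"
  assumes P: "\<And>z. z \<noteq> 0 \<Longrightarrow> P z = z ^ m * ((1 / z) ^ s * (of_real e + of_real e' * (1 / z)\<^sup>2 + (1 / z) ^ 4 * R (1 / z)))"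
    and R: "continuous_on UNIV R" and p: "\<And>x. P (of_real x) = of_real (p x)"
  shows "((\<lambda>x. p x * x ^ s / x ^ m) \<longlongrightarrow> e) at_top"
proof -
  define T where "T u = of_real e + of_real e' * u\<^sup>2 + u ^ 4 * R u" for u
  have "isCont R 0" using R by (simp add: continuous_on_eq_continuous_at)
  then have "isCont T 0" unfolding T_def by (intro continuous_intros)
  then have "(T \<longlongrightarrow> T 0) (nhds 0)" using isCont_def tendsto_at_iff_tendsto_nhds by blast
  moreover have "((\<lambda>x. of_real (1 / x)) \<longlongrightarrow> (0::complex)) at_top"
    using tendsto_of_real[OF tendsto_inverse_0_at_top[OF filterlim_ident], where 'a = complex] by (simp add: inverse_eq_divide)
  ultimately have "((\<lambda>x. T (of_real (1 / x))) \<longlongrightarrow> T 0) at_top" by (rule filterlim_compose)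
  then have "((\<lambda>x. Re (T (of_real (1 / x)))) \<longlongrightarrow> Re (T 0)) at_top" by (rule tendsto_Re)
  moreover have "\<forall>\<^sub>F x in at_top. p x * x ^ s / x ^ m = Re (T (of_real (1 / x)))"
    using eventually_gt_at_top[of 0]
  proof eventually_elim
    case (elim x)
    have "of_real (p x) = of_real (x ^ m * (1 / x) ^ s) * T (of_real (1 / x))"
      using P[of "of_real x"] elim by (simp add: p T_def)
    then have "p x = x ^ m * (1 / x) ^ s * Re (T (of_real (1 / x)))"
      by (metis Re_complex_of_real times_complex.simps(1) Im_complex_of_real mult_zero_left diff_zero)
    then show ?case using elim by (simp add: field_simps)
  qed
  ultimately show ?thesis using tendsto_cong by (force simp: T_def)
qed

lemma limit_eventually_pos:
  fixes p :: "real \<Rightarrow> real"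
  assumes "((\<lambda>x. p x * x ^ s / x ^ m) \<longlongrightarrow> e) at_top" "e > 0"
  shows "\<forall>\<^sub>F x in at_top. p x > 0"
  using order_tendstoD(1)[OF assms] eventually_gt_at_top[of 0]
proof eventually_elim
  case (elim x)
  then have "x ^ s / x ^ m > 0" by simp
  moreover have "p x * (x ^ s / x ^ m) > 0" using elim by simp
  ultimately show ?case by (meson zero_less_mult_pos2)
qed

lemma finite_zeros:
  fixes p :: "real \<Rightarrow> real"
  assumes "\<forall>\<^sub>F x in at_top. p x > 0" and q: "\<And>x. p x = poly q x"
  shows "finite {x. p x = 0}"
proof -
  obtain x where "p x > 0" using assms(1) eventually_happens trivial_limit_at_top_linorder by blast
  then have "q \<noteq> 0" using q by auto
  then show ?thesis unfolding q by (rule poly_roots_finite)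
qed

lemma ratio_limit_0:
  fixes p q :: "real \<Rightarrow> real"
  assumes p: "((\<lambda>x. p x * x ^ Suc s / x ^ m) \<longlongrightarrow> e) at_top" and q: "((\<lambda>x. q x * x ^ s / x ^ m) \<longlongrightarrow> n) at_top"
    and n: "n \<noteq> 0"
  shows "((\<lambda>x. p x / q x) \<longlongrightarrow> 0) at_top"
proof -
  have "((\<lambda>x. (p x * x ^ Suc s / x ^ m) / (q x * x ^ s / x ^ m) * inverse x) \<longlongrightarrow> e / n * 0) at_top"
    by (intro tendsto_mult tendsto_divide p q n tendsto_inverse_0_at_top filterlim_ident)
  moreover have "\<forall>\<^sub>F x in at_top. (p x * x ^ Suc s / x ^ m) / (q x * x ^ s / x ^ m) * inverse x = p x / q x"
    using eventually_gt_at_top[of 0] by eventually_elim (simp add: field_simps)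
  ultimately show ?thesis using tendsto_cong by force
qed

context
  fixes P Q :: "complex \<Rightarrow> complex" and p q :: "real \<Rightarrow> real" and a :: real
  assumes hol: "P holomorphic_on UNIV" "Q holomorphic_on UNIV"
    and re: "\<And>x. P (of_real x) = of_real (p x)" "\<And>x. Q (of_real x) = of_real (q x)"
begin

lemma ratio_antimono:
  assumes im: "\<And>z. Im z > 0 \<Longrightarrow> Im (P z / Q z) \<le> 0" and q: "\<And>x. x > a \<Longrightarrow> q x > 0" and xy: "a < x" "x \<le> y"
  shows "p y / q y \<le> p x / q x"
proof -
  have d: "P field_differentiable at z" "Q field_differentiable at z" for z
    using hol holomorphic_on_imp_differentiable_at open_UNIV by blast+
  have "Re (P (of_real y) / Q (of_real y)) \<le> Re (P (of_real x) / Q (of_real x))"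
  proof (rule nonincreasing_on_reals[of a "\<lambda>z. P z / Q z"])
    show "(\<lambda>z. P z / Q z) field_differentiable at (complex_of_real t)" if "t > a" for t
      using q[OF that] by (intro field_differentiable_divide d) (simp add: re)
    show "Im (P (of_real t) / Q (of_real t)) = 0" for t by (simp add: re Im_divide)
  qed (use im xy in auto)
  then show ?thesis by (simp add: re flip: of_real_divide)
qed

text \<open>A ratio decreasing to 0 is nonnegative. If \<open>p\<close> were nonpositive at
  \<open>x\<close>, the ratio would be squeezed to 0 from \<open>x\<close> on, and \<open>p\<close>
  would have infinitely many zeros.\<close>

lemma pos_of_decreasing_ratio:
  assumes im: "\<And>z. Im z > 0 \<Longrightarrow> Im (P z / Q z) \<le> 0" and q: "\<And>x. x > a \<Longrightarrow> q x > 0"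
    and lim: "((\<lambda>x. p x / q x) \<longlongrightarrow> 0) at_top" and fin: "finite {x. p x = 0}" and x: "x > a"
  shows "p x > 0"
proof (rule ccontr)
  assume neg: "\<not> p x > 0"
  have mono: "p y / q y \<le> p x / q x" if "a < x" "x \<le> y" for x y by (rule ratio_antimono[OF im q that])
  have "p y = 0" if y: "y \<ge> x" for y
  proof -
    have "p y / q y \<ge> 0" using nonneg_if_nonincreasing[of a "\<lambda>x. p x / q x", OF mono lim, of y] x y by simp
    moreover have "p y / q y \<le> p x / q x" using mono x y by simp
    moreover have "p x / q x \<le> 0" using neg q[OF x] by (simp add: divide_nonpos_pos)
    moreover have "q y > 0" using q x y by simp
    ultimately show ?thesis by (metis order_antisym order_trans divide_eq_0_iff less_irrefl)
  qed
  then have "{x..} \<subseteq> {x. p x = 0}" by auto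
  then show False using fin infinite_Ici finite_subset by blast
qed

end

text \<open>Transfers positivity from numerator to denominator: the sign of the imaginary part makes
  \<open>p / q\<close> increasing wherever \<open>q\<close> is positive, which forbids a zero of
  \<open>q\<close> to the right of \<open>a\<close>.\<close>

lemma interlacing_sign:
  fixes P Q :: "complex \<Rightarrow> complex" and p q :: "real \<Rightarrow> real"
  assumes hol: "P holomorphic_on UNIV" "Q holomorphic_on UNIV"
    and re: "\<And>x. P (of_real x) = of_real (p x)" "\<And>x. Q (of_real x) = of_real (q x)"
    and im: "\<And>z. Im z > 0 \<Longrightarrow> Im (P z / Q z) \<ge> 0"
    and p: "\<And>x. x > a \<Longrightarrow> p x > 0" and ev: "\<forall>\<^sub>F x in at_top. q x > 0" and fin: "finite {x. q x = 0}" and x: "x > a"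
  shows "q x > 0"
proof (rule interlacing_pos[OF _ _ p ev fin _ x])
  have c: "continuous_on UNIV (\<lambda>x. Re (F (of_real x)))" if "F holomorphic_on UNIV" for F
    using holomorphic_on_imp_continuous_on[OF that]
    by (intro continuous_intros continuous_on_compose2[of UNIV F UNIV of_real]) auto
  show "continuous_on UNIV p" "continuous_on UNIV q" using c[OF hol(1)] c[OF hol(2)] by (simp_all add: re)
  fix b x y assume b: "b \<ge> a" "\<And>t. t > b \<Longrightarrow> q t > 0" "b < x" "x \<le> y"
  have "(\<lambda>z. - P z) holomorphic_on UNIV" by (intro holomorphic_intros hol)
  from ratio_antimono[OF this hol(2), of "\<lambda>x. - p x" q b x y] show "p x / q x \<le> p y / q y"
    using b im by (simp add: re)
qed

section \<open>Bounds at a vertex\<close>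

lemma sum_lessThan_6: "(\<Sum>r<6. f r) = f 0 + f 1 + f 2 + f 3 + f 4 + f (5 :: nat)"
  for f :: "nat \<Rightarrow> 'a :: comm_monoid_add"
  by (simp add: eval_nat_numeral add.assoc)

lemma sum_lessThan_6_even:
  fixes u R :: complex
  shows "(\<Sum>r<6. of_real (if odd (r + 0) then 0 else c r) * u ^ r) + u ^ 6 * R
    = of_real (c 0) + of_real (c 2) * u\<^sup>2 + u ^ 4 * (of_real (c 4) + u\<^sup>2 * R)"
  by (simp add: sum_lessThan_6) (simp add: algebra_simps eval_nat_numeral)

lemma sum_lessThan_6_odd:
  fixes u R :: complex
  shows "(\<Sum>r<6. of_real (if odd (r + 1) then 0 else c r) * u ^ r) + u ^ 6 * R
    = u * (of_real (c 1) + of_real (c 3) * u\<^sup>2 + u ^ 4 * (of_real (c 5) + u * R))"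
  by (simp add: sum_lessThan_6) (simp add: algebra_simps eval_nat_numeral)

context signed_regular_vertex
begin

text \<open>
  \<open>LL\<close>, \<open>NN\<close> and \<open>EE\<close> collect the pairs of sets with \<open>k\<close> in none, in exactly one (up to sign), and in
  both of them.
\<close>

definition LL :: "real \<Rightarrow> 'a \<Rightarrow> 'a :: real_field" where "LL X = pair_poly cm cp U X"
definition NN :: "real \<Rightarrow> 'a \<Rightarrow> 'a :: real_field" where
  "NN X y = - (pair_poly (\<lambda>I. cm (insert k I)) cp U X y + pair_poly cm (\<lambda>J. cp (insert k J)) U X y)"
definition EE :: "real \<Rightarrow> 'a \<Rightarrow> 'a :: real_field" where
  "EE X = pair_poly (\<lambda>I. cm (insert k I)) (\<lambda>J. cp (insert k J)) U X"

lemma pair_poly_V: "pair_poly cm cp V X y = y\<^sup>2 * LL X y - y * NN X y + of_real X * EE X y"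
  using pair_poly_insert[OF finU kU(1), of cm cp X y] by (simp add: kU(2)[symmetric] LL_def NN_def EE_def algebra_simps)

lemma LNE_of_real:
  "LL X (of_real y) = of_real (LL X y)" "NN X (of_real y) = of_real (NN X y)" "EE X (of_real y) = of_real (EE X y)"
  by (simp_all add: LL_def NN_def EE_def pair_poly_of_real)

lemma LNE_holomorphic: "LL X holomorphic_on UNIV" "NN X holomorphic_on UNIV" "EE X holomorphic_on UNIV"
  unfolding LL_def NN_def[abs_def] EE_def by (intro holomorphic_intros pair_poly_holomorphic)+

lemma LNE_poly:
  obtains l n e where "\<And>y::real. LL X y = poly l y" "\<And>y::real. NN X y = poly n y" "\<And>y::real. EE X y = poly e y"
proof
  show "LL X y = poly (pair_poly_rep cm cp U X) y" for y :: real by (simp add: poly_pair_poly_rep LL_def)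
  show "EE X y = poly (pair_poly_rep (\<lambda>I. cm (insert k I)) (\<lambda>J. cp (insert k J)) U X) y" for y :: real
    by (simp add: poly_pair_poly_rep EE_def)
  show "NN X y = poly (- (pair_poly_rep (\<lambda>I. cm (insert k I)) cp U X + pair_poly_rep cm (\<lambda>J. cp (insert k J)) U X)) y" for y :: real
    by (simp add: poly_pair_poly_rep NN_def)
qed

definition N3 :: "real \<Rightarrow> real" where "N3 X = 2 * (w - D * B + (1 - X) * (D * (D - 1)))"
definition E2 :: "real \<Rightarrow> real" where "E2 X = D * (D - (1 - X))"
definition E4 :: "real \<Rightarrow> real" where
  "E4 X = - 2 * D * S4 + 2 * (1 - X) * S4' - \<tau>\<^sup>2 + 4 * (1 - X) * wN - 2 * (1 - X)\<^sup>2 * t"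

lemma LL_expand:
  obtains R :: "complex \<Rightarrow> complex" where "continuous_on UNIV R"
    "\<And>z. z \<noteq> 0 \<Longrightarrow> LL X z = z ^ (2 * card U) * ((1 / z) ^ 0 * (of_real 1 + of_real (- B) * (1 / z)\<^sup>2 + (1 / z) ^ 4 * R (1 / z)))"
proof (rule level_expansion[OF finU gL_swap])
  fix R :: "complex \<Rightarrow> complex"
  assume R: "continuous_on UNIV R" "\<And>u. (\<Sum>I\<in>Pow U. \<Sum>J\<in>Pow U. complex_of_real (gL X I J) * u ^ (card I + card J))
      = (\<Sum>r<6. of_real (if odd (r + 0) then 0 else coef (level U (gL X)) r) * u ^ r) + u ^ 6 * R u"
  define R' where "R' u = of_real (coef (level U (gL X)) 4) + u\<^sup>2 * R u" for u
  show ?thesis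
  proof (rule that)
    show "continuous_on UNIV R'" unfolding R'_def by (intro continuous_intros R)
    show "LL X z = z ^ (2 * card U) * ((1 / z) ^ 0 * (of_real 1 + of_real (- B) * (1 / z)\<^sup>2 + (1 / z) ^ 4 * R' (1 / z)))"
      if "z \<noteq> 0" for z
      unfolding LL_def pair_poly_expand[OF finU that] gL_def[symmetric] R(2) sum_lessThan_6_even R'_def coef_L by simp
  qed
qed

lemma EE_expand:
  obtains R :: "complex \<Rightarrow> complex" where "continuous_on UNIV R"
    "\<And>z. z \<noteq> 0 \<Longrightarrow> EE X z = z ^ (2 * card U) * ((1 / z) ^ Suc 1 * (of_real (E2 X) + of_real (E4 X) * (1 / z)\<^sup>2 + (1 / z) ^ 4 * R (1 / z)))"
proof (rule level_expansion[OF finU gE_swap])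
  fix R :: "complex \<Rightarrow> complex"
  assume R: "continuous_on UNIV R" "\<And>u. (\<Sum>I\<in>Pow U. \<Sum>J\<in>Pow U. complex_of_real (gE X I J) * u ^ (card I + card J))
      = (\<Sum>r<6. of_real (if odd (r + 0) then 0 else coef (level U (gE X)) r) * u ^ r) + u ^ 6 * R u"
  define R' where "R' u = R u" for u
  show ?thesis
  proof (rule that)
    show "continuous_on UNIV R'" unfolding R'_def by (rule R(1))
    show "EE X z = z ^ (2 * card U) * ((1 / z) ^ Suc 1 * (of_real (E2 X) + of_real (E4 X) * (1 / z)\<^sup>2 + (1 / z) ^ 4 * R' (1 / z)))"
      if "z \<noteq> 0" for z
      unfolding EE_def pair_poly_expand[OF finU that] gE_def[symmetric] R(2) sum_lessThan_6_even coef_E(3) E4_def[symmetric] R'_def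
      unfolding coef_E(1,2) E2_def[symmetric] by (simp add: distrib_left power2_eq_square eval_nat_numeral mult_ac)
  qed
qed

lemma NN_expand:
  obtains R :: "complex \<Rightarrow> complex" where "continuous_on UNIV R"
    "\<And>z. z \<noteq> 0 \<Longrightarrow> NN X z = z ^ (2 * card U) * ((1 / z) ^ Suc 0 * (of_real (2 * D) + of_real (N3 X) * (1 / z)\<^sup>2 + (1 / z) ^ 4 * R (1 / z)))"
proof (rule level_expansion[OF finU gN_swap])
  fix R :: "complex \<Rightarrow> complex"
  assume R: "continuous_on UNIV R" "\<And>u. (\<Sum>I\<in>Pow U. \<Sum>J\<in>Pow U. complex_of_real (gN X I J) * u ^ (card I + card J))
      = (\<Sum>r<6. of_real (if odd (r + 1) then 0 else coef (level U (gN X)) r) * u ^ r) + u ^ 6 * R u"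
  define R' where "R' u = of_real (coef (level U (gN X)) 5) + u * R u" for u
  show ?thesis
  proof (rule that)
    show "continuous_on UNIV R'" unfolding R'_def by (intro continuous_intros R)
    fix z :: complex assume z: "z \<noteq> 0"
    have "NN X z = z ^ (2 * card U) * (\<Sum>I\<in>Pow U. \<Sum>J\<in>Pow U. complex_of_real (gN X I J) * (1 / z) ^ (card I + card J))"
      unfolding NN_def pair_poly_expand[OF finU z] distrib_left[symmetric] sum.distrib[symmetric] mult_minus_right[symmetric] sum_negf[symmetric]
      by (intro arg_cong2[where f = "(*)"] sum.cong refl) (simp add: gN_def algebra_simps)
    then show "NN X z = z ^ (2 * card U) * ((1 / z) ^ Suc 0 * (of_real (2 * D) + of_real (N3 X) * (1 / z)\<^sup>2 + (1 / z) ^ 4 * R' (1 / z)))"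
      unfolding R(2) sum_lessThan_6_odd R'_def coef_N N3_def[symmetric] by simp
  qed
qed

context
  fixes X :: real
  assumes X: "0 < X" "X \<le> 1" and D: "D > 0"
begin

lemma subset_poly_mdet:
  assumes "finite S"
  shows "subset_poly cm S x = mdet S (\<lambda>i j. (if i = j then x i else 0) + complex_of_real (- A i j))"
    and "subset_poly cp S x = mdet S (\<lambda>i j. (if i = j then x i else 0) + complex_of_real (A i j))"
proof -
  have "subset_poly c S x = mdet S (\<lambda>i j. (if i = j then x i else 0) + complex_of_real (M i j))"
    if "\<And>I. c I = mdet I M" for c M
    unfolding mdet_diag_expand[OF assms] subset_poly_def that mdet_of_real ..
  from this[of cm "\<lambda>i j. - A i j"] this[of cp A]
  show "subset_poly cm S x = mdet S (\<lambda>i j. (if i = j then x i else 0) + complex_of_real (- A i j))"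
    "subset_poly cp S x = mdet S (\<lambda>i j. (if i = j then x i else 0) + complex_of_real (A i j))"
    by (simp_all add: cm_def cp_def)
qed

text \<open>In the last two claims the variable at \<open>k\<close> may be real, even 0. A neighbour
  of \<open>k\<close>, which exists since \<open>D > 0\<close>, then keeps column \<open>k\<close>
  of the matrix from vanishing.\<close>

lemma subset_poly_nonzero:
  assumes x: "\<And>i. i \<in> U \<Longrightarrow> Im (x i) > 0"
  shows "subset_poly cm U x \<noteq> 0" "subset_poly cp U x \<noteq> 0"
    "Im (x k) \<ge> 0 \<Longrightarrow> subset_poly cm V x \<noteq> 0" "Im (x k) \<ge> 0 \<Longrightarrow> subset_poly cp V x \<noteq> 0"
proof -
  have "mdet U (\<lambda>i j. (if i = j then x i else 0) + complex_of_real (M i j)) \<noteq> 0"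
    if "\<And>i j. M i j = M j i" "M k k = 0" for M
  proof -
    have "mdet U (\<lambda>i j. (if i = j then (x(k := \<i>)) i else 0) + complex_of_real (M i j)) \<noteq> 0"
      by (rule mdet_stable[where k = k]) (use x finU that in auto)
    moreover have "mdet U (\<lambda>i j. (if i = j then (x(k := \<i>)) i else 0) + complex_of_real (M i j))
      = mdet U (\<lambda>i j. (if i = j then x i else 0) + complex_of_real (M i j))"
      using kU(1) by (intro mdet_cong) auto
    ultimately show ?thesis by simp
  qed
  from this[of A] this[of "\<lambda>i j. - A i j"]
  show "subset_poly cm U x \<noteq> 0" "subset_poly cp U x \<noteq> 0"
    unfolding subset_poly_mdet[OF finU] using sym by auto
  obtain j where j: "j \<in> U" "A k j \<noteq> 0"
  proof -
    have "\<exists>j\<in>U. (a j)\<^sup>2 \<noteq> 0" using sum_a D sum.neutral[of U "\<lambda>j. (a j)\<^sup>2"] by fastforce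
    then show ?thesis using that by (auto simp: a_def)
  qed
  then have j': "j \<in> V" "j \<noteq> k" "A j k \<noteq> 0" using kU(1) sym[of j k] by (auto simp: U_def)
  assume xk: "Im (x k) \<ge> 0"
  show "subset_poly cm V x \<noteq> 0" unfolding subset_poly_mdet[OF finV]
  proof (rule mdet_stable[OF finV, where k = k])
    show "Im (x i) > 0" if "i \<in> V" "i \<noteq> k" for i using x that by (simp add: U_def)
  qed (use sym j' xk in auto)
  show "subset_poly cp V x \<noteq> 0" unfolding subset_poly_mdet[OF finV]
  proof (rule mdet_stable[OF finV, where k = k])
    show "Im (x i) > 0" if "i \<in> V" "i \<noteq> k" for i using x that by (simp add: U_def)
  qed (use sym j' xk in auto)
qed

lemma LL_nonzero: "Im z > 0 \<Longrightarrow> LL X z \<noteq> (0::complex)"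
proof -
  assume z: "Im z > 0"
  have "pair_sum cm cp U (\<lambda>i. if i \<in> U then z\<^sup>2 else z * z) (\<lambda>i. if i \<in> U then z else z)
    (\<lambda>i. if i \<in> U then z else z) (\<lambda>i. if i \<in> U then of_real X else 1) \<noteq> 0"
  proof (rule pair_sum_stable[OF finU X subset_refl, of "\<lambda>_. {z. Im z > 0}" cm cp "\<lambda>_. z" "\<lambda>_. z" "\<lambda>_. z"])
    show "pair_sum cm cp U (\<lambda>i. x i * y i) y x (\<lambda>_. 1) \<noteq> 0"
      if "\<And>i. i \<in> U \<Longrightarrow> x i \<in> {z. Im z > 0} \<and> y i \<in> {z. Im z > 0}" for x y
      unfolding pair_sum_product[OF finU] using subset_poly_nonzero(1,2) that by auto
  qed (use z in auto)
  moreover have "pair_sum cm cp U (\<lambda>i. if i \<in> U then z\<^sup>2 else z * z) (\<lambda>i. if i \<in> U then z else z)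
    (\<lambda>i. if i \<in> U then z else z) (\<lambda>i. if i \<in> U then of_real X else 1) = LL X z"
    unfolding LL_def pair_poly_def by (rule pair_sum_cong) auto
  ultimately show ?thesis by simp
qed

text \<open>All vertices except \<open>k\<close> are contracted, and both variables of
  \<open>k\<close> get the common value \<open>s\<close>. Admitting real \<open>s\<close> puts the
  roots in \<open>s\<close> strictly below the real axis.\<close>

lemma LNE_stable:
  assumes z: "Im z > 0" and s: "Im s \<ge> 0"
  shows "s\<^sup>2 * LL X z - s * NN X z + EE X z \<noteq> (0::complex)"
proof -
  let ?\<Omega> = "\<lambda>i. if i = k then {z. Im z \<ge> 0} else {z. Im z > 0}"
  let ?n = "\<lambda>i. if i \<in> U then z\<^sup>2 else s * s" and ?a = "\<lambda>i. if i \<in> U then z else s"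
    and ?m = "\<lambda>i. if i \<in> U then complex_of_real X else 1"
  have "pair_sum cm cp V ?n ?a ?a ?m \<noteq> 0"
  proof (rule pair_sum_stable[OF finV X, of U ?\<Omega> cm cp "\<lambda>_. z" "\<lambda>_. s" "\<lambda>_. s"])
    show "U \<subseteq> V" by (auto simp: U_def)
    show "pair_sum cm cp V (\<lambda>i. x i * y i) y x (\<lambda>_. 1) \<noteq> 0"
      if xy: "\<And>i. i \<in> V \<Longrightarrow> x i \<in> ?\<Omega> i \<and> y i \<in> ?\<Omega> i" for x y
    proof -
      have "Im (x k) \<ge> 0" "Im (y k) \<ge> 0" using xy[OF kV] by auto
      moreover have "Im (x i) > 0" "Im (y i) > 0" if "i \<in> U" for i
        using xy[of i] that by (auto simp: U_def)
      ultimately show ?thesis unfolding pair_sum_product[OF finV] using subset_poly_nonzero(3,4) by auto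
    qed
    show "s \<in> ?\<Omega> i \<and> s \<in> ?\<Omega> i" if "i \<in> V - U" for i using that s by (auto simp: U_def)
  qed (use z kU(1) in auto)
  moreover have "pair_sum cm cp V ?n ?a ?a ?m = s * s * pair_sum cm cp U ?n ?a ?a ?m
      + s * pair_sum (\<lambda>I. cm (insert k I)) cp U ?n ?a ?a ?m + s * pair_sum cm (\<lambda>J. cp (insert k J)) U ?n ?a ?a ?m
      + pair_sum (\<lambda>I. cm (insert k I)) (\<lambda>J. cp (insert k J)) U ?n ?a ?a ?m"
    using pair_sum_insert[OF finU kU(1), of cm cp ?n ?a ?a ?m] kU by simp
  moreover have "pair_sum f g U ?n ?a ?a ?m = pair_poly f g U X z" for f g
    unfolding pair_poly_def by (rule pair_sum_cong) auto
  ultimately show ?thesis by (simp add: LL_def NN_def EE_def power2_eq_square algebra_simps)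
qed

text \<open>For fixed \<open>z\<close> the quadratic in \<open>s\<close> factors as
  \<open>LL * (s - a) * (s - b)\<close> with \<open>a\<close>, \<open>b\<close> in the open lower
  half-plane. Hence \<open>NN / LL = a + b\<close> and \<open>NN / EE = 1 / a + 1 / b\<close>. The
  last two claims treat the polynomial of \<open>V\<close> itself and an auxiliary function
  \<open>S\<close> linking it to \<open>LL\<close>.\<close>

lemma LNE_Im:
  assumes z: "Im z > 0"
  shows "Im (NN X z / LL X z) < 0" "Im (NN X z / EE X z) > 0"
    and "EE X z \<noteq> (0::complex)" "NN X z \<noteq> (0::complex)"
    and "Im ((2 * z * LL X z - of_real X * NN X z) / LL X z) > 0"
    and "Im ((z\<^sup>2 * LL X z - z * NN X z + of_real X * EE X z) / (2 * z * LL X z - of_real X * NN X z)) > 0"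
proof -
  have L: "LL X z \<noteq> 0" by (rule LL_nonzero[OF z])
  obtain a b where ab: "\<And>s. s\<^sup>2 + (- NN X z / LL X z) * s + EE X z / LL X z = (s - a) * (s - b)"
    using quadratic_factor by blast
  have "s\<^sup>2 + (- NN X z / LL X z) * s + EE X z / LL X z = (s\<^sup>2 * LL X z - s * NN X z + EE X z) / LL X z" for s
    using L by (simp add: field_simps)
  then have nz: "(s - a) * (s - b) \<noteq> 0" if "Im s \<ge> 0" for s
    using LNE_stable[OF z that] L unfolding ab[symmetric] by simp
  have im: "Im a < 0" "Im b < 0" using nz[of a] nz[of b] by force+
  have e: "EE X z / LL X z = a * b" using ab[of 0] by simp
  have n: "NN X z / LL X z = a + b"
    using sum_of_roots[of "- NN X z / LL X z" a b] ab[of 1] e by (simp add: algebra_simps)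
  have ne: "a \<noteq> 0" "b \<noteq> 0" using im by auto
  show n1: "Im (NN X z / LL X z) < 0" unfolding n using im by simp
  show "EE X z \<noteq> 0" using e ne by auto
  show "NN X z \<noteq> 0" using n1 by auto
  have "NN X z / EE X z = (NN X z / LL X z) / (EE X z / LL X z)" using L by simp
  also have "\<dots> = 1 / a + 1 / b" unfolding n e using ne by (simp add: field_simps)
  finally show "Im (NN X z / EE X z) > 0" using Im_inverse_pos[OF im(1)] Im_inverse_pos[OF im(2)] by simp
  define S where "S = 2 * z + of_real X * (- a - b)"
  define p where "p = z\<^sup>2 + z * (- a - b) + of_real X * (a * b)"
  have S: "(2 * z * LL X z - of_real X * NN X z) / LL X z = S"
  proof -
    have "(2 * z * LL X z - of_real X * NN X z) / LL X z = 2 * z - of_real X * (NN X z / LL X z)"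
      using L by (simp add: field_simps)
    then show ?thesis unfolding n by (simp add: S_def algebra_simps)
  qed
  have p: "(z\<^sup>2 * LL X z - z * NN X z + of_real X * EE X z) / LL X z = p"
  proof -
    have "(z\<^sup>2 * LL X z - z * NN X z + of_real X * EE X z) / LL X z = z\<^sup>2 - z * (NN X z / LL X z) + of_real X * (EE X z / LL X z)"
      using L by (simp add: field_simps)
    then show ?thesis unfolding n e by (simp add: p_def algebra_simps)
  qed
  have ImS: "Im S > 0" using z im X by (simp add: S_def add_pos_pos)
  then show "Im ((2 * z * LL X z - of_real X * NN X z) / LL X z) > 0" unfolding S .
  \<comment> \<open>Moving \<open>a\<close> and \<open>b\<close> by a common shift and then
    contracting \<open>k\<close> as well yields \<open>X * \<zeta>^2 + S * \<zeta> + p\<close>. So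
    its roots \<open>c\<close>, \<open>d\<close> are below the axis too, and \<open>S / p\<close> is
    minus the sum of their reciprocals.\<close>
  have nz2: "\<zeta>\<^sup>2 + (S / of_real X) * \<zeta> + p / of_real X \<noteq> 0" if "Im \<zeta> \<ge> 0" for \<zeta>
  proof -
    have "z\<^sup>2 * 1 + z * (\<zeta> - a) + z * (\<zeta> - b) + of_real X * ((\<zeta> - a) * (\<zeta> - b)) \<noteq> 0"
    proof (rule contraction_nonzero[OF _ z X])
      fix x y :: complex assume xy: "Im x > 0" "Im y > 0"
      have "x + (\<zeta> - a) \<noteq> 0" "y + (\<zeta> - b) \<noteq> 0" using xy im that by (auto simp: complex_eq_iff)
      then have "(x + (\<zeta> - a)) * (y + (\<zeta> - b)) \<noteq> 0" by simp
      then show "x * y * 1 + y * (\<zeta> - a) + x * (\<zeta> - b) + (\<zeta> - a) * (\<zeta> - b) \<noteq> 0"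
        by (simp add: algebra_simps)
    qed
    moreover have "z\<^sup>2 * 1 + z * (\<zeta> - a) + z * (\<zeta> - b) + of_real X * ((\<zeta> - a) * (\<zeta> - b))
      = of_real X * (\<zeta>\<^sup>2 + (S / of_real X) * \<zeta> + p / of_real X)"
      using X by (simp add: S_def p_def field_simps power2_eq_square)
    ultimately show ?thesis by auto
  qed
  obtain c d where cd: "\<And>s. s\<^sup>2 + (S / of_real X) * s + p / of_real X = (s - c) * (s - d)"
    using quadratic_factor by blast
  have imcd: "Im c < 0" "Im d < 0" using nz2[of c] nz2[of d] unfolding cd by force+
  then have ne2: "c \<noteq> 0" "d \<noteq> 0" by auto
  have e2: "p / of_real X = c * d" using cd[of 0] by simp
  have n2: "S / of_real X = - (c + d)"
    using sum_of_roots[of "S / of_real X" c d] cd[of 1] e2 by simp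
  have "S / p = (S / of_real X) / (p / of_real X)" using X by simp
  also have "\<dots> = - (1 / c) - 1 / d" unfolding n2 e2 using ne2 by (simp add: field_simps)
  finally have "Im (S / p) < 0" using Im_inverse_pos[OF imcd(1)] Im_inverse_pos[OF imcd(2)] by simp
  then have "Im (1 / (S / p)) > 0" by (rule Im_inverse_pos)
  then show "Im ((z\<^sup>2 * LL X z - z * NN X z + of_real X * EE X z) / (2 * z * LL X z - of_real X * NN X z)) > 0"
    unfolding S[symmetric] p[symmetric] using L by simp
qed

context
  fixes a0 :: real
  assumes D2: "D \<ge> 2" and a0: "a0 \<ge> 0" and pp: "\<And>x. x > a0 \<Longrightarrow> pair_poly cm cp V X x > (0::real)"
begin

lemma E2_pos: "E2 X > 0" using X D2 by (simp add: E2_def)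

lemma LNE_limits:
  "((\<lambda>x::real. LL X x * x ^ 0 / x ^ (2 * card U)) \<longlongrightarrow> 1) at_top"
  "((\<lambda>x::real. NN X x * x ^ Suc 0 / x ^ (2 * card U)) \<longlongrightarrow> 2 * D) at_top"
  "((\<lambda>x::real. EE X x * x ^ Suc (Suc 0) / x ^ (2 * card U)) \<longlongrightarrow> E2 X) at_top"
proof -
  obtain RL :: "complex \<Rightarrow> complex" where RL: "continuous_on UNIV RL"
    "\<And>z. z \<noteq> 0 \<Longrightarrow> LL X z = z ^ (2 * card U) * ((1 / z) ^ 0 * (of_real 1 + of_real (- B) * (1 / z)\<^sup>2 + (1 / z) ^ 4 * RL (1 / z)))"
    by (rule LL_expand[of X]) (rule that)
  show "((\<lambda>x::real. LL X x * x ^ 0 / x ^ (2 * card U)) \<longlongrightarrow> 1) at_top"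
    by (rule expansion_real_limit[OF RL(2,1) LNE_of_real(1)])
  obtain RN :: "complex \<Rightarrow> complex" where RN: "continuous_on UNIV RN"
    "\<And>z. z \<noteq> 0 \<Longrightarrow> NN X z = z ^ (2 * card U) * ((1 / z) ^ Suc 0 * (of_real (2 * D) + of_real (N3 X) * (1 / z)\<^sup>2 + (1 / z) ^ 4 * RN (1 / z)))"
    by (rule NN_expand[of X]) (rule that)
  show "((\<lambda>x::real. NN X x * x ^ Suc 0 / x ^ (2 * card U)) \<longlongrightarrow> 2 * D) at_top"
    by (rule expansion_real_limit[OF RN(2,1) LNE_of_real(2)])
  obtain RE :: "complex \<Rightarrow> complex" where RE: "continuous_on UNIV RE"
    "\<And>z. z \<noteq> 0 \<Longrightarrow> EE X z = z ^ (2 * card U) * ((1 / z) ^ Suc 1 * (of_real (E2 X) + of_real (E4 X) * (1 / z)\<^sup>2 + (1 / z) ^ 4 * RE (1 / z)))"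
    by (rule EE_expand[of X]) (rule that)
  show "((\<lambda>x::real. EE X x * x ^ Suc (Suc 0) / x ^ (2 * card U)) \<longlongrightarrow> E2 X) at_top"
    using expansion_real_limit[OF RE(2,1) LNE_of_real(3)] by simp
qed

text \<open>Positivity to the right of \<open>a0\<close> travels along the chain \<open>p\<close>,
  \<open>S\<close>, \<open>LL\<close>, \<open>NN\<close>, \<open>EE\<close> with
  \<open>S = 2 * x * LL - X * NN\<close>. The first two links are interlacing; in the last two,
  \<open>NN / LL\<close> and \<open>EE / NN\<close> decrease to 0.\<close>

lemma LNE_pos: "x > a0 \<Longrightarrow> LL X x > (0::real)" "x > a0 \<Longrightarrow> NN X x > (0::real)" "x > a0 \<Longrightarrow> EE X x > (0::real)"
proof -
  obtain l n e where lne: "\<And>y::real. LL X y = poly l y" "\<And>y::real. NN X y = poly n y" "\<And>y::real. EE X y = poly e y"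
    by (rule LNE_poly[of X]) (rule that)
  note hol = LNE_holomorphic[of X]
  define S where "S x = 2 * x * LL X x - X * NN X x" for x :: real
  define P where "P z = z\<^sup>2 * LL X z - z * NN X z + of_real X * EE X z" for z :: complex
  define SC where "SC z = 2 * z * LL X z - of_real X * NN X z" for z :: complex
  have holS: "SC holomorphic_on UNIV" "P holomorphic_on UNIV"
    unfolding SC_def[abs_def] P_def[abs_def] by (intro holomorphic_intros hol)+
  have reS: "SC (of_real x) = of_real (S x)" "P (of_real x) = of_real (pair_poly cm cp V X x)" for x
    by (simp_all add: SC_def S_def P_def LNE_of_real pair_poly_V)
  have evL: "\<forall>\<^sub>F x in at_top. LL X x > (0::real)"
    by (rule limit_eventually_pos[OF LNE_limits(1)]) simp
  have evN: "\<forall>\<^sub>F x in at_top. NN X x > (0::real)"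
    by (rule limit_eventually_pos[OF LNE_limits(2)]) (use D in simp)
  have evE: "\<forall>\<^sub>F x in at_top. EE X x > (0::real)"
    by (rule limit_eventually_pos[OF LNE_limits(3) E2_pos])
  have "((\<lambda>x. 2 * (LL X x * x ^ 0 / x ^ (2 * card U)) - X * (NN X x * x ^ Suc 0 / x ^ (2 * card U)) * (inverse x * inverse x))
      \<longlongrightarrow> 2 * 1 - X * (2 * D) * (0 * 0)) at_top"
    by (intro tendsto_intros LNE_limits tendsto_inverse_0_at_top filterlim_ident)
  moreover have "\<forall>\<^sub>F x in at_top. 2 * (LL X x * x ^ 0 / x ^ (2 * card U)) - X * (NN X x * x ^ Suc 0 / x ^ (2 * card U)) * (inverse x * inverse x)
      = S x * x ^ 0 / x ^ Suc (2 * card U)"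
    using eventually_gt_at_top[of 0] by eventually_elim (simp add: S_def field_simps)
  ultimately have "((\<lambda>x. S x * x ^ 0 / x ^ Suc (2 * card U)) \<longlongrightarrow> 2 * 1 - X * (2 * D) * (0 * 0)) at_top"
    by (rule tendsto_cong[THEN iffD1, rotated])
  then have evS: "\<forall>\<^sub>F x in at_top. S x > 0" by (rule limit_eventually_pos) simp
  have finS: "finite {x. S x = 0}"
    by (rule finite_zeros[OF evS, of "[:0, 2:] * l - Polynomial.smult X n"]) (simp add: S_def lne)
  have posS: "S x > 0" if "x > a0" for x
    by (rule interlacing_sign[OF holS(2,1) reS(2,1) _ pp evS finS that])
      (use LNE_Im(6) in \<open>simp add: P_def SC_def less_imp_le\<close>)
  have posL: "LL X x > 0" if "x > a0" for x :: real
    by (rule interlacing_sign[OF holS(1) hol(1) reS(1) LNE_of_real(1) _ posS evL finite_zeros[OF evL lne(1)] that])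
      (use LNE_Im(5) in \<open>simp add: SC_def less_imp_le\<close>)
  have posN: "NN X x > 0" if "x > a0" for x :: real
    by (rule pos_of_decreasing_ratio[OF hol(2,1) LNE_of_real(2,1) _ posL ratio_limit_0[OF LNE_limits(2,1)] finite_zeros[OF evN lne(2)] that])
      (use LNE_Im(1) in \<open>auto simp: less_imp_le\<close>)
  have imEN: "Im (EE X z / NN X z) \<le> 0" if "Im z > 0" for z
  proof -
    have "Im (1 / (NN X z / EE X z)) < 0" by (rule Im_inverse_neg[OF LNE_Im(2)[OF that]])
    then show ?thesis by simp
  qed
  have posE: "EE X x > 0" if "x > a0" for x :: real
    by (rule pos_of_decreasing_ratio[OF hol(3,2) LNE_of_real(3,2) imEN posN ratio_limit_0[OF LNE_limits(3,2)] finite_zeros[OF evE lne(3)] that])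
      (use D in auto)
  show "x > a0 \<Longrightarrow> LL X x > (0::real)" "x > a0 \<Longrightarrow> NN X x > (0::real)" "x > a0 \<Longrightarrow> EE X x > (0::real)"
    using posL posN posE by auto
qed

text \<open>The Nevanlinna bound for \<open>LL / NN\<close> has second moment
  \<open>w / D + (1 - X) * (D - 1)\<close>. Its left side is positive to the right of
  \<open>a0\<close>, so \<open>x^2\<close> must exceed this moment.\<close>

lemma walk_bound:
  assumes x: "x > a0"
  shows "w < D * (x\<^sup>2 - (1 - X) * (D - 1))"
proof -
  obtain RL :: "complex \<Rightarrow> complex" where RL: "continuous_on UNIV RL"
    "\<And>z. z \<noteq> 0 \<Longrightarrow> LL X z = z ^ (2 * card U) * ((1 / z) ^ 0 * (of_real 1 + of_real (- B) * (1 / z)\<^sup>2 + (1 / z) ^ 4 * RL (1 / z)))"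
    by (rule LL_expand[of X]) (rule that)
  obtain RN :: "complex \<Rightarrow> complex" where RN: "continuous_on UNIV RN"
    "\<And>z. z \<noteq> 0 \<Longrightarrow> NN X z = z ^ (2 * card U) * ((1 / z) ^ Suc 0 * (of_real (2 * D) + of_real (N3 X) * (1 / z)\<^sup>2 + (1 / z) ^ 4 * RN (1 / z)))"
    by (rule NN_expand[of X]) (rule that)
  have lim: "((\<lambda>z::complex. z * (z * (z - of_real (2 * D / 1) * (LL X z / NN X z)) - of_real (N3 X / (2 * D) - (- B) / 1))) \<longlongrightarrow> 0) at_infinity"
    by (rule Nevanlinna_expansion_limit[OF _ _ RN(1) RL(1) RN(2) RL(2)]) (use D in auto)
  have im: "Im (LL X z / NN X z) > 0" if "Im z > 0" for z
    using Im_inverse_pos[OF LNE_Im(1)[OF that]] by simp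
  have "2 * D / 1 * x * LL X x \<le> (x\<^sup>2 - (N3 X / (2 * D) - (- B) / 1)) * NN X x"
    by (rule Nevanlinna_bound[OF LNE_holomorphic(2,1) LNE_of_real(2,1) im a0 LNE_pos(2,1) _ lim x]) (use D in auto)
  moreover have "2 * D / 1 * x * LL X x > 0" using D x a0 LNE_pos(1)[OF x] by simp
  ultimately have "x\<^sup>2 - (N3 X / (2 * D) - (- B) / 1) > 0"
    using LNE_pos(2)[OF x] by (meson less_le_trans zero_less_mult_pos2)
  moreover have "N3 X / (2 * D) - (- B) / 1 = w / D + (1 - X) * (D - 1)"
    using D by (simp add: N3_def field_simps)
  ultimately have "w / D < x\<^sup>2 - (1 - X) * (D - 1)" by simp
  then show ?thesis using D by (simp add: field_simps)
qed

lemma walk_sums: "0 \<le> wN" "wN \<le> w" "\<tau>\<^sup>2 \<le> D * wN" "t \<le> D * (D - 1)"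
proof -
  have a1: "(a i)\<^sup>2 \<le> 1" for i using a_signs[of i] by auto
  show "0 \<le> wN" unfolding wN_def by (intro sum_nonneg) simp
  show "wN \<le> w" unfolding wN_def w_def by (intro sum_mono) (simp add: a1 mult_left_le_one_le)
  \<comment> \<open>Writing \<open>a i\<close> as its cube keeps both Cauchy-Schwarz factors
    supported on the neighbours of \<open>k\<close>, so that \<open>wN\<close> appears and not the
    larger \<open>w\<close>.\<close>
  have "\<tau> = (\<Sum>i\<in>U. a i * (a i * (a i * Aa i)))"
    unfolding \<tau>_def by (rule sum.cong[OF refl]) (use a_signs in force)
  then have "\<tau>\<^sup>2 \<le> (\<Sum>i\<in>U. (a i)\<^sup>2) * (\<Sum>i\<in>U. (a i * (a i * Aa i))\<^sup>2)"
    by (simp only: Cauchy_Schwarz_ineq_sum)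
  also have "(\<Sum>i\<in>U. (a i * (a i * Aa i))\<^sup>2) = wN"
    unfolding wN_def
  proof (rule sum.cong[OF refl])
    fix i show "(a i * (a i * Aa i))\<^sup>2 = (a i)\<^sup>2 * (Aa i)\<^sup>2" using a_signs[of i] by auto
  qed
  finally show "\<tau>\<^sup>2 \<le> D * wN" by (simp add: sum_a)
  have "(a i)\<^sup>2 * (a j)\<^sup>2 * (A i j)\<^sup>2 \<le> (a i)\<^sup>2 * (A i j)\<^sup>2" for i j
    by (intro mult_right_mono) (simp_all add: a1 mult_right_le_one_le)
  then show "t \<le> D * (D - 1)" unfolding t_def sum_aA[symmetric] by (intro sum_mono)
qed

text \<open>The Nevanlinna bound for \<open>NN / EE\<close>. Its second moment depends on the graph
  and is replaced by a lower bound in \<open>D\<close>, \<open>X\<close> and \<open>x\<close>, for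
  which \<open>walk_bound\<close> supplies the needed control of \<open>w\<close>.\<close>

lemma main_bound:
  assumes x: "x > a0"
  shows "x\<^sup>2 > (1 - X) * (D - 1)"
    "(D - (1 - X))\<^sup>2 * x * NN X x \<le> 2 * D * (x\<^sup>2 - (1 - X) * (D - 1)) * EE X x"
proof -
  define h where "h = 1 - X"
  have h: "0 \<le> h" "h < 1" "h \<le> 1" using X by (auto simp: h_def)
  have w: "w < D * (x\<^sup>2 - h * (D - 1))" using walk_bound[OF x] by (simp add: h_def)
  have "0 \<le> w" using walk_sums by linarith
  then have "0 < x\<^sup>2 - h * (D - 1)" using w D by (meson le_less_trans zero_less_mult_pos)
  then show "x\<^sup>2 > (1 - X) * (D - 1)" by (simp add: h_def)
  have Dh: "D - h > 0" using D2 h by linarith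
  obtain RE :: "complex \<Rightarrow> complex" where RE: "continuous_on UNIV RE"
    "\<And>z. z \<noteq> 0 \<Longrightarrow> EE X z = z ^ (2 * card U) * ((1 / z) ^ Suc 1 * (of_real (E2 X) + of_real (E4 X) * (1 / z)\<^sup>2 + (1 / z) ^ 4 * RE (1 / z)))"
    by (rule EE_expand[of X]) (rule that)
  obtain RN :: "complex \<Rightarrow> complex" where RN: "continuous_on UNIV RN"
    "\<And>z. z \<noteq> 0 \<Longrightarrow> NN X z = z ^ (2 * card U) * ((1 / z) ^ Suc 0 * (of_real (2 * D) + of_real (N3 X) * (1 / z)\<^sup>2 + (1 / z) ^ 4 * RN (1 / z)))"
    by (rule NN_expand[of X]) (rule that)
  have lim: "((\<lambda>z::complex. z * (z * (z - of_real (E2 X / (2 * D)) * (NN X z / EE X z)) - of_real (E4 X / E2 X - N3 X / (2 * D)))) \<longlongrightarrow> 0) at_infinity"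
    by (rule Nevanlinna_expansion_limit[OF _ _ RE(1) RN(1) RE(2)[unfolded One_nat_def] RN(2)]) (use D E2_pos in auto)
  \<comment> \<open>The value left over once \<open>\<tau>^2 \<le> D * wN\<close>,
    \<open>wN \<le> w\<close>, \<open>t \<le> D * (D - 1)\<close> and the bound on \<open>w\<close>
    are inserted into the second moment. It gives
    \<open>x^2 - v0 = D * (x^2 - h * (D - 1)) / (D - h)\<close>.\<close>
  define v0 where "v0 = h * (D * (D - 1) - x\<^sup>2) / (D - h)"
  have "v0 \<le> E4 X / E2 X - N3 X / (2 * D)"
  proof -
    have "E4 X / E2 X - N3 X / (2 * D) = (E4 X - N3 X * (D - h) / 2) / (D * (D - h))"
    proof -
      have "r / (D * e) - s / (2 * D) = (r - s * e / 2) / (D * e)" if "e > 0" for r s e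
        using D that by (simp add: field_simps)
      from this[OF Dh] show ?thesis by (simp add: E2_def h_def)
    qed
    moreover have "E4 X - N3 X * (D - h) / 2
      = D * w - 3 * h * w + 2 * h * wN - \<tau>\<^sup>2 - 2 * h\<^sup>2 * t + h * (D * (D * (D - 1))) + h\<^sup>2 * (D * (D - 1))"
      unfolding E4_def N3_def S4_eq S4'_eq h_def[symmetric] by (simp add: field_simps power2_eq_square)
    moreover have "\<dots> \<ge> D * (D - h) * v0"
    proof -
      \<comment> \<open>After \<open>\<tau>^2\<close> is traded for \<open>D * wN\<close>, the count
        \<open>wN\<close> has coefficient \<open>2 * h - D\<close>. It is nonpositive because
        \<open>D \<ge> 2\<close>, so passing to \<open>w\<close> is allowed.\<close>
      have "(D - 2 * h) * wN \<le> (D - 2 * h) * w" using walk_sums D2 h by (intro mult_left_mono) auto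
      moreover have "h * w \<le> h * (D * (x\<^sup>2 - h * (D - 1)))" using w h by (intro mult_left_mono) auto
      moreover have "h\<^sup>2 * t \<le> h\<^sup>2 * (D * (D - 1))" using walk_sums by (intro mult_left_mono) auto
      moreover have "D * (D - h) * v0 = h * (D * (D * (D - 1))) - h * (D * x\<^sup>2)"
        using Dh by (simp add: v0_def field_simps)
      ultimately show ?thesis using walk_sums(3) by (simp add: algebra_simps power2_eq_square)
    qed
    ultimately show ?thesis using D Dh by (simp add: pos_le_divide_eq mult.commute)
  qed
  then have "E2 X / (2 * D) * x * NN X x \<le> (x\<^sup>2 - v0) * EE X x"
    using Nevanlinna_bound[OF LNE_holomorphic(3,2) LNE_of_real(3,2) LNE_Im(2) a0 LNE_pos(3,2) _ lim x] D E2_pos by simp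
  moreover have "E2 X / (2 * D) = (D - h) / 2" using D by (simp add: E2_def h_def)
  moreover have "x\<^sup>2 - v0 = D * (x\<^sup>2 - h * (D - 1)) / (D - h)"
    using Dh by (simp add: v0_def field_simps)
  ultimately have "(D - h) / 2 * x * NN X x \<le> D * (x\<^sup>2 - h * (D - 1)) / (D - h) * EE X x" by simp
  moreover have "e\<^sup>2 * x * r \<le> 2 * D * y * s" if "e / 2 * x * r \<le> D * y / e * s" "e > 0" for e r s y
    using that by (simp add: field_simps power2_eq_square)
  ultimately show "(D - (1 - X))\<^sup>2 * x * NN X x \<le> 2 * D * (x\<^sup>2 - (1 - X) * (D - 1)) * EE X x"
    using Dh unfolding h_def[symmetric] by blast
qed

end

end

end

section \<open>The flow from the mixed polynomial to the characteristic polynomials\<close>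

text \<open>
  The inequality that makes the flow argument work for the curve \<open>Y\<^sup>2 = (d - 1) q / 10000\<close>, with
  \<open>t = 5 / (d - 1)\<close>; it is certified by nonnegative Bernstein coefficients on the unit square.
\<close>

lemma flow_polynomial_scaled:
  fixes X t :: real
  assumes X: "0 \<le> X" "X \<le> 1" and t: "0 \<le> t" "t \<le> 1"
    and A: "A = 5695 - 1139 * t" and B: "B = 90 + 2270 * t" and q: "q = 80010 - 2 * A * X - B * (X * X)"
  shows "(A + B * X) * (5 * (5 + t) * (q - 10000 + 10000 * X) - 10000 * X * ((5 + t * X) * (5 + t * X)))
    \<le> 5000 * q * ((5 + t * X) * (5 + t * X))"
proof -
  \<comment> \<open>Coefficients \<open>b0\<close> to \<open>b4\<close> of the difference in the
    quartic Bernstein basis in \<open>X\<close>, binomials absorbed; each is then rewritten in the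
    cubic Bernstein basis in \<open>t\<close>.\<close>
  define b0 where "b0 = 33576250 + 0 * t + 398706950 * (t * t) + 0 * (t * t * t)"
  have b0: "b0 = 33576250 * ((1 - t) * (1 - t) * (1 - t)) + 100728750 * t * ((1 - t) * (1 - t)) + 499435700 * (t * t) * (1 - t) + 432283200 * (t * t * t)"
    by (simp add: b0_def algebra_simps)
  have b0p: "b0 \<ge> 0" unfolding b0 using t by (intro add_nonneg_nonneg mult_nonneg_nonneg) auto
  define b1 where "b1 = 174683750 + (- 328402250) * t + 792298250 * (t * t) + 12973210 * (t * t * t)"
  have b1: "b1 = 174683750 * ((1 - t) * (1 - t) * (1 - t)) + 195649000 * t * ((1 - t) * (1 - t)) + 659545000 * (t * t) * (1 - t) + 651552960 * (t * t * t)"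
    by (simp add: b1_def algebra_simps)
  have b1p: "b1 \<ge> 0" unfolding b1 using t by (intro add_nonneg_nonneg mult_nonneg_nonneg) auto
  define b2 where "b2 = 349785000 + (- 303883000) * t + 269665400 * (t * t) + 136680 * (t * t * t)"
  have b2: "b2 = 349785000 * ((1 - t) * (1 - t) * (1 - t)) + 745472000 * t * ((1 - t) * (1 - t)) + 711254400 * (t * t) * (1 - t) + 315704080 * (t * t * t)"
    by (simp add: b2_def algebra_simps)
  have b2p: "b2 \<ge> 0" unfolding b2 using t by (intro add_nonneg_nonneg mult_nonneg_nonneg) auto
  define b3 where "b3 = 310026250 + 392196250 * t + 1629350 * (t * t) + (- 12881770) * (t * t * t)"
  have b3: "b3 = 310026250 * ((1 - t) * (1 - t) * (1 - t)) + 1322275000 * t * ((1 - t) * (1 - t)) + 1716100600 * (t * t) * (1 - t) + 690970080 * (t * t * t)"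
    by (simp add: b3_def algebra_simps)
  have b3p: "b3 \<ge> 0" unfolding b3 using t by (intro add_nonneg_nonneg mult_nonneg_nonneg) auto
  define b4 where "b4 = 101348750 + 367677000 * t + 126005250 * (t * t) + 11304760 * (t * t * t)"
  have b4: "b4 = 101348750 * ((1 - t) * (1 - t) * (1 - t)) + 671723250 * t * ((1 - t) * (1 - t)) + 1165405500 * (t * t) * (1 - t) + 606335760 * (t * t * t)"
    by (simp add: b4_def algebra_simps)
  have b4p: "b4 \<ge> 0" unfolding b4 using t by (intro add_nonneg_nonneg mult_nonneg_nonneg) auto
  define S where "S = b0 * ((1 - X) * (1 - X) * (1 - X) * (1 - X)) + b1 * X * ((1 - X) * (1 - X) * (1 - X))
    + b2 * (X * X) * ((1 - X) * (1 - X)) + b3 * (X * X * X) * (1 - X) + b4 * (X * X * X * X)"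
  have "S \<ge> 0"
    unfolding S_def using X by (intro add_nonneg_nonneg mult_nonneg_nonneg b0p b1p b2p b3p b4p) auto
  moreover have "5000 * q * ((5 + t * X) * (5 + t * X))
    - (A + B * X) * (5 * (5 + t) * (q - 10000 + 10000 * X) - 10000 * X * ((5 + t * X) * (5 + t * X))) = S"
    unfolding S_def q A B b0_def b1_def b2_def b3_def b4_def by (simp add: algebra_simps)
  ultimately show ?thesis by linarith
qed

text \<open>Gronwall argument: \<open>g x * exp (c * x)\<close> is nondecreasing.\<close>

lemma positivity_propagates:
  fixes g :: "real \<Rightarrow> real"
  assumes ab: "a < b" and cont: "continuous_on {a..b} g" and ga: "g a > 0"
    and der: "\<And>x. a < x \<Longrightarrow> x < b \<Longrightarrow> \<exists>g'. (g has_real_derivative g') (at x) \<and> g' \<ge> - c * g x"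
  shows "g b > 0"
proof -
  have "g a * exp (c * a) \<le> g b * exp (c * b)"
  proof (rule DERIV_nonneg_imp_increasing_open[OF less_imp_le[OF ab]])
    fix x assume x: "a < x" "x < b"
    obtain g' where g': "(g has_real_derivative g') (at x)" "g' \<ge> - c * g x" using der[OF x] by blast
    have "((\<lambda>x. g x * exp (c * x)) has_real_derivative (g' + c * g x) * exp (c * x)) (at x)"
      using g'(1) by (auto intro!: derivative_eq_intros simp: algebra_simps)
    moreover have "(g' + c * g x) * exp (c * x) \<ge> 0" using g'(2) by simp
    ultimately show "\<exists>y. ((\<lambda>x. g x * exp (c * x)) has_real_derivative y) (at x) \<and> 0 \<le> y" by blast
  qed (intro continuous_intros cont)
  moreover have "g a * exp (c * a) > 0" using ga by simp
  ultimately have "g b * exp (c * b) > 0" by linarith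
  then show ?thesis by (simp add: zero_less_mult_iff)
qed

lemma nonneg_at_end:
  fixes f :: "real \<Rightarrow> real"
  assumes "continuous_on UNIV f" "\<And>x. x > a \<Longrightarrow> f x \<ge> 0" "x \<ge> a"
  shows "f x \<ge> 0"
proof (cases "x = a")
  case True
  have "isCont f a" using assms(1) by (simp add: continuous_on_eq_continuous_at)
  then have "(f \<longlongrightarrow> f a) (at_right a)" by (simp add: isCont_def filterlim_at_split)
  moreover have "\<forall>\<^sub>F x in at_right a. 0 \<le> f x"
    using assms(2) eventually_at_right_less[of a] by (auto elim: eventually_mono)
  ultimately show ?thesis unfolding True by (rule tendsto_lowerbound) simp
qed (use assms in auto)

context signed_regular_vertex
begin

lemma pair_sum_upd:
  "pair_sum cm cp V ((\<lambda>_. y\<^sup>2)(k := n')) ((\<lambda>_. y)(k := a')) ((\<lambda>_. y)(k := a')) ((\<lambda>_. X)(k := m'))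
    = n' * LL X y - a' * NN X y + m' * EE X (y :: real)"
proof -
  have "pair_sum f g U ((\<lambda>_. y\<^sup>2)(k := n')) ((\<lambda>_. y)(k := a')) ((\<lambda>_. y)(k := a')) ((\<lambda>_. X)(k := m')) = pair_poly f g U X y" for f g
    unfolding pair_poly_def by (rule pair_sum_cong) (use kU(1) in auto)
  then show ?thesis
    using pair_sum_insert[OF finU kU(1), of cm cp "(\<lambda>_. y\<^sup>2)(k := n')" "(\<lambda>_. y)(k := a')" "(\<lambda>_. y)(k := a')" "(\<lambda>_. X)(k := m')"]
    by (simp add: kU(2)[symmetric] LL_def NN_def EE_def algebra_simps)
qed

lemma LNE_continuous: "continuous_on UNIV (NN X :: real \<Rightarrow> real)" "continuous_on UNIV (EE X :: real \<Rightarrow> real)"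
proof -
  obtain l n e where "\<And>y::real. LL X y = poly l y" "\<And>y::real. NN X y = poly n y" "\<And>y::real. EE X y = poly e y"
    by (rule LNE_poly[of X]) (rule that)
  then have "NN X = poly n" "EE X = poly e" by auto
  then show "continuous_on UNIV (NN X :: real \<Rightarrow> real)" "continuous_on UNIV (EE X :: real \<Rightarrow> real)"
    by (simp_all add: continuous_intros)
qed

text \<open>The flow evaluates the bound on the curve itself, that is at the endpoint
  \<open>x = a0\<close>, which is reached by a limit from the right.\<close>

lemma main_bound_closed:
  assumes X: "0 < X" "X \<le> 1" and D: "D \<ge> 2" and a0: "a0 \<ge> 0" and pp: "\<And>x. x > a0 \<Longrightarrow> pair_poly cm cp V X x > (0::real)"
    and x: "x \<ge> a0"
  shows "(D - (1 - X))\<^sup>2 * x * NN X x \<le> 2 * D * (x\<^sup>2 - (1 - X) * (D - 1)) * EE X x" "EE X x \<ge> 0"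
proof -
  have D0: "D > 0" using D by simp
  have "2 * D * (x\<^sup>2 - (1 - X) * (D - 1)) * EE X x - (D - (1 - X))\<^sup>2 * x * NN X x \<ge> 0"
    by (rule nonneg_at_end[OF _ _ x])
      (use main_bound(2)[OF X D0 D a0 pp] in \<open>auto intro!: continuous_intros LNE_continuous\<close>)
  then show "(D - (1 - X))\<^sup>2 * x * NN X x \<le> 2 * D * (x\<^sup>2 - (1 - X) * (D - 1)) * EE X x" by simp
  show "EE X x \<ge> 0"
    by (rule nonneg_at_end[OF LNE_continuous(2) _ x]) (use LNE_pos(3)[OF X D0 D a0 pp] in \<open>auto intro: less_imp_le\<close>)
qed

end

context signed_regular
begin

lemma vertex: "k \<in> V \<Longrightarrow> signed_regular_vertex A V D k"
  by unfold_locales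

abbreviation pX :: "real \<Rightarrow> real \<Rightarrow> real" where "pX X y \<equiv> pair_poly cm cp V X y"

lemma pX_DERIV:
  assumes Y: "(Y has_real_derivative Y') (at X)"
  shows "((\<lambda>X. pX X (Y X)) has_real_derivative
    (\<Sum>k\<in>V. 2 * Y X * Y' * signed_regular_vertex.LL A V k X (Y X) - Y' * signed_regular_vertex.NN A V k X (Y X)
      + signed_regular_vertex.EE A V k X (Y X))) (at X)"
proof -
  have "((\<lambda>X. pair_sum cm cp V (\<lambda>_. (Y X)\<^sup>2) (\<lambda>_. Y X) (\<lambda>_. Y X) (\<lambda>_. X)) has_real_derivative
    (\<Sum>k\<in>V. pair_sum cm cp V ((\<lambda>_. (Y X)\<^sup>2)(k := 2 * Y X * Y')) ((\<lambda>_. Y X)(k := Y')) ((\<lambda>_. Y X)(k := Y')) ((\<lambda>_. X)(k := 1)))) (at X)"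
    by (rule pair_sum_DERIV[OF finV]) (use Y in \<open>auto intro!: derivative_eq_intros\<close>)
  also have "(\<Sum>k\<in>V. pair_sum cm cp V ((\<lambda>_. (Y X)\<^sup>2)(k := 2 * Y X * Y')) ((\<lambda>_. Y X)(k := Y')) ((\<lambda>_. Y X)(k := Y')) ((\<lambda>_. X)(k := 1)))
    = (\<Sum>k\<in>V. 2 * Y X * Y' * signed_regular_vertex.LL A V k X (Y X) - Y' * signed_regular_vertex.NN A V k X (Y X)
      + signed_regular_vertex.EE A V k X (Y X))"
    by (rule sum.cong[OF refl]) (simp add: signed_regular_vertex.pair_sum_upd[OF vertex])
  finally show ?thesis by (simp add: pair_poly_def)
qed

text \<open>The polynomial in the variable \<open>u = 1 / y\<close>. It extends continuously to
  \<open>u = 0\<close> with value 1, so the pairs where positivity fails form a compact set and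
  nothing escapes to \<open>y = \<infinity>\<close>.\<close>

definition recip_sum :: "real \<Rightarrow> real \<Rightarrow> real" where
  "recip_sum X u = (\<Sum>I\<in>Pow V. \<Sum>J\<in>Pow V. cm I * cp J * X ^ card (I \<inter> J) * u ^ (card I + card J))"

lemma pX_recip_sum: "y \<noteq> 0 \<Longrightarrow> pX X y = y ^ (2 * card V) * recip_sum X (1 / y)"
  using pair_poly_expand[OF finV, of y cm cp X] by (simp add: recip_sum_def)

lemma pX_pos_iff: "y > 0 \<Longrightarrow> pX X y > 0 \<longleftrightarrow> recip_sum X (1 / y) > 0"
  by (simp add: pX_recip_sum zero_less_mult_iff)

lemma recip_sum_0: "recip_sum X 0 = 1"
proof -
  have "recip_sum X 0 = (\<Sum>I\<in>Pow V. \<Sum>J\<in>Pow V. if I = {} then if J = {} then 1 else 0 else 0)"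
    unfolding recip_sum_def
  proof (intro sum.cong refl)
    fix I J assume "I \<in> Pow V" "J \<in> Pow V"
    then have "finite I" "finite J" using finV finite_subset by auto
    then show "cm I * cp J * X ^ card (I \<inter> J) * 0 ^ (card I + card J) = (if I = {} then if J = {} then 1 else 0 else 0)"
      by (auto simp: power_0_left)
  qed
  also have "\<dots> = (\<Sum>I\<in>Pow V. if I = {} then 1 else 0)"
    by (rule sum.cong) (use finV in auto)
  finally show ?thesis using finV by simp
qed

lemma recip_sum_continuous: "continuous_on S (\<lambda>z. recip_sum (fst z) (snd z))"
  unfolding recip_sum_def by (intro continuous_intros)

lemma pX_continuous: "continuous_on S Y \<Longrightarrow> continuous_on S (\<lambda>X. pX X (Y X))"
proof -
  assume Y: "continuous_on S Y"
  have "continuous_on S (\<lambda>X. pair_wt (\<lambda>_. (Y X)\<^sup>2) (\<lambda>_. Y X) (\<lambda>_. Y X) (\<lambda>_. of_real X) I J i)" for I J i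
    by (cases "i \<in> I"; cases "i \<in> J") (auto simp: pair_wt_def intro!: continuous_intros Y)
  then show ?thesis unfolding pair_poly_def pair_sum_def by (intro continuous_intros)
qed

text \<open>If positivity fails above the curve, let \<open>X1\<close> be the first parameter where
  it does. A failure strictly above the curve is impossible since for fixed \<open>y\<close> the
  derivative in \<open>X\<close> is a sum of values \<open>EE \<ge> 0\<close>. A failure on the
  curve is impossible since there the derivative is at least \<open>- 2 * card V\<close> times the
  value itself.\<close>

lemma flow:
  assumes D: "D \<ge> 6" and t: "t = 5 / (D - 1)"
    and fA: "fA = 5695 - 1139 * t" and fB: "fB = 90 + 2270 * t"
    and fq: "\<And>X. fq X = 80010 - 2 * fA * X - fB * (X * X)"
    and Y: "\<And>X. Y X = sqrt ((D - 1) * fq X / 10000)"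
    and start: "\<And>y. y \<ge> Y 0 \<Longrightarrow> pX 0 y > 0"
    and X: "0 \<le> X" "X \<le> 1" and y: "y \<ge> Y X"
  shows "pX X y > 0"
proof (rule ccontr)
  assume bad: "\<not> pX X y > 0"
  have t01: "0 \<le> t" "t \<le> 1" using D by (auto simp: t field_simps)
  have AB: "4556 \<le> fA" "fA \<le> 5695" "90 \<le> fB" "fB \<le> 2360" using t01 by (auto simp: fA fB)
  have q_lb: "fq X \<ge> 60000" if "0 \<le> X" "X \<le> 1" for X
  proof -
    have "fA * X \<le> 5695 * 1" "fB * (X * X) \<le> 2360 * (1 * 1)" using AB that by (intro mult_mono; simp)+
    then show ?thesis by (simp add: fq)
  qed
  have Ypos: "Y X > 1" if "0 \<le> X" "X \<le> 1" for X
  proof -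
    have "(D - 1) * fq X \<ge> 5 * 60000" using q_lb[OF that] D by (intro mult_mono) auto
    then show ?thesis by (simp add: Y)
  qed
  have Y2: "(Y X)\<^sup>2 = (D - 1) * fq X / 10000" if "0 \<le> X" "X \<le> 1" for X
    using q_lb[OF that] D by (simp add: Y)
  have Ycont: "continuous_on S Y" for S
    unfolding Y[abs_def] fq by (intro continuous_intros) auto
  define K where "K = {z \<in> {0..1} \<times> {0..1}. snd z * Y (fst z) \<le> 1 \<and> recip_sum (fst z) (snd z) \<le> 0}"
  have Kcl: "compact K"
  proof -
    have "closed {z :: real \<times> real. snd z * Y (fst z) \<le> 1}"
      by (intro closed_Collect_le continuous_intros continuous_on_compose2[OF Ycont]) auto
    moreover have "closed {z :: real \<times> real. recip_sum (fst z) (snd z) \<le> 0}"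
      by (intro closed_Collect_le continuous_intros recip_sum_continuous)
    ultimately have "compact (({0..1} \<times> {0..1}) \<inter> ({z :: real \<times> real. snd z * Y (fst z) \<le> 1} \<inter> {z. recip_sum (fst z) (snd z) \<le> 0}))"
      by (intro compact_Int_closed compact_Times compact_Icc closed_Int)
    also have "({0..1} \<times> {0..1}) \<inter> ({z :: real \<times> real. snd z * Y (fst z) \<le> 1} \<inter> {z. recip_sum (fst z) (snd z) \<le> 0}) = K"
      by (auto simp: K_def)
    finally show ?thesis .
  qed
  have inK: "(X, 1 / y) \<in> K" if "0 \<le> X" "X \<le> 1" "y \<ge> Y X" "\<not> pX X y > 0" for X y
  proof -
    have "y > 1" using Ypos[OF that(1,2)] that(3) by linarith
    then show ?thesis using that pX_pos_iff[of y X] by (auto simp: K_def field_simps)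
  qed
  have "K \<noteq> {}" using inK[OF X y bad] by auto
  then obtain z where z: "z \<in> K" "\<And>z'. z' \<in> K \<Longrightarrow> fst z \<le> fst z'"
    using continuous_attains_inf[OF Kcl, of fst] continuous_on_fst[OF continuous_on_id] by blast
  define X1 where "X1 = fst z"
  define y1 where "y1 = 1 / snd z"
  have zK: "0 \<le> X1" "X1 \<le> 1" "0 \<le> snd z" "snd z * Y X1 \<le> 1" "recip_sum X1 (snd z) \<le> 0"
    using z(1) by (auto simp: K_def X1_def)
  have "snd z \<noteq> 0" using zK(5) recip_sum_0[of X1] by auto
  then have y1: "y1 > 0" "y1 \<ge> Y X1" "pX X1 y1 \<le> 0"
    using zK pX_pos_iff[of y1 X1] by (auto simp: y1_def field_simps not_less)
  have X1pos: "X1 > 0" using start[of y1] y1 zK(1) by (cases "X1 = 0") auto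
  have before: "pX X y > 0" if "0 \<le> X" "X < X1" "y \<ge> Y X" for X y
    using z(2)[OF inK[of X y]] that zK(2) by (force simp: X1_def)
  have bounds: "(D - (1 - X))\<^sup>2 * y * signed_regular_vertex.NN A V k X y
      \<le> 2 * D * (y\<^sup>2 - (1 - X) * (D - 1)) * signed_regular_vertex.EE A V k X y"
    "signed_regular_vertex.EE A V k X y \<ge> 0"
    if "0 < X" "X < X1" "y \<ge> Y X" "k \<in> V" for X y k
    using signed_regular_vertex.main_bound_closed[OF vertex[OF that(4)], of X "Y X" y] that D zK(2)
      Ypos[of X] before[of X] by (auto simp: less_imp_le)
  show False
  proof (cases "y1 > Y X1")
    case True
    have "isCont Y X1" using Ycont[of UNIV] by (simp add: continuous_on_eq_continuous_at)
    then have "\<forall>\<^sub>F X in at X1. Y X < y1" using True order_tendstoD(2)[of Y "Y X1" "at X1" y1] by (simp add: isCont_def)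
    then obtain e where e: "e > 0" "\<And>X. X \<noteq> X1 \<Longrightarrow> dist X X1 < e \<Longrightarrow> Y X < y1"
      unfolding eventually_at by blast
    define X0 where "X0 = max (X1 / 2) (X1 - e / 2)"
    have X0: "0 < X0" "X0 < X1" "X1 - e < X0" using X1pos e(1) by (auto simp: X0_def)
    have Ylt: "Y X < y1" if "X0 \<le> X" "X < X1" for X using e(2)[of X] that X0 by (auto simp: dist_real_def)
    have "pX X1 y1 > 0"
    proof (rule positivity_propagates[where c = 0 and g = "\<lambda>X. pX X y1", OF X0(2)])
      show "continuous_on {X0..X1} (\<lambda>X. pX X y1)" by (intro pX_continuous continuous_intros)
      show "pX X0 y1 > 0" using before[of X0 y1] X0 Ylt[of X0] by simp
      fix X assume X: "X0 < X" "X < X1"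
      have d: "((\<lambda>_. y1) has_real_derivative 0) (at X)" by simp
      have "(\<Sum>k\<in>V. signed_regular_vertex.EE A V k X y1) \<ge> 0"
        using bounds(2)[of X y1] X X0 Ylt[of X] by (intro sum_nonneg) auto
      then show "\<exists>g'. ((\<lambda>X. pX X y1) has_real_derivative g') (at X) \<and> g' \<ge> - 0 * pX X y1"
        using pX_DERIV[OF d] by (intro exI conjI) auto
    qed
    then show False using y1 by simp
  next
    case False
    then have y1Y: "y1 = Y X1" using y1 by simp
    have "pX X1 (Y X1) > 0"
    proof (rule positivity_propagates[where c = "2 * real (card V)" and g = "\<lambda>X. pX X (Y X)", OF X1pos])
      show "continuous_on {0..X1} (\<lambda>X. pX X (Y X))" by (intro pX_continuous Ycont)
      show "pX 0 (Y 0) > 0" by (rule start) simp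
      fix X assume X: "0 < X" "X < X1"
      then have X01: "0 \<le> X" "X \<le> 1" using zK by auto
      \<comment> \<open>Minus the logarithmic derivative of \<open>Y\<close>, as
        \<open>fq' = - 2 * (fA + fB * X)\<close>.\<close>
      define \<kappa> where "\<kappa> = (fA + fB * X) / fq X"
      have fq0: "fq X > 0" using q_lb[OF X01] by simp
      have "fB * X \<le> 2360 * 1" using AB X01 by (intro mult_mono) auto
      moreover have "fB * X \<ge> 0" using AB X01 by simp
      ultimately have num: "fA + fB * X \<ge> 0" "fA + fB * X \<le> 8055" using AB by auto
      have \<kappa>: "0 \<le> \<kappa>" "\<kappa> \<le> 1" using num fq0 q_lb[OF X01] by (auto simp: \<kappa>_def divide_le_eq)
      define \<delta> where "\<delta> = D - 1"
      have \<delta>: "\<delta> > 0" using D by (simp add: \<delta>_def)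
      have "((\<lambda>X. 80010 - 2 * fA * X - fB * (X * X)) has_real_derivative - 2 * (fA + fB * X)) (at X)"
        by (auto intro!: derivative_eq_intros simp: algebra_simps)
      then have dfq: "(fq has_real_derivative - 2 * (fA + fB * X)) (at X)" using fq by presburger
      have dq: "((\<lambda>X. \<delta> * fq X / 10000) has_real_derivative \<delta> * (- 2 * (fA + fB * X)) / 10000) (at X)"
        by (rule DERIV_cdivide[OF DERIV_cmult[OF dfq]])
      have "((\<lambda>X. sqrt (\<delta> * fq X / 10000)) has_real_derivative inverse (sqrt (\<delta> * fq X / 10000)) / 2 * (\<delta> * (- 2 * (fA + fB * X)) / 10000)) (at X)"
        by (rule DERIV_chain2[OF DERIV_real_sqrt dq]) (use \<delta> fq0 in simp)
      moreover have "Y = (\<lambda>X. sqrt (\<delta> * fq X / 10000))" by (auto simp: Y \<delta>_def)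
      ultimately have dY: "(Y has_real_derivative inverse (Y X) / 2 * (\<delta> * (- 2 * (fA + fB * X)) / 10000)) (at X)" by simp
      have \<delta>Y: "\<delta> = 10000 * (Y X * Y X) / fq X"
        using Y2[OF X01] fq0 by (simp add: \<delta>_def field_simps power2_eq_square)
      have aux: "inverse y / 2 * (r * (- 2 * s) / 10000) = - (s / q) * y" if "r = 10000 * (y * y) / q" "q > 0" "y > 0" for r y s q :: real
        using that by (simp add: field_simps)
      have "inverse (Y X) / 2 * (\<delta> * (- 2 * (fA + fB * X)) / 10000) = - \<kappa> * Y X"
        unfolding \<kappa>_def by (rule aux[OF \<delta>Y fq0]) (use Ypos[OF X01] in simp)
      then have dY: "(Y has_real_derivative - \<kappa> * Y X) (at X)" using dY by (simp only:)
      define G where "G = pX X (Y X)"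
      have G: "G > 0" unfolding G_def using before[of X "Y X"] X by simp
      define e where "e = D - (1 - X)"
      have e: "e > 0" using D X01 by (simp add: e_def)
      \<comment> \<open>The scaled polynomial inequality times \<open>\<delta>^2 / 125000\<close>,
        through \<open>5 + t = 5 * D / \<delta>\<close> and
        \<open>5 + t * X = 5 * e / \<delta>\<close>.\<close>
      have key: "2 * \<kappa> * D * ((Y X)\<^sup>2 - (1 - X) * (D - 1)) \<le> e\<^sup>2 * (1 + 2 * \<kappa> * X)"
      proof -
        have s: "(fA + fB * X) * (5 * (5 + t) * (fq X - 10000 + 10000 * X) - 10000 * X * ((5 + t * X) * (5 + t * X)))
          \<le> 5000 * fq X * ((5 + t * X) * (5 + t * X))"
          by (rule flow_polynomial_scaled[OF X01 t01 fA fB fq])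
        have 5: "5 + t = 5 * D / \<delta>" "5 + t * X = 5 * e / \<delta>"
          using \<delta> by (auto simp: t e_def \<delta>_def field_simps)
        define Z where "Z = fq X / 10000 - (1 - X)"
        have Z: "fq X - 10000 + 10000 * X = 10000 * Z" by (simp add: Z_def)
        have "r * (5 * (5 * D / \<delta>) * (10000 * Z) - 10000 * X * ((5 * e / \<delta>) * (5 * e / \<delta>)))
          = 125000 / \<delta>\<^sup>2 * (r * (2 * (D * \<delta> * Z) - 2 * X * e\<^sup>2))" for r
          using \<delta> by (simp add: field_simps power2_eq_square)
        moreover have "5000 * fq X * ((5 * e / \<delta>) * (5 * e / \<delta>)) = 125000 / \<delta>\<^sup>2 * (fq X * e\<^sup>2)"
          using \<delta> by (simp add: field_simps power2_eq_square)
        ultimately have "125000 / \<delta>\<^sup>2 * ((fA + fB * X) * (2 * (D * \<delta> * Z) - 2 * X * e\<^sup>2)) \<le> 125000 / \<delta>\<^sup>2 * (fq X * e\<^sup>2)"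
          using s unfolding 5 Z by (simp only:)
        moreover have "125000 / \<delta>\<^sup>2 > 0" using \<delta> by simp
        ultimately have "(fA + fB * X) * (2 * (D * \<delta> * Z) - 2 * X * e\<^sup>2) \<le> fq X * e\<^sup>2"
          by (meson mult_le_cancel_left_pos)
        then have "\<kappa> * (2 * (D * \<delta> * Z) - 2 * X * e\<^sup>2) \<le> e\<^sup>2"
          using fq0 by (simp add: \<kappa>_def divide_le_eq mult.commute)
        moreover have "(Y X)\<^sup>2 - (1 - X) * (D - 1) = \<delta> * Z"
          using Y2[OF X01] by (simp add: Z_def \<delta>_def algebra_simps)
        ultimately show ?thesis by (simp add: algebra_simps)
      qed
      \<comment> \<open>Eliminating \<open>LL\<close> by means of \<open>G\<close> leaves
        \<open>- 2 * \<kappa> * G\<close> plus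
        \<open>(1 + 2 * \<kappa> * X) * EE - \<kappa> * Y * NN\<close>; the latter is nonnegative by
        \<open>bounds\<close> and \<open>key\<close>, and \<open>\<kappa> \<le> 1\<close>.\<close>
      have lower: "2 * Y X * (- \<kappa> * Y X) * signed_regular_vertex.LL A V k X (Y X)
          - (- \<kappa> * Y X) * signed_regular_vertex.NN A V k X (Y X) + signed_regular_vertex.EE A V k X (Y X) \<ge> - 2 * G"
        if k: "k \<in> V" for k
      proof -
        define l m n where "l = signed_regular_vertex.LL A V k X (Y X)"
          and "m = signed_regular_vertex.NN A V k X (Y X)" and "n = signed_regular_vertex.EE A V k X (Y X)"
        have p: "G = (Y X)\<^sup>2 * l - Y X * m + X * n"
          using signed_regular_vertex.pair_poly_V[OF vertex[OF k], of X "Y X"] by (simp add: G_def l_def m_def n_def)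
        have b: "e\<^sup>2 * Y X * m \<le> 2 * D * ((Y X)\<^sup>2 - (1 - X) * (D - 1)) * n" "n \<ge> 0"
          using bounds[of X "Y X" k] X k by (auto simp: m_def n_def e_def)
        have "e\<^sup>2 * (\<kappa> * Y X * m) = \<kappa> * (e\<^sup>2 * Y X * m)" by simp
        also have "\<dots> \<le> \<kappa> * (2 * D * ((Y X)\<^sup>2 - (1 - X) * (D - 1)) * n)" using b(1) \<kappa>(1) by (intro mult_left_mono)
        also have "\<dots> = (2 * \<kappa> * D * ((Y X)\<^sup>2 - (1 - X) * (D - 1))) * n" by simp
        also have "\<dots> \<le> e\<^sup>2 * (1 + 2 * \<kappa> * X) * n" using key b(2) by (intro mult_right_mono)
        finally have "e\<^sup>2 * (\<kappa> * Y X * m) \<le> e\<^sup>2 * ((1 + 2 * \<kappa> * X) * n)" by (simp add: mult.assoc)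
        then have km: "\<kappa> * Y X * m \<le> (1 + 2 * \<kappa> * X) * n" using e by (simp add: mult_le_cancel_left)
        have "2 * Y X * (- \<kappa> * Y X) * l - (- \<kappa> * Y X) * m + n = - (2 * \<kappa>) * ((Y X)\<^sup>2 * l) + \<kappa> * Y X * m + n"
          by (simp add: power2_eq_square)
        also have "(Y X)\<^sup>2 * l = G + Y X * m - X * n" using p by simp
        also have "- (2 * \<kappa>) * (G + Y X * m - X * n) + \<kappa> * Y X * m + n
          = - 2 * (\<kappa> * G) + ((1 + 2 * \<kappa> * X) * n - \<kappa> * Y X * m)" by (simp add: algebra_simps)
        also have "\<dots> \<ge> - 2 * G"
        proof -
          have "\<kappa> * G \<le> G" using \<kappa> G by (simp add: mult_left_le_one_le)
          then show ?thesis using km by linarith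
        qed
        finally show ?thesis by (simp add: l_def m_def n_def)
      qed
      have "(\<Sum>k\<in>V. - 2 * G) \<le> (\<Sum>k\<in>V. 2 * Y X * (- \<kappa> * Y X) * signed_regular_vertex.LL A V k X (Y X)
          - (- \<kappa> * Y X) * signed_regular_vertex.NN A V k X (Y X) + signed_regular_vertex.EE A V k X (Y X))"
        by (rule sum_mono) (rule lower)
      then show "\<exists>g'. ((\<lambda>X. pX X (Y X)) has_real_derivative g') (at X) \<and> g' \<ge> - (2 * real (card V)) * pX X (Y X)"
        using pX_DERIV[OF dY] by (intro exI conjI) (auto simp: G_def mult_ac)
    qed
    then show False using y1 y1Y by simp
  qed
qed

end

section \<open>Relaxation of the edge signs\<close>

lemma mdet_zero_column:
  assumes S: "finite S" and b: "b \<in> S" and z: "\<And>i. i \<in> S \<Longrightarrow> M i b = 0"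
  shows "mdet S M = 0"
  unfolding mdet_def
proof (rule sum.neutral, rule ballI)
  fix p assume "p \<in> {p. p permutes S}"
  then have "p ` S = S" by (auto simp: permutes_image)
  then obtain i where "i \<in> S" "p i = b" using b by (metis imageE)
  then have "(\<Prod>i\<in>S. M i (p i)) = 0" using S z by (intro prod_zero) auto
  then show "of_int (sign p) * (\<Prod>i\<in>S. M i (p i)) = 0" by simp
qed

text \<open>Every permutation uses exactly one entry of column \<open>b\<close>.\<close>

lemma mdet_column_affine:
  fixes M :: "nat \<Rightarrow> nat \<Rightarrow> 'a :: comm_ring_1"
  assumes S: "finite S" and b: "b \<in> S"
  shows "mdet S (\<lambda>i j. if j = b then v i + x * u i else M i j)
    = mdet S (\<lambda>i j. if j = b then v i else M i j) + x * mdet S (\<lambda>i j. if j = b then u i else M i j)"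
proof -
  have "(\<Prod>i\<in>S. if p i = b then v i + x * u i else M i (p i))
    = (\<Prod>i\<in>S. if p i = b then v i else M i (p i)) + x * (\<Prod>i\<in>S. if p i = b then u i else M i (p i))"
    if p: "p permutes S" for p
  proof -
    obtain i where i: "i \<in> S" "p i = b" using b permutes_image[OF p] by (metis imageE)
    have "(\<Prod>j\<in>S - {i}. if p j = b then g j else M j (p j)) = (\<Prod>j\<in>S - {i}. M j (p j))" for g
    proof (rule prod.cong[OF refl])
      fix j assume "j \<in> S - {i}"
      then have "p j \<noteq> b" using i(2) permutes_inj[OF p] by (metis DiffD2 injD singletonI)
      then show "(if p j = b then g j else M j (p j)) = M j (p j)" by simp
    qed
    then show ?thesis unfolding prod.remove[OF S i(1)] using i by (simp add: algebra_simps)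
  qed
  then have "mdet S (\<lambda>i j. if j = b then v i + x * u i else M i j) = (\<Sum>p | p permutes S.
      of_int (sign p) * (\<Prod>i\<in>S. if p i = b then v i else M i (p i)) + x * (of_int (sign p) * (\<Prod>i\<in>S. if p i = b then u i else M i (p i))))"
    unfolding mdet_def by (intro sum.cong refl) (simp add: algebra_simps)
  then show ?thesis by (simp only: mdet_def sum.distrib sum_distrib_left)
qed

lemma mdet_unit_column:
  assumes S: "finite S" and b: "b \<notin> S"
  shows "mdet (insert b S) (\<lambda>i j. if j = b then of_bool (i = b) else M i j) = mdet S M"
proof -
  have "mdet S (\<lambda>i j. if j = c then (if b = b then of_bool (i = b) else M i b) else (if j = b then of_bool (i = b) else M i j)) = 0"
    if "c \<in> S" for c
    by (rule mdet_zero_column[OF S that]) (use b in auto)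
  moreover have "mdet S (\<lambda>i j. if j = b then of_bool (i = b) else M i j) = mdet S M"
    using b by (intro mdet_cong) auto
  ultimately show ?thesis unfolding mdet_insert[OF S b] by simp
qed

definition upd :: "(nat \<Rightarrow> nat \<Rightarrow> real) \<Rightarrow> nat set \<Rightarrow> real \<Rightarrow> nat \<Rightarrow> nat \<Rightarrow> real" where
  "upd B e x = (\<lambda>i j. if {i, j} = e then x else B i j)"

text \<open>
  The quadratic term comes from the permutations that exchange the two ends of the edge.
\<close>

lemma mdet_edge:
  fixes B :: "nat \<Rightarrow> nat \<Rightarrow> real"
  assumes S: "finite S" "a \<notin> S" "b \<notin> S" "a \<noteq> b"
  obtains K L where "\<And>x. mdet (insert a (insert b S)) (\<lambda>i j. r * upd B {a, b} x i j) = K + x * L - (r * x)\<^sup>2 * mdet S (\<lambda>i j. r * B i j)"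
proof -
  have fS: "finite (insert b S)" "a \<notin> insert b S" using S by auto
  define M where "M i j = r * B i j" for i j
  define C where "C j = mdet (insert b S) (\<lambda>i l. if l = j then (if i = b then 0 else M i a) else M i l)" for j
  define C' where "C' j = mdet (insert b S) (\<lambda>i l. if l = j then r * of_bool (i = b) else M i l)" for j
  have col: "mdet (insert b S) (\<lambda>i l. if l = j then r * upd B {a, b} x i a else r * upd B {a, b} x i l) = C j + x * C' j"
    if "j \<in> insert b S" for j x
  proof -
    have "mdet (insert b S) (\<lambda>i l. if l = j then r * upd B {a, b} x i a else r * upd B {a, b} x i l)
      = mdet (insert b S) (\<lambda>i l. if l = j then (if i = b then 0 else M i a) + x * (r * of_bool (i = b)) else M i l)"
      using S by (intro mdet_cong) (auto simp: upd_def M_def doubleton_eq_iff)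
    then show ?thesis unfolding mdet_column_affine[OF fS(1) that] C_def C'_def .
  qed
  \<comment> \<open>The source of the quadratic term: a column that is \<open>r\<close> times the
    unit vector at \<open>b\<close> collapses the determinant to the minor on
    \<open>S\<close>.\<close>
  have C'b: "C' b = r * mdet S M"
  proof -
    have "C' b = mdet (insert b S) (\<lambda>i l. if l = b then 0 + r * of_bool (i = b) else M i l)" unfolding C'_def add_0_left ..
    also have "\<dots> = mdet (insert b S) (\<lambda>i l. if l = b then 0 else M i l) + r * mdet S M"
      unfolding mdet_column_affine[OF fS(1) insertI1] mdet_unit_column[OF S(1,3)] ..
    also have "mdet (insert b S) (\<lambda>i l. if l = b then 0 else M i l) = 0"
      by (rule mdet_zero_column[OF fS(1) insertI1]) simp
    finally show ?thesis by simp
  qed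
  have "mdet (insert a (insert b S)) (\<lambda>i j. r * upd B {a, b} x i j)
      = (M a a * mdet (insert b S) M - (\<Sum>j\<in>S. M a j * C j)) + x * (- (\<Sum>j\<in>S. M a j * C' j) - r * C b) - (r * x)\<^sup>2 * mdet S M" for x
  proof -
    have "mdet (insert b S) (\<lambda>i j. r * upd B {a, b} x i j) = mdet (insert b S) M"
      using S by (intro mdet_cong) (auto simp: upd_def M_def doubleton_eq_iff)
    moreover have "(\<Sum>j\<in>insert b S. r * upd B {a, b} x a j * mdet (insert b S) (\<lambda>i l. if l = j then r * upd B {a, b} x i a else r * upd B {a, b} x i l))
      = r * x * (C b + x * C' b) + (\<Sum>j\<in>S. M a j * C j + x * (M a j * C' j))"
    proof -
      have "(\<Sum>j\<in>S. r * upd B {a, b} x a j * mdet (insert b S) (\<lambda>i l. if l = j then r * upd B {a, b} x i a else r * upd B {a, b} x i l))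
        = (\<Sum>j\<in>S. M a j * C j + x * (M a j * C' j))"
      proof (rule sum.cong[OF refl])
        fix j assume j: "j \<in> S"
        then have "{a, j} \<noteq> {a, b}" using S(3) by (auto simp: doubleton_eq_iff)
        then have "r * upd B {a, b} x a j = M a j" by (simp add: upd_def M_def)
        then show "r * upd B {a, b} x a j * mdet (insert b S) (\<lambda>i l. if l = j then r * upd B {a, b} x i a else r * upd B {a, b} x i l)
          = M a j * C j + x * (M a j * C' j)"
          unfolding col[OF insertI2[OF j]] by (simp add: algebra_simps)
      qed
      moreover have "r * upd B {a, b} x a b = r * x" by (simp add: upd_def)
      ultimately show ?thesis using S(1,3) by (simp add: col)
    qed
    moreover have "r * upd B {a, b} x a a = M a a" using S(4) by (auto simp: upd_def M_def doubleton_eq_iff)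
    ultimately show ?thesis
      unfolding mdet_insert[OF fS] by (simp add: C'b sum.distrib sum_distrib_left algebra_simps power2_eq_square)
  qed
  then show ?thesis unfolding M_def[abs_def] by (rule that)
qed

text \<open>
  The factors \<open>-1\<close> and \<open>1\<close> let lemmas about \<open>r * B\<close> cover both families of minors.
\<close>

abbreviation minor_neg :: "(nat \<Rightarrow> nat \<Rightarrow> real) \<Rightarrow> nat set \<Rightarrow> real" where "minor_neg B I \<equiv> mdet I (\<lambda>i j. (- 1) * B i j)"
abbreviation minor_pos :: "(nat \<Rightarrow> nat \<Rightarrow> real) \<Rightarrow> nat set \<Rightarrow> real" where "minor_pos B I \<equiv> mdet I (\<lambda>i j. 1 * B i j)"

text \<open>Weight 0 on the intersection keeps only disjoint pairs. For \<open>n\<close> vertices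
  and constant \<open>y\<close> the value is \<open>2 ^ n\<close> times the mixed determinantal
  polynomial of \<open>B\<close> and \<open>- B\<close> at \<open>y / 2\<close>.\<close>

definition disjoint_sum :: "(nat \<Rightarrow> nat \<Rightarrow> real) \<Rightarrow> nat set \<Rightarrow> (nat \<Rightarrow> 'a) \<Rightarrow> 'a :: real_field" where
  "disjoint_sum B V y = pair_sum (minor_neg B) (minor_pos B) V y (\<lambda>_. 1) (\<lambda>_. 1) (\<lambda>_. 0)"

lemma pair_sum_cong_coeff:
  assumes "\<And>I. I \<subseteq> V \<Longrightarrow> c I = d I" "\<And>I. I \<subseteq> V \<Longrightarrow> c' I = d' I"
  shows "pair_sum c c' V n a b m = pair_sum d d' V n a b m"
  unfolding pair_sum_def using assms by (intro sum.cong refl) auto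

lemma pair_sum_linear1: "pair_sum (\<lambda>I. f I + r * g I - s * h I) c' V n a b m
    = pair_sum f c' V n a b m + of_real r * pair_sum g c' V n a b m - of_real s * pair_sum h c' V n a b m"
  unfolding pair_sum_def sum_distrib_left sum.distrib[symmetric] sum_subtractf[symmetric]
  by (intro sum.cong refl) (simp add: algebra_simps)

lemma pair_sum_linear2: "pair_sum c (\<lambda>I. f I + r * g I - s * h I) V n a b m
    = pair_sum c f V n a b m + of_real r * pair_sum c g V n a b m - of_real s * pair_sum c h V n a b m"
  unfolding pair_sum_def sum_distrib_left sum.distrib[symmetric] sum_subtractf[symmetric]
  by (intro sum.cong refl) (simp add: algebra_simps)

lemma upd_outside: "\<not> e \<subseteq> I \<Longrightarrow> i \<in> I \<Longrightarrow> j \<in> I \<Longrightarrow> upd B e x i j = B i j"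
  by (auto simp: upd_def)

lemma disjoint_sum_cong_B: "(\<And>i j. i \<in> V \<Longrightarrow> j \<in> V \<Longrightarrow> B i j = B' i j) \<Longrightarrow> disjoint_sum B V y = disjoint_sum B' V y"
  unfolding disjoint_sum_def by (intro pair_sum_cong_coeff mdet_cong) auto

text \<open>Disjoint \<open>I\<close> and \<open>J\<close> cannot both contain \<open>e\<close>, so
  at most one minor in a product depends on \<open>x\<close>. The quadratic parts from
  \<open>e \<subseteq> I\<close> and from \<open>e \<subseteq> J\<close> both carry the sign of
  \<open>- x^2\<close>, since the factors \<open>-1\<close> and \<open>1\<close> are squared; this
  produces the 2.\<close>

lemma disjoint_sum_edge:
  fixes y :: "nat \<Rightarrow> 'a :: real_field"
  assumes V: "finite V" and e: "card e = 2"
  obtains K L where "\<And>x. disjoint_sum (upd B e x) V y = K + of_real x * L - of_real (2 * x\<^sup>2) * (if e \<subseteq> V then disjoint_sum B (V - e) y else 0)"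
proof (cases "e \<subseteq> V")
  case False
  then have "disjoint_sum (upd B e x) V y = disjoint_sum B V y" for x
    by (intro disjoint_sum_cong_B) (auto intro: upd_outside)
  with False show ?thesis by (intro that[of "disjoint_sum B V y" 0]) simp
next
  case True
  obtain a b where ab: "e = {a, b}" "a \<noteq> b" using e by (meson card_2_iff)
  define U where "U = V - e"
  have U: "finite U" "a \<notin> U" "b \<notin> U" "V = insert a (insert b U)" using V True ab by (auto simp: U_def)
  have fU: "finite (insert b U)" "a \<notin> insert b U" using U ab by auto
  define pr where "pr r I KL \<longleftrightarrow> (\<forall>x. mdet (insert a (insert b I)) (\<lambda>i j. r * upd B e x i j)
      = fst KL + x * snd KL - (r * x)\<^sup>2 * mdet I (\<lambda>i j. r * B i j))" for r I KL
  have ex: "\<exists>KL. pr r I KL" if I: "I \<subseteq> U" for I r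
  proof -
    have I': "finite I" "a \<notin> I" "b \<notin> I" using I U finite_subset by auto
    show ?thesis
    proof (rule mdet_edge[OF I' ab(2), of r B])
      fix K L assume "\<And>x. mdet (insert a (insert b I)) (\<lambda>i j. r * upd B {a, b} x i j) = K + x * L - (r * x)\<^sup>2 * mdet I (\<lambda>i j. r * B i j)"
      then have "pr r I (K, L)" unfolding pr_def ab(1) fst_conv snd_conv by (intro allI)
      then show ?thesis ..
    qed
  qed
  \<comment> \<open>The coefficients are chosen as functions of \<open>I\<close> so that they can
    serve as coefficient functions of a \<open>pair_sum\<close> over \<open>U\<close>.\<close>
  define P where "P I = (SOME KL. pr (- 1) I KL)" for I
  define Q where "Q I = (SOME KL. pr 1 I KL)" for I
  have P: "minor_neg (upd B e x) (insert a (insert b I)) = fst (P I) + x * snd (P I) - x\<^sup>2 * minor_neg B I" if "I \<subseteq> U" for I x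
  proof -
    have "pr (- 1) I (P I)" unfolding P_def by (rule someI_ex[OF ex[OF that]])
    then have "minor_neg (upd B e x) (insert a (insert b I)) = fst (P I) + x * snd (P I) - (- 1 * x)\<^sup>2 * minor_neg B I"
      unfolding pr_def by (rule spec)
    then show ?thesis unfolding power_mult_distrib by (simp only: power2_minus power_one mult_1)
  qed
  have Q: "minor_pos (upd B e x) (insert a (insert b I)) = fst (Q I) + x * snd (Q I) - x\<^sup>2 * minor_pos B I" if "I \<subseteq> U" for I x
  proof -
    have "pr 1 I (Q I)" unfolding Q_def by (rule someI_ex[OF ex[OF that]])
    then have "minor_pos (upd B e x) (insert a (insert b I)) = fst (Q I) + x * snd (Q I) - (1 * x)\<^sup>2 * minor_pos B I"
      unfolding pr_def by (rule spec)
    then show ?thesis by (simp only: mult_1)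
  qed
  have other: "mdet I (\<lambda>i j. r * upd B e x i j) = mdet I (\<lambda>i j. r * B i j)" if "\<not> e \<subseteq> I" for I r x
    by (rule mdet_cong) (use upd_outside[OF that] in auto)
  have ne: "\<not> e \<subseteq> I" "\<not> e \<subseteq> insert a I" "\<not> e \<subseteq> insert b I" if "I \<subseteq> U" for I using that U ab by auto
  note exp = pair_sum_insert[OF fU] pair_sum_insert[OF U(1,3)]
  define z :: "(nat set \<Rightarrow> real) \<Rightarrow> (nat set \<Rightarrow> real) \<Rightarrow> 'a" where "z f g = pair_sum f g U y (\<lambda>_. 1) (\<lambda>_. 1) (\<lambda>_. 0)" for f g
  have T: "disjoint_sum C V y = y a * (y b * z (minor_neg C) (minor_pos C) + z (\<lambda>I. minor_neg C (insert b I)) (minor_pos C) + z (minor_neg C) (\<lambda>I. minor_pos C (insert b I)))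
    + (y b * z (\<lambda>I. minor_neg C (insert a I)) (minor_pos C) + z (\<lambda>I. minor_neg C (insert a (insert b I))) (minor_pos C) + z (\<lambda>I. minor_neg C (insert a I)) (\<lambda>I. minor_pos C (insert b I)))
    + (y b * z (minor_neg C) (\<lambda>I. minor_pos C (insert a I)) + z (\<lambda>I. minor_neg C (insert b I)) (\<lambda>I. minor_pos C (insert a I)) + z (minor_neg C) (\<lambda>I. minor_pos C (insert a (insert b I))))" for C
    unfolding disjoint_sum_def U(4) exp z_def by simp
  have zc: "z f g = z f' g'" if "\<And>I. I \<subseteq> U \<Longrightarrow> f I = f' I" "\<And>I. I \<subseteq> U \<Longrightarrow> g I = g' I" for f g f' g'
    unfolding z_def by (rule pair_sum_cong_coeff) (use that in auto)
  have z1: "z (minor_neg (upd B e x)) (minor_pos (upd B e x)) = z (minor_neg B) (minor_pos B)"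
    "z (\<lambda>I. minor_neg (upd B e x) (insert b I)) (minor_pos (upd B e x)) = z (\<lambda>I. minor_neg B (insert b I)) (minor_pos B)"
    "z (minor_neg (upd B e x)) (\<lambda>I. minor_pos (upd B e x) (insert b I)) = z (minor_neg B) (\<lambda>I. minor_pos B (insert b I))"
    "z (\<lambda>I. minor_neg (upd B e x) (insert a I)) (minor_pos (upd B e x)) = z (\<lambda>I. minor_neg B (insert a I)) (minor_pos B)"
    "z (minor_neg (upd B e x)) (\<lambda>I. minor_pos (upd B e x) (insert a I)) = z (minor_neg B) (\<lambda>I. minor_pos B (insert a I))"
    "z (\<lambda>I. minor_neg (upd B e x) (insert a I)) (\<lambda>I. minor_pos (upd B e x) (insert b I)) = z (\<lambda>I. minor_neg B (insert a I)) (\<lambda>I. minor_pos B (insert b I))"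
    "z (\<lambda>I. minor_neg (upd B e x) (insert b I)) (\<lambda>I. minor_pos (upd B e x) (insert a I)) = z (\<lambda>I. minor_neg B (insert b I)) (\<lambda>I. minor_pos B (insert a I))" for x
    by (intro zc other ne; assumption)+
  have z2: "z (\<lambda>I. minor_neg (upd B e x) (insert a (insert b I))) (minor_pos (upd B e x))
      = z (\<lambda>I. fst (P I)) (minor_pos B) + of_real x * z (\<lambda>I. snd (P I)) (minor_pos B) - of_real (x\<^sup>2) * z (minor_neg B) (minor_pos B)" for x
    unfolding z_def pair_sum_linear1[where r = x and s = "x\<^sup>2", symmetric]
    by (rule pair_sum_cong_coeff) (simp_all only: P other[OF ne(1)])
  have z3: "z (minor_neg (upd B e x)) (\<lambda>I. minor_pos (upd B e x) (insert a (insert b I)))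
      = z (minor_neg B) (\<lambda>I. fst (Q I)) + of_real x * z (minor_neg B) (\<lambda>I. snd (Q I)) - of_real (x\<^sup>2) * z (minor_neg B) (minor_pos B)" for x
    unfolding z_def pair_sum_linear2[where r = x and s = "x\<^sup>2", symmetric]
    by (rule pair_sum_cong_coeff) (simp_all only: Q other[OF ne(1)])
  have z0: "disjoint_sum B (V - e) y = z (minor_neg B) (minor_pos B)" by (simp add: disjoint_sum_def z_def U_def)
  define K where "K = y a * (y b * z (minor_neg B) (minor_pos B) + z (\<lambda>I. minor_neg B (insert b I)) (minor_pos B) + z (minor_neg B) (\<lambda>I. minor_pos B (insert b I)))
    + (y b * z (\<lambda>I. minor_neg B (insert a I)) (minor_pos B) + z (\<lambda>I. fst (P I)) (minor_pos B) + z (\<lambda>I. minor_neg B (insert a I)) (\<lambda>I. minor_pos B (insert b I)))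
    + (y b * z (minor_neg B) (\<lambda>I. minor_pos B (insert a I)) + z (\<lambda>I. minor_neg B (insert b I)) (\<lambda>I. minor_pos B (insert a I)) + z (minor_neg B) (\<lambda>I. fst (Q I)))"
  define L where "L = z (\<lambda>I. snd (P I)) (minor_pos B) + z (minor_neg B) (\<lambda>I. snd (Q I))"
  have "disjoint_sum (upd B e x) V y = K + of_real x * L - of_real (2 * x\<^sup>2) * z (minor_neg B) (minor_pos B)" for x
    unfolding T z1 z2 z3 K_def L_def of_real_mult[of 2] of_real_numeral by (simp only: ring_distribs) simp
  then show ?thesis unfolding z0[symmetric] by (intro that[of K L]) (simp only: if_P[OF True])
qed

text \<open>
  The edges in the list are not decided yet: a pending edge \<open>e\<close> of value \<open>x\<close> enters with the weight
  \<open>w e = 2 (1 - x\<^sup>2)\<close>, which cancels the quadratic term of \<open>disjoint_sum_edge\<close>.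
\<close>

fun relaxed_sum :: "(nat \<Rightarrow> nat \<Rightarrow> real) \<Rightarrow> (nat set \<Rightarrow> real) \<Rightarrow> nat set \<Rightarrow> nat set list \<Rightarrow> (nat \<Rightarrow> 'a) \<Rightarrow> 'a :: real_field" where
  "relaxed_sum B w V [] y = disjoint_sum B V y"
| "relaxed_sum B w V (e # es) y = relaxed_sum B w V es y - of_real (w e) * (if e \<subseteq> V then relaxed_sum B w (V - e) es y else 0)"

lemma relaxed_sum_cong_y: "(\<And>i. i \<in> V \<Longrightarrow> y i = y' i) \<Longrightarrow> relaxed_sum B w V es y = relaxed_sum B w V es y'"
proof (induction es arbitrary: V)
  case Nil
  then show ?case unfolding relaxed_sum.simps disjoint_sum_def by (intro pair_sum_cong) auto
next
  case (Cons e es)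
  have "relaxed_sum B w V es y = relaxed_sum B w V es y'" "relaxed_sum B w (V - e) es y = relaxed_sum B w (V - e) es y'"
    by (rule Cons.IH; use Cons.prems in simp)+
  then show ?case by simp
qed

lemma relaxed_sum_cong_B:
  "(\<And>i j. i \<in> V \<Longrightarrow> j \<in> V \<Longrightarrow> B i j = B' i j) \<Longrightarrow> (\<And>e. e \<in> set es \<Longrightarrow> w e = w' e) \<Longrightarrow> relaxed_sum B w V es y = relaxed_sum B' w' V es y"
proof (induction es arbitrary: V)
  case Nil
  then show ?case unfolding relaxed_sum.simps by (intro disjoint_sum_cong_B) auto
next
  case (Cons e es)
  have "relaxed_sum B w V es y = relaxed_sum B' w' V es y" "relaxed_sum B w (V - e) es y = relaxed_sum B' w' (V - e) es y"
    by (rule Cons.IH; use Cons.prems in simp)+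
  moreover have "w e = w' e" using Cons.prems(2) by simp
  ultimately show ?case by simp
qed

lemma relaxed_sum_of_real: "relaxed_sum B w V es (\<lambda>i. of_real (y i)) = of_real (relaxed_sum B w V es y)"
proof (induction es arbitrary: V)
  case Nil
  then show ?case
    unfolding relaxed_sum.simps disjoint_sum_def pair_sum_of_real[symmetric] of_real_1 of_real_0 ..
qed simp

lemma relaxed_sum_cnj: "relaxed_sum B w V es (\<lambda>i. cnj (y i)) = cnj (relaxed_sum B w V es y)"
proof (induction es arbitrary: V)
  case Nil
  have "pair_wt (\<lambda>i. cnj (y i)) (\<lambda>_. 1) (\<lambda>_. 1) (\<lambda>_. 0) I J i = cnj (pair_wt y (\<lambda>_. 1) (\<lambda>_. 1) (\<lambda>_. 0) I J i)" for I J i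
    by (simp add: pair_wt_def)
  then show ?case unfolding relaxed_sum.simps disjoint_sum_def pair_sum_def by simp
qed simp

lemma relaxed_sum_holomorphic: "(\<lambda>z. relaxed_sum B w V es (\<lambda>_. z)) holomorphic_on S"
proof (induction es arbitrary: V)
  case Nil
  have "(\<lambda>z::complex. pair_wt (\<lambda>_. z) (\<lambda>_. 1) (\<lambda>_. 1) (\<lambda>_. 0) I J i) holomorphic_on S" for I J i
    by (cases "i \<in> I"; cases "i \<in> J") (auto simp: pair_wt_def intro!: holomorphic_intros)
  then show ?case unfolding relaxed_sum.simps disjoint_sum_def pair_sum_def by (intro holomorphic_intros)
next
  case (Cons e es)
  show ?case by (cases "e \<subseteq> V") (auto intro!: holomorphic_intros Cons.IH)
qed

lemma disjoint_sum_limit: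
  assumes "finite V"
  shows "((\<lambda>y. pair_sum c c' V (\<lambda>_. y) (\<lambda>_. 1) (\<lambda>_. 1) (\<lambda>_. 0) / y ^ card V) \<longlongrightarrow> c {} * c' {}) (at_top :: real filter)"
  using assms
proof (induction V arbitrary: c c' rule: finite_induct)
  case empty
  then show ?case by (simp add: pair_sum_def)
next
  case (insert k U)
  let ?F = "\<lambda>c c' y. pair_sum c c' U (\<lambda>_. y) (\<lambda>_. 1) (\<lambda>_. 1) (\<lambda>_. 0) :: real"
  have "((\<lambda>y. ?F c c' y / y ^ card U + (?F (\<lambda>I. c (insert k I)) c' y / y ^ card U) * inverse y
      + (?F c (\<lambda>I. c' (insert k I)) y / y ^ card U) * inverse y) \<longlongrightarrow> c {} * c' {} + c (insert k {}) * c' {} * 0 + c {} * c' (insert k {}) * 0) at_top"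
    by (intro tendsto_intros insert.IH tendsto_inverse_0_at_top filterlim_ident)
  moreover have "\<forall>\<^sub>F y in at_top. ?F c c' y / y ^ card U + (?F (\<lambda>I. c (insert k I)) c' y / y ^ card U) * inverse y
      + (?F c (\<lambda>I. c' (insert k I)) y / y ^ card U) * inverse y
      = pair_sum c c' (insert k U) (\<lambda>_. y) (\<lambda>_. 1) (\<lambda>_. 1) (\<lambda>_. 0) / y ^ card (insert k U)"
    using eventually_gt_at_top[of 0]
    by eventually_elim (simp add: pair_sum_insert[OF insert.hyps] insert.hyps field_simps)
  ultimately show ?case by (simp add: tendsto_cong)
qed

lemma relaxed_sum_limit:
  assumes "finite V" "\<forall>e\<in>set es. card e = 2"
  shows "((\<lambda>y. relaxed_sum B w V es (\<lambda>_. y) / y ^ card V) \<longlongrightarrow> 1) (at_top :: real filter)"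
  using assms
proof (induction es arbitrary: V)
  case Nil
  then show ?case using disjoint_sum_limit[OF Nil(1), of "minor_neg B" "minor_pos B"] by (simp add: disjoint_sum_def)
next
  case (Cons e es)
  note IH = Cons.IH[OF Cons.prems(1)]
  show ?case
  proof (cases "e \<subseteq> V")
    case True
    have "finite e" using True Cons.prems(1) finite_subset by blast
    then have c: "card V = Suc (Suc (card (V - e)))"
      using True Cons.prems card_Diff_subset[of e V] card_mono[of V e] by auto
    have "((\<lambda>y. relaxed_sum B w V es (\<lambda>_. y) / y ^ card V - w e * (relaxed_sum B w (V - e) es (\<lambda>_. y) / y ^ card (V - e) * (inverse y * inverse y)))
        \<longlongrightarrow> 1 - w e * (1 * (0 * 0))) at_top"
      using Cons.prems by (intro tendsto_intros Cons.IH tendsto_inverse_0_at_top filterlim_ident) auto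
    moreover have "\<forall>\<^sub>F y in at_top. relaxed_sum B w V es (\<lambda>_. y) / y ^ card V - w e * (relaxed_sum B w (V - e) es (\<lambda>_. y) / y ^ card (V - e) * (inverse y * inverse y))
      = relaxed_sum B w V (e # es) (\<lambda>_. y) / y ^ card V"
      using eventually_gt_at_top[of 0] by eventually_elim (simp add: c True field_simps)
    ultimately show ?thesis by (simp add: tendsto_cong)
  qed (use IH Cons.prems in simp)
qed

lemma relaxed_sum_eventually_pos:
  assumes "finite V" "\<forall>e\<in>set es. card e = 2"
  shows "\<forall>\<^sub>F y in at_top. relaxed_sum B w V es (\<lambda>_. y) > (0 :: real)"
  by (rule limit_eventually_pos[where s = 0 and m = "card V" and e = 1]) (use relaxed_sum_limit[OF assms] in simp_all)

text \<open>Matching away an edge through \<open>b\<close> removes the variable \<open>y b\<close>,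
  so such terms are constant in it; the coefficient of \<open>y b\<close> is the relaxed sum without
  the vertex \<open>b\<close>.\<close>

lemma relaxed_sum_affine:
  assumes "finite V" "b \<in> V" "\<forall>e\<in>set es. card e = 2"
  shows "\<exists>\<beta>. \<forall>s. relaxed_sum B w V es (y(b := s)) = s * relaxed_sum B w (V - {b}) es y + \<beta>"
  using assms
proof (induction es arbitrary: V)
  case Nil
  have U: "finite (V - {b})" "b \<notin> V - {b}" "V = insert b (V - {b})" using Nil by auto
  have "relaxed_sum B w V [] (y(b := s)) = s * relaxed_sum B w (V - {b}) [] y + (pair_sum (\<lambda>I. minor_neg B (insert b I)) (minor_pos B) (V - {b}) y (\<lambda>_. 1) (\<lambda>_. 1) (\<lambda>_. 0)
      + pair_sum (minor_neg B) (\<lambda>I. minor_pos B (insert b I)) (V - {b}) y (\<lambda>_. 1) (\<lambda>_. 1) (\<lambda>_. 0))" for s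
  proof -
    have "pair_sum f g (V - {b}) (y(b := s)) (\<lambda>_. 1) (\<lambda>_. 1) (\<lambda>_. 0) = pair_sum f g (V - {b}) y (\<lambda>_. 1) (\<lambda>_. 1) (\<lambda>_. 0)" for f g
      by (rule pair_sum_cong) auto
    then show ?thesis
      using pair_sum_insert[OF U(1,2), of "minor_neg B" "minor_pos B" "y(b := s)" "\<lambda>_. 1" "\<lambda>_. 1" "\<lambda>_. 0"] U(3)
      by (simp add: disjoint_sum_def insert_absorb[OF Nil(2)])
  qed
  then show ?case by blast
next
  case (Cons e es)
  obtain \<beta> where \<beta>: "\<And>s. relaxed_sum B w V es (y(b := s)) = s * relaxed_sum B w (V - {b}) es y + \<beta>"
    using Cons.IH[of V] Cons.prems by (auto simp del: fun_upd_apply)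
  show ?case
  proof (cases "e \<subseteq> V")
    case False
    then have "\<not> e \<subseteq> V - {b}" by auto
    then show ?thesis using \<beta> False by (intro exI[of _ \<beta>]) (simp del: fun_upd_apply)
  next
    case eV: True
    show ?thesis
    proof (cases "b \<in> e")
      case True
      then have "relaxed_sum B w (V - e) es (y(b := s)) = relaxed_sum B w (V - e) es y" for s by (intro relaxed_sum_cong_y) auto
      moreover have "\<not> e \<subseteq> V - {b}" using True by auto
      ultimately show ?thesis using \<beta> eV by (intro exI[of _ "\<beta> - of_real (w e) * relaxed_sum B w (V - e) es y"]) (simp add: algebra_simps del: fun_upd_apply)
    next
      case False
      obtain \<gamma> where \<gamma>: "\<And>s. relaxed_sum B w (V - e) es (y(b := s)) = s * relaxed_sum B w (V - e - {b}) es y + \<gamma>"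
        using Cons.IH[of "V - e"] Cons.prems False by (auto simp del: fun_upd_apply)
      have "V - e - {b} = V - {b} - e" "e \<subseteq> V - {b}" using eV False by auto
      then show ?thesis using \<beta> \<gamma> eV by (intro exI[of _ "\<beta> - of_real (w e) * \<gamma>"]) (simp add: algebra_simps del: fun_upd_apply)
    qed
  qed
qed

lemma disjoint_sum_nonzero:
  fixes y :: "nat \<Rightarrow> complex"
  assumes V: "finite V" and sym: "\<And>i j. B i j = B j i" and diag: "\<And>i. B i i = 0" and y: "\<And>i. i \<in> V \<Longrightarrow> Im (y i) > 0"
  shows "disjoint_sum B V y \<noteq> 0"
proof -
  have nz: "subset_poly (\<lambda>I. mdet I (\<lambda>i j. r * B i j)) U x \<noteq> 0"
    if U: "U \<subseteq> V" and x: "\<And>i. i \<in> U \<Longrightarrow> Im (x i) > 0" for U r and x :: "nat \<Rightarrow> complex"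
  proof -
    have fU: "finite U" using U V finite_subset by blast
    \<comment> \<open>\<open>mdet_stable\<close> also constrains the variable at its distinguished
      index 0, which may lie outside \<open>U\<close>; hence the default value
      \<open>\<i>\<close>.\<close>
    define x' where "x' i = (if i \<in> U then x i else \<i>)" for i
    have x': "Im (x' i) > 0" for i using x by (simp add: x'_def)
    have "subset_poly (\<lambda>I. mdet I (\<lambda>i j. r * B i j)) U x = mdet U (\<lambda>i j. (if i = j then x i else 0) + complex_of_real (r * B i j))"
      unfolding mdet_diag_expand[OF fU] subset_poly_def mdet_of_real ..
    also have "\<dots> = mdet U (\<lambda>i j. (if i = j then x' i else 0) + complex_of_real (r * B i j))"
      by (rule mdet_cong) (auto simp: x'_def)
    also have "\<dots> \<noteq> 0"
    proof (rule mdet_stable[OF fU, where k = 0])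
      show "r * B i j = r * B j i" for i j using sym by simp
      show "x' 0 + complex_of_real (r * B 0 0) \<noteq> 0 \<or> (\<exists>j\<in>U. j \<noteq> 0 \<and> r * B j 0 \<noteq> 0)"
        using x'[of 0] by (auto simp: diag)
    qed (use x' in \<open>auto intro: less_imp_le\<close>)
    finally show ?thesis .
  qed
  have "pair_sum (minor_neg B) (minor_pos B) V (\<lambda>i. if i \<in> V then y i else y i * y i) (\<lambda>i. if i \<in> V then 1 else y i)
    (\<lambda>i. if i \<in> V then 1 else y i) (\<lambda>i. if i \<in> V then 0 else 1) \<noteq> 0"
  proof (rule pair_sum_stable_0[OF V subset_refl])
    show "pair_sum (minor_neg B) (minor_pos B) U (\<lambda>i. x i * y i) y x (\<lambda>_. 1) \<noteq> 0"
      if "U \<subseteq> V" "\<And>i. i \<in> U \<Longrightarrow> Im (x i) > 0 \<and> Im (y i) > 0" for U and x y :: "nat \<Rightarrow> complex"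
      unfolding pair_sum_product[OF finite_subset[OF that(1) V]]
      using nz[OF that(1), of x "- 1"] nz[OF that(1), of y 1] that(2) by auto
  qed (use y in auto)
  moreover have "pair_sum (minor_neg B) (minor_pos B) V (\<lambda>i. if i \<in> V then y i else y i * y i) (\<lambda>i. if i \<in> V then 1 else y i)
    (\<lambda>i. if i \<in> V then 1 else y i) (\<lambda>i. if i \<in> V then 0 else 1) = disjoint_sum B V y"
    unfolding disjoint_sum_def by (rule pair_sum_cong) auto
  ultimately show ?thesis by simp
qed

text \<open>The Heilmann-Lieb mechanism: subtracting \<open>w e\<close> times the mixed second
  derivative preserves stability for \<open>w e \<ge> 0\<close>. With the sum
  \<open>y b * \<alpha> + \<beta>\<close> and \<open>d\<close> the coefficient of \<open>y a\<close>
  in \<open>\<alpha>\<close>, stability of the smaller sums gives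
  \<open>Im (\<alpha> / d) > 0\<close> and \<open>Im (\<beta> / \<alpha>) \<ge> 0\<close>. A zero
  would then force \<open>y b = w e * d / \<alpha> - \<beta> / \<alpha>\<close> out of the upper
  half-plane.\<close>

lemma relaxed_sum_nonzero:
  fixes y :: "nat \<Rightarrow> complex"
  assumes "finite V" and sym: "\<And>i j. B i j = B j i" and diag: "\<And>i. B i i = 0"
    and w: "\<And>e. w e \<ge> 0" and "\<forall>e\<in>set es. card e = 2" and "\<And>i. i \<in> V \<Longrightarrow> Im (y i) > 0"
  shows "relaxed_sum B w V es y \<noteq> 0"
  using assms(1,5,6)
proof (induction es arbitrary: V y)
  case Nil
  then show ?case using disjoint_sum_nonzero[OF Nil(1) sym diag, of y] by simp
next
  case (Cons e es)
  note prems = Cons.prems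
  have es: "\<forall>e\<in>set es. card e = 2" using prems by simp
  show ?case
  proof (cases "e \<subseteq> V")
    case False
    then show ?thesis using Cons.IH[OF prems(1) es prems(3)] by simp
  next
    case True
    obtain a b where ab: "e = {a, b}" "a \<noteq> b" using prems(2) by (auto simp: card_2_iff)
    have abV: "a \<in> V" "b \<in> V" using True ab by auto
    define d where "d = relaxed_sum B w (V - e) es y"
    define \<alpha> where "\<alpha> = relaxed_sum B w (V - {b}) es y"
    have Vab: "V - {b} - {a} = V - e" using ab by auto
    obtain \<alpha>0 where \<alpha>0: "\<And>s. relaxed_sum B w (V - {b}) es (y(a := s)) = s * d + \<alpha>0"
      using relaxed_sum_affine[of "V - {b}" a es B w y] prems(1) es abV ab(2) unfolding Vab d_def by auto
    obtain \<beta> where \<beta>: "\<And>s. relaxed_sum B w V es (y(b := s)) = s * \<alpha> + \<beta>"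
      using relaxed_sum_affine[of V b es B w y] prems(1) es abV unfolding \<alpha>_def by auto
    have d: "d \<noteq> 0" unfolding d_def using prems by (intro Cons.IH) auto
    have \<alpha>: "\<alpha> = y a * d + \<alpha>0" using \<alpha>0[of "y a"] by (simp add: \<alpha>_def)
    have \<alpha>n: "s * d + \<alpha>0 \<noteq> 0" if "Im s > 0" for s
      unfolding \<alpha>0[symmetric] using prems that by (intro Cons.IH) auto
    have \<beta>n: "s * \<alpha> + \<beta> \<noteq> 0" if "Im s > 0" for s
      unfolding \<beta>[symmetric] using prems that by (intro Cons.IH) auto
    have "Im (\<alpha>0 / d) \<ge> 0"
    proof (rule ccontr)
      assume "\<not> ?thesis"
      then have "Im (- (\<alpha>0 / d)) > 0" by simp
      from \<alpha>n[OF this] show False using d by simp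
    qed
    then have ad: "Im (\<alpha> / d) > 0" using d prems(3)[OF abV(1)] by (simp add: \<alpha> add_divide_distrib)
    then have \<alpha>0': "\<alpha> \<noteq> 0" by auto
    have b: "Im (\<beta> / \<alpha>) \<ge> 0"
    proof (rule ccontr)
      assume "\<not> ?thesis"
      then have "Im (- (\<beta> / \<alpha>)) > 0" by simp
      from \<beta>n[OF this] show False using \<alpha>0' by simp
    qed
    have da: "Im (d / \<alpha>) < 0" using Im_inverse_neg[OF ad] by simp
    have "y b * \<alpha> + \<beta> - of_real (w e) * d \<noteq> 0"
    proof
      assume "y b * \<alpha> + \<beta> - of_real (w e) * d = 0"
      then have "y b * \<alpha> = of_real (w e) * d - \<beta>" by (simp add: algebra_simps)
      then have "y b = of_real (w e) * (d / \<alpha>) - \<beta> / \<alpha>" using \<alpha>0' by (simp add: field_simps)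
      moreover have "Im (of_real r * u) = r * Im u" for r u by simp
      ultimately have "Im (y b) = w e * Im (d / \<alpha>) - Im (\<beta> / \<alpha>)" by (simp only: minus_complex.simps)
      also have "\<dots> \<le> 0" using b da w[of e] mult_nonneg_nonpos[of "w e" "Im (d / \<alpha>)"] by simp
      finally show False using prems(3)[OF abV(2)] by simp
    qed
    moreover have "relaxed_sum B w V es y = y b * \<alpha> + \<beta>" using \<beta>[of "y b"] by simp
    ultimately show ?thesis using True by (simp add: d_def)
  qed
qed

section \<open>Choosing the signs\<close>

text \<open>Along the segment from \<open>F0\<close> to \<open>F1\<close> there are no nonreal
  zeros. A zero to the right of \<open>y0\<close> cannot arise from a complex pair, cannot enter
  through \<open>y0\<close>, where both ends are positive, and cannot come from infinity. At the
  first parameter with such a zero, Hurwitz's theorem gives the contradiction.\<close>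

lemma positivity_persists:
  fixes F0 F1 :: "complex \<Rightarrow> complex" and f0 f1 :: "real \<Rightarrow> real"
  assumes hol: "F0 holomorphic_on UNIV" "F1 holomorphic_on UNIV"
    and re: "\<And>x. F0 (of_real x) = of_real (f0 x)" "\<And>x. F1 (of_real x) = of_real (f1 x)"
    and cnj: "\<And>z. F0 (cnj z) = cnj (F0 z)" "\<And>z. F1 (cnj z) = cnj (F1 z)"
    and nz: "\<And>c z. 0 \<le> c \<Longrightarrow> c \<le> 1 \<Longrightarrow> Im z > 0 \<Longrightarrow> of_real (1 - c) * F0 z + of_real c * F1 z \<noteq> 0"
    and f0: "\<And>y. y \<ge> y0 \<Longrightarrow> f0 y > 0" and f1: "f1 y0 > 0" "\<forall>\<^sub>F y in at_top. f1 y > 0"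
    and y: "y \<ge> y0"
  shows "f1 y > 0"
proof (rule ccontr)
  assume "\<not> f1 y > 0"
  then have y': "f1 y \<le> 0" by simp
  have cont: "continuous_on S f0" "continuous_on S f1" for S
  proof -
    have c: "continuous_on S (\<lambda>x. Re (F (complex_of_real x)))" if "F holomorphic_on UNIV" for F
      using holomorphic_on_imp_continuous_on[OF that]
      by (intro continuous_intros continuous_on_compose2[of UNIV F S of_real]) auto
    show "continuous_on S f0" "continuous_on S f1" using c[OF hol(1)] c[OF hol(2)] by (simp_all add: re)
  qed
  obtain M where M: "\<And>t. t \<ge> M \<Longrightarrow> f1 t > 0" using f1(2) by (auto simp: eventually_at_top_linorder)
  define Z where "Z = {t \<in> {y0..max M y0}. f1 t \<le> 0}"
  have inZ: "t \<in> Z" if "t \<ge> y0" "f1 t \<le> 0" for t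
  proof -
    have "t < M" using M[of t] that by force
    then show ?thesis using that by (simp add: Z_def)
  qed
  have "closed {t. f1 t \<le> 0}" using cont(2)[of UNIV] by (intro closed_Collect_le continuous_intros)
  then have "compact ({y0..max M y0} \<inter> {t. f1 t \<le> 0})" by (intro compact_Int_closed) auto
  moreover have "{y0..max M y0} \<inter> {t. f1 t \<le> 0} = Z" by (auto simp: Z_def)
  ultimately have Z: "compact Z" by simp
  \<comment> \<open>The parameter at which the interpolation vanishes at \<open>t\<close>; its
    minimum over \<open>Z\<close> is the first parameter with a zero at or beyond
    \<open>y0\<close>.\<close>
  define \<kappa> where "\<kappa> t = f0 t / (f0 t - f1 t)" for t
  have den: "f0 t - f1 t > 0" "f0 t > 0" if "t \<in> Z" for t using that f0[of t] by (auto simp: Z_def)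
  have "continuous_on Z \<kappa>" unfolding \<kappa>_def using den by (intro continuous_intros cont) force
  moreover have "Z \<noteq> {}" using inZ[OF y y'] by auto
  ultimately obtain t1 where t1: "t1 \<in> Z" "\<And>t. t \<in> Z \<Longrightarrow> \<kappa> t1 \<le> \<kappa> t"
    using continuous_attains_inf[OF Z, of \<kappa>] by blast
  define c1 where "c1 = \<kappa> t1"
  have c1: "0 < c1" "c1 \<le> 1" using den[OF t1(1)] t1(1) by (auto simp: c1_def \<kappa>_def Z_def field_simps)
  have root: "(1 - c1) * f0 t1 + c1 * f1 t1 = 0"
    using den[OF t1(1)] by (simp add: c1_def \<kappa>_def field_simps)
  have "t1 \<noteq> y0" using t1(1) f1(1) by (auto simp: Z_def)
  then have t1y: "t1 > y0" using t1(1) by (auto simp: Z_def)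
  have pos: "(1 - c) * f0 t + c * f1 t > 0" if c: "0 \<le> c" "c < c1" and t: "t \<ge> y0" for c t
  proof (cases "f1 t > 0")
    case True
    then show ?thesis using c c1 f0[OF t] by (intro add_pos_nonneg mult_pos_pos mult_nonneg_nonneg) auto
  next
    case False
    then have tZ: "t \<in> Z" using inZ t by simp
    then have "c < \<kappa> t" using t1(2)[OF tZ] c by (simp add: c1_def)
    then show ?thesis using den[OF tZ] by (simp add: \<kappa>_def pos_less_divide_eq algebra_simps)
  qed
  define F where "F c z = of_real (1 - c) * F0 z + of_real c * F1 z" for c z
  have Fre: "F c (of_real x) = of_real ((1 - c) * f0 x + c * f1 x)" for c x by (simp add: F_def re)
  define S where "S = {z. Re z > y0}"
  \<comment> \<open>Parameters tending to \<open>c1\<close> from below, where the interpolations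
    have no zeros in the half-plane \<open>S\<close>.\<close>
  define \<sigma> where "\<sigma> n = c1 * (1 - 1 / real (Suc n))" for n
  have \<sigma>: "0 \<le> \<sigma> n" "\<sigma> n < c1" for n using c1(1) by (auto simp: \<sigma>_def field_simps)
  have holF: "F c holomorphic_on T" for c T
    unfolding F_def[abs_def] by (rule holomorphic_on_subset[of _ UNIV]) (intro holomorphic_intros hol, simp)
  have "F c1 (of_real t1) \<noteq> 0"
  proof (rule Hurwitz_no_zeros[of S "\<lambda>n. F (\<sigma> n)" "F c1"])
    show "open S" "connected S" unfolding S_def by (rule open_halfspace_Re_gt, rule convex_connected, rule convex_halfspace_Re_gt)
    show "uniform_limit K (\<lambda>n. F (\<sigma> n)) (F c1) sequentially" if K: "compact K" for K
    proof -
      have "compact ((\<lambda>z. F1 z - F0 z) ` K)"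
        by (rule compact_continuous_image[OF continuous_on_subset[OF holomorphic_on_imp_continuous_on[OF holomorphic_on_diff[OF hol(2,1)]]] K]) simp
      then have "bounded ((\<lambda>z. F1 z - F0 z) ` K)" by (rule compact_imp_bounded)
      then obtain b where b: "\<And>z. z \<in> K \<Longrightarrow> norm (F1 z - F0 z) \<le> b" by (auto simp: bounded_iff)
      show ?thesis
      proof (rule uniform_limitI)
        fix e :: real assume e: "e > 0"
        have "((\<lambda>n. c1 / real (Suc n) * \<bar>b\<bar>) \<longlongrightarrow> 0 * \<bar>b\<bar>) sequentially"
          by (rule tendsto_mult[OF LIMSEQ_Suc[OF lim_const_over_n] tendsto_const])
        then have "\<forall>\<^sub>F n in sequentially. c1 / real (Suc n) * \<bar>b\<bar> < e" using e by (intro order_tendstoD(2)) auto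
        then show "\<forall>\<^sub>F n in sequentially. \<forall>z\<in>K. dist (F (\<sigma> n) z) (F c1 z) < e"
        proof eventually_elim
          case (elim n)
          show ?case
          proof
            fix z assume z: "z \<in> K"
            have "F (\<sigma> n) z - F c1 z = of_real (\<sigma> n - c1) * (F1 z - F0 z)" by (simp add: F_def algebra_simps)
            also have "\<sigma> n - c1 = - (c1 / real (Suc n))" by (simp add: \<sigma>_def field_simps)
            finally have "dist (F (\<sigma> n) z) (F c1 z) = c1 / real (Suc n) * norm (F1 z - F0 z)"
              using c1 by (simp add: dist_norm norm_mult norm_divide del: of_nat_Suc)
            also have "\<dots> \<le> c1 / real (Suc n) * \<bar>b\<bar>"
              using b[OF z] c1 by (intro mult_left_mono) auto
            finally show "dist (F (\<sigma> n) z) (F c1 z) < e" using elim by simp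
          qed
        qed
      qed
    qed
    show "\<not> F c1 constant_on S"
    proof
      assume "F c1 constant_on S"
      then obtain v where v: "\<And>z. z \<in> S \<Longrightarrow> F c1 z = v" unfolding constant_on_def by blast
      define T where "T = max M y0 + 1"
      have "complex_of_real T \<in> S" "complex_of_real t1 \<in> S" using t1y by (auto simp: S_def T_def)
      then have "F c1 (of_real T) = F c1 (of_real t1)" by (simp only: v)
      then have "of_real ((1 - c1) * f0 T + c1 * f1 T) = (0::complex)" unfolding Fre root by simp
      then have "(1 - c1) * f0 T + c1 * f1 T = 0" by (simp only: of_real_eq_0_iff)
      moreover have "(1 - c1) * f0 T + c1 * f1 T > 0"
      proof -
        have "f0 T > 0" "f1 T > 0" using f0[of T] M[of T] by (auto simp: T_def)
        then show ?thesis using c1 by (intro add_nonneg_pos mult_pos_pos mult_nonneg_nonneg) auto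
      qed
      ultimately show False by simp
    qed
    show "F (\<sigma> n) z \<noteq> 0" if z: "z \<in> S" for n z
    proof (cases "Im z = 0")
      case True
      then have "F (\<sigma> n) z = F (\<sigma> n) (of_real (Re z))" by (intro arg_cong[where f = "F (\<sigma> n)"]) (simp add: complex_eq_iff)
      also have "\<dots> = of_real ((1 - \<sigma> n) * f0 (Re z) + \<sigma> n * f1 (Re z))" by (rule Fre)
      finally have "F (\<sigma> n) z = of_real ((1 - \<sigma> n) * f0 (Re z) + \<sigma> n * f1 (Re z))" .
      moreover have "(1 - \<sigma> n) * f0 (Re z) + \<sigma> n * f1 (Re z) > 0" using pos[OF \<sigma>] z by (simp add: S_def)
      ultimately show ?thesis by (simp only: of_real_eq_0_iff)
    next
      case False
      have c: "0 \<le> \<sigma> n" "\<sigma> n \<le> 1" using \<sigma>[of n] c1 by auto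
      have Fcnj: "F (\<sigma> n) (cnj z) = cnj (F (\<sigma> n) z)" by (simp add: F_def cnj)
      from False consider "Im z > 0" | "Im (cnj z) > 0" by fastforce
      then show ?thesis
      proof cases
        case 1
        then show ?thesis using nz[OF c] by (simp add: F_def)
      next
        case 2
        have "F (\<sigma> n) (cnj z) \<noteq> 0" unfolding F_def by (rule nz[OF c 2])
        then show ?thesis unfolding Fcnj by simp
      qed
    qed
    show "of_real t1 \<in> S" using t1y by (simp add: S_def)
  qed (rule holF)+
  then show False unfolding Fre root by simp
qed

text \<open>The term \<open>- 2 * x^2\<close> from the minors and the pending weight
  \<open>- 2 * (1 - x^2)\<close> multiply the same sum over \<open>V - e\<close> and add up to
  \<open>- 2\<close>, so no quadratic term survives.\<close>

lemma relaxed_sum_edge_affine: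
  fixes y :: "nat \<Rightarrow> 'a :: real_field"
  assumes "finite V" and e: "card e = 2" and "\<forall>f\<in>set es. card f = 2"
  shows "\<exists>K L. \<forall>x. relaxed_sum (upd B e x) w V es y - of_real (2 * (1 - x\<^sup>2)) * (if e \<subseteq> V then relaxed_sum B w (V - e) es y else 0) = K + of_real x * L"
  using assms(1,3)
proof (induction es arbitrary: V)
  case Nil
  obtain K L where KL: "\<And>x. disjoint_sum (upd B e x) V y = K + of_real x * L - of_real (2 * x\<^sup>2) * (if e \<subseteq> V then disjoint_sum B (V - e) y else 0)"
    by (rule disjoint_sum_edge[OF Nil(1) e, of B y]) (rule that)
  define z where "z = (if e \<subseteq> V then disjoint_sum B (V - e) y else 0)"
  have "relaxed_sum (upd B e x) w V [] y - of_real (2 * (1 - x\<^sup>2)) * z = (K - 2 * z) + of_real x * L" for x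
    unfolding relaxed_sum.simps KL z_def[symmetric] by (simp add: algebra_simps)
  then show ?case unfolding z_def relaxed_sum.simps by blast
next
  case (Cons f es)
  define H where "H V x = relaxed_sum (upd B e x) w V es y - of_real (2 * (1 - x\<^sup>2)) * (if e \<subseteq> V then relaxed_sum B w (V - e) es y else 0)" for V x
  obtain K L where KL: "\<And>x. H V x = K + of_real x * L" using Cons.IH[of V] Cons.prems unfolding H_def by auto
  obtain K' L' where KL': "\<And>x. H (V - f) x = K' + of_real x * L'" using Cons.IH[of "V - f"] Cons.prems unfolding H_def by auto
  have comm: "V - e - f = V - f - e" by auto
  have eq: "relaxed_sum (upd B e x) w V (f # es) y - of_real (2 * (1 - x\<^sup>2)) * (if e \<subseteq> V then relaxed_sum B w (V - e) (f # es) y else 0)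
    = H V x - of_real (w f) * (if f \<subseteq> V then H (V - f) x else 0)" for x
  proof (cases "f \<subseteq> V")
    case False
    then have "\<not> f \<subseteq> V - e" by auto
    then show ?thesis using False by (simp add: H_def)
  next
    case True
    then have "e \<subseteq> V \<and> f \<subseteq> V - e \<longleftrightarrow> e \<subseteq> V - f" by auto
    then show ?thesis using True by (auto simp: H_def comm algebra_simps)
  qed
  show ?case
  proof (intro exI allI)
    fix x show "relaxed_sum (upd B e x) w V (f # es) y - of_real (2 * (1 - x\<^sup>2)) * (if e \<subseteq> V then relaxed_sum B w (V - e) (f # es) y else 0)
      = (K - of_real (w f) * (if f \<subseteq> V then K' else 0)) + of_real x * (L - of_real (w f) * (if f \<subseteq> V then L' else 0))"
      unfolding eq KL KL' by (simp add: algebra_simps)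
  qed
qed

text \<open>As a function of the edge value the sum is affine, so one of the two signs does not
  decrease it at the single point \<open>y0\<close>. Real-rootedness on the segment from 0 to that
  sign extends positivity from \<open>y0\<close> to the whole ray.\<close>

lemma choose_sign:
  assumes V: "finite V" and sym: "\<And>i j. B i j = B j i" and diag: "\<And>i. B i i = 0"
    and w: "\<And>f. w f \<ge> 0" "w e = 2" and es: "e \<notin> set es" "card e = 2" "\<forall>f\<in>set es. card f = 2"
    and B: "\<And>i j. {i, j} = e \<Longrightarrow> B i j = 0"
    and pos: "\<And>y. y \<ge> y0 \<Longrightarrow> relaxed_sum B w V (e # es) (\<lambda>_. y) > (0::real)"
  shows "\<exists>x\<in>{-1, 1}. \<forall>y\<ge>y0. relaxed_sum (upd B e x) w V es (\<lambda>_. y) > (0::real)"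
proof -
  define \<Phi> :: "real \<Rightarrow> real \<Rightarrow> real" where "\<Phi> x y = relaxed_sum (upd B e x) w V es (\<lambda>_. y) - 2 * (1 - x\<^sup>2) * (if e \<subseteq> V then relaxed_sum B w (V - e) es (\<lambda>_. y) else 0)" for x y
  define \<Psi> :: "real \<Rightarrow> complex \<Rightarrow> complex" where "\<Psi> x y = relaxed_sum (upd B e x) w V es (\<lambda>_. y) - of_real (2 * (1 - x\<^sup>2)) * (if e \<subseteq> V then relaxed_sum B w (V - e) es (\<lambda>_. y) else 0)" for x y
  have B0: "upd B e 0 = B" by (auto simp: upd_def B fun_eq_iff)
  have \<Phi>0: "\<Phi> 0 y = relaxed_sum B w V (e # es) (\<lambda>_. y)" for y by (simp add: \<Phi>_def B0 w)
  have aff: "\<Phi> x y = (1 - \<bar>x\<bar>) * \<Phi> 0 y + \<bar>x\<bar> * \<Phi> (sgn x) y" for x y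
  proof -
    obtain K L where "\<And>x. \<Phi> x y = K + x * L"
      using relaxed_sum_edge_affine[OF V es(2,3), of B w "\<lambda>_. y"] unfolding \<Phi>_def by auto
    then show ?thesis by (simp add: algebra_simps) (simp add: sgn_if abs_if)
  qed
  have affC: "\<Psi> (c * s) z = of_real (1 - c) * \<Psi> 0 z + of_real c * \<Psi> s z" for c s z
  proof -
    obtain K L where "\<And>x. \<Psi> x z = K + of_real x * L"
      using relaxed_sum_edge_affine[OF V es(2,3), of B w "\<lambda>_. z"] unfolding \<Psi>_def by blast
    then show ?thesis by (simp add: algebra_simps)
  qed
  have updsym: "upd B e x i j = upd B e x j i" for x i j using sym by (auto simp: upd_def insert_commute)
  have upddiag: "upd B e x i i = 0" for x i using es(2) diag by (auto simp: upd_def)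
  have nz: "\<Psi> x z \<noteq> 0" if "\<bar>x\<bar> \<le> 1" "Im z > 0" for x z
  proof -
    \<comment> \<open>An intermediate edge value is itself a relaxed sum, with the weight of
      \<open>e\<close> lowered to \<open>2 * (1 - x^2) \<ge> 0\<close>, so stability
      applies.\<close>
    define w' where "w' = w(e := 2 * (1 - x\<^sup>2))"
    have n1: "relaxed_sum (upd B e x) w' V (e # es) (\<lambda>_. z) \<noteq> 0"
    proof (rule relaxed_sum_nonzero[OF V updsym upddiag])
      show "w' f \<ge> 0" for f using w(1) that(1) by (simp add: w'_def abs_square_le_1)
    qed (use es that in auto)
    have e1: "relaxed_sum (upd B e x) w' V es (\<lambda>_. z) = relaxed_sum (upd B e x) w V es (\<lambda>_. z)"
      using es(1) by (intro relaxed_sum_cong_B) (auto simp: w'_def)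
    have e2: "relaxed_sum (upd B e x) w' (V - e) es (\<lambda>_. z) = relaxed_sum B w (V - e) es (\<lambda>_. z)"
    proof (intro relaxed_sum_cong_B)
      show "w' f = w f" if "f \<in> set es" for f using es(1) that by (auto simp: w'_def)
      show "upd B e x i j = B i j" if "i \<in> V - e" "j \<in> V - e" for i j
      proof -
        have "i \<in> e" if "{i, j} = e" using that by auto
        then show ?thesis using \<open>i \<in> V - e\<close> by (auto simp: upd_def)
      qed
    qed
    have e3: "w' e = 2 * (1 - x\<^sup>2)" by (simp add: w'_def)
    show ?thesis using n1 unfolding \<Psi>_def relaxed_sum.simps e1 e2 e3 .
  qed
  define x where "x = (if \<Phi> 1 y0 \<ge> \<Phi> 0 y0 then 1 else - 1 :: real)"
  have x: "x \<in> {-1, 1}" by (simp add: x_def)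
  have \<Phi>x: "\<Phi> x y = relaxed_sum (upd B e x) w V es (\<lambda>_. y)" for y using x by (auto simp: \<Phi>_def)
  have re: "\<Psi> r (of_real y) = of_real (\<Phi> r y)" for r y
    by (simp add: \<Psi>_def \<Phi>_def relaxed_sum_of_real)
  have cnj: "\<Psi> r (cnj z) = cnj (\<Psi> r z)" for r z
    using relaxed_sum_cnj[where y = "\<lambda>_. z"] by (simp add: \<Psi>_def)
  have hol: "\<Psi> r holomorphic_on UNIV" for r
    unfolding \<Psi>_def[abs_def] by (cases "e \<subseteq> V") (auto intro!: holomorphic_intros relaxed_sum_holomorphic)
  have "\<Phi> x y > 0" if "y \<ge> y0" for y
  proof (rule positivity_persists[OF hol hol re re cnj cnj _ _ _ _ that])
    show "of_real (1 - c) * \<Psi> 0 z + of_real c * \<Psi> x z \<noteq> 0" if "0 \<le> c" "c \<le> 1" "Im z > 0" for c z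
      unfolding affC[symmetric] using that x by (intro nz) auto
    show "\<Phi> 0 y > 0" if "y \<ge> y0" for y unfolding \<Phi>0 by (rule pos[OF that])
    have "\<Phi> 0 y0 > 0" unfolding \<Phi>0 by (rule pos) simp
    moreover have "\<Phi> (- 1) y0 = 2 * \<Phi> 0 y0 - \<Phi> 1 y0"
    proof -
      obtain K L where "\<And>x. \<Phi> x y0 = K + x * L"
        using relaxed_sum_edge_affine[OF V es(2,3), of B w "\<lambda>_. y0"] unfolding \<Phi>_def by auto
      then show ?thesis by simp
    qed
    ultimately show "\<Phi> x y0 > 0" by (auto simp: x_def)
    show "\<forall>\<^sub>F y in at_top. \<Phi> x y > 0" unfolding \<Phi>x by (rule relaxed_sum_eventually_pos[OF V es(3)])
  qed
  then show ?thesis using x unfolding \<Phi>x by blast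
qed

lemma choose_signs:
  assumes V: "finite V"
  shows "(\<And>i j. B i j = B j i) \<Longrightarrow> (\<And>i. B i i = 0) \<Longrightarrow> distinct es \<Longrightarrow> \<forall>f\<in>set es. card f = 2 \<Longrightarrow>
    (\<And>i j. {i, j} \<in> set es \<Longrightarrow> B i j = 0) \<Longrightarrow> (\<And>y. y \<ge> y0 \<Longrightarrow> relaxed_sum B (\<lambda>_. 2) V es (\<lambda>_. y) > (0::real)) \<Longrightarrow>
    \<exists>s. (\<forall>e. s e \<in> {-1, 1}) \<and> (\<forall>y\<ge>y0. disjoint_sum (\<lambda>i j. if {i, j} \<in> set es then s {i, j} else B i j) V (\<lambda>_. y) > (0::real))"
proof (induction es arbitrary: B)
  case Nil
  then show ?case by (intro exI[of _ "\<lambda>_. 1"]) auto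
next
  case (Cons e es)
  have "\<exists>x\<in>{-1, 1}. \<forall>y\<ge>y0. relaxed_sum (upd B e x) (\<lambda>_. 2) V es (\<lambda>_. y) > (0::real)"
    by (rule choose_sign[OF V]) (use Cons.prems in auto)
  then obtain x where x: "x \<in> {-1, 1}" "\<And>y. y \<ge> y0 \<Longrightarrow> relaxed_sum (upd B e x) (\<lambda>_. 2) V es (\<lambda>_. y) > (0::real)" by blast
  have "\<exists>s. (\<forall>e. s e \<in> {-1, 1}) \<and> (\<forall>y\<ge>y0. disjoint_sum (\<lambda>i j. if {i, j} \<in> set es then s {i, j} else upd B e x i j) V (\<lambda>_. y) > (0::real))"
  proof (rule Cons.IH)
    show "upd B e x i j = upd B e x j i" for i j using Cons.prems(1) by (auto simp: upd_def insert_commute)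
    show "upd B e x i i = 0" for i using Cons.prems(2,4) by (auto simp: upd_def)
    show "upd B e x i j = 0" if "{i, j} \<in> set es" for i j using Cons.prems(3,5) that by (auto simp: upd_def)
  qed (use Cons.prems x in auto)
  then obtain s where s: "\<And>e. s e \<in> {-1, 1}"
    "\<And>y. y \<ge> y0 \<Longrightarrow> disjoint_sum (\<lambda>i j. if {i, j} \<in> set es then s {i, j} else upd B e x i j) V (\<lambda>_. y) > (0::real)" by blast
  have "(\<lambda>i j. if {i, j} \<in> set es then s {i, j} else upd B e x i j)
    = (\<lambda>i j. if {i, j} \<in> set (e # es) then (s(e := x)) {i, j} else B i j)"
    using Cons.prems(3) by (auto simp: fun_eq_iff upd_def)
  then show ?case using s x(1) by (intro exI[of _ "s(e := x)"]) auto
qed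

section \<open>The weighted matching polynomial\<close>

abbreviation Z0 :: "nat \<Rightarrow> nat \<Rightarrow> real" where "Z0 \<equiv> \<lambda>_ _. 0"

lemma disjoint_sum_zero_remove:
  fixes y :: "nat \<Rightarrow> real"
  assumes W: "finite W" "k \<in> W"
  shows "disjoint_sum Z0 W y = y k * disjoint_sum Z0 (W - {k}) y"
proof -
  have U: "finite (W - {k})" "k \<notin> W - {k}" "insert k (W - {k}) = W" using W by auto
  have z: "mdet (insert k I) (\<lambda>i j. r * Z0 i j) = 0" if "I \<subseteq> W - {k}" for I and r :: real
  proof (rule mdet_zero_column)
    show "finite (insert k I)" using that U(1) finite_subset by blast
  qed auto
  have f: "pair_sum (\<lambda>_. 0) c' (W - {k}) y (\<lambda>_. 1) (\<lambda>_. 1) (\<lambda>_. 0) = 0" "pair_sum c' (\<lambda>_. 0) (W - {k}) y (\<lambda>_. 1) (\<lambda>_. 1) (\<lambda>_. 0) = 0" for c'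
    by (simp_all add: pair_sum_def)
  have "pair_sum (\<lambda>I. minor_neg Z0 (insert k I)) c' (W - {k}) y (\<lambda>_. 1) (\<lambda>_. 1) (\<lambda>_. 0) = pair_sum (\<lambda>_. 0) c' (W - {k}) y (\<lambda>_. 1) (\<lambda>_. 1) (\<lambda>_. 0)"
    "pair_sum c' (\<lambda>I. minor_pos Z0 (insert k I)) (W - {k}) y (\<lambda>_. 1) (\<lambda>_. 1) (\<lambda>_. 0) = pair_sum c' (\<lambda>_. 0) (W - {k}) y (\<lambda>_. 1) (\<lambda>_. 1) (\<lambda>_. 0)" for c'
    by (rule pair_sum_cong_coeff; simp only: z)+
  then show ?thesis
    using pair_sum_insert[OF U(1,2), of "minor_neg Z0" "minor_pos Z0" y "\<lambda>_. 1" "\<lambda>_. 1" "\<lambda>_. 0"]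
    unfolding U(3) f by (simp only: disjoint_sum_def mult_zero_left mult_zero_right mult_1 add_0_right)
qed

text \<open>With all entries 0 the relaxed sum is the matching polynomial with edge weight
  \<open>r\<close>. It is built edge by edge, whereas the root bound needs the recursion at a
  vertex; the new edge \<open>f\<close> is treated according to whether it fits into
  \<open>W\<close> and contains \<open>k\<close>.\<close>

lemma matching_recursion:
  fixes y r :: real
  assumes "finite W" "k \<in> W" "distinct es" "\<forall>e\<in>set es. card e = 2"
  shows "relaxed_sum Z0 (\<lambda>_. r) W es (\<lambda>_. y) = y * relaxed_sum Z0 (\<lambda>_. r) (W - {k}) es (\<lambda>_. y)
    - r * (\<Sum>e | e \<in> set es \<and> k \<in> e \<and> e \<subseteq> W. relaxed_sum Z0 (\<lambda>_. r) (W - e) es (\<lambda>_. y))"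
  using assms
proof (induction es arbitrary: W)
  case Nil
  show ?case using disjoint_sum_zero_remove[OF Nil(1,2)] by simp
next
  case (Cons f es)
  define m where "m W es = relaxed_sum Z0 (\<lambda>_. r) W es (\<lambda>_. y)" for W es
  define S where "S W es = {e. e \<in> set es \<and> k \<in> e \<and> e \<subseteq> W}" for W es
  have mC: "m W (f # es) = m W es - r * (if f \<subseteq> W then m (W - f) es else 0)" for W by (simp add: m_def)
  have IH: "m W es = y * m (W - {k}) es - r * (\<Sum>e\<in>S W es. m (W - e) es)" if "finite W" "k \<in> W" for W
    using Cons.IH[of W] that Cons.prems by (simp add: m_def S_def)
  have fin: "finite (S W es)" by (simp add: S_def)
  have fne: "f \<noteq> {}" using Cons.prems(4) by auto
  have fes: "f \<notin> set es" using Cons.prems(3) by simp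
  have "m W (f # es) = y * m (W - {k}) (f # es) - r * (\<Sum>e\<in>S W (f # es). m (W - e) (f # es))"
  proof (cases "f \<subseteq> W")
    case False
    then have n: "\<not> f \<subseteq> W - X" for X by auto
    have "S W (f # es) = S W es" using False by (auto simp: S_def)
    then show ?thesis using IH[OF Cons.prems(1,2)] False by (simp add: mC n)
  next
    case fW: True
    show ?thesis
    proof (cases "k \<in> f")
      case True
      have "f \<notin> S W es" using fes by (simp add: S_def)
      have eq: "m (W - e) (f # es) = m (W - e) es" if "k \<in> e" for e
      proof -
        have "\<not> f \<subseteq> W - e" using that True by blast
        then show ?thesis by (simp only: mC if_False mult_zero_right diff_0_right)
      qed
      have "S W (f # es) = insert f (S W es)" using True fW by (auto simp: S_def)
      then have "(\<Sum>e\<in>S W (f # es). m (W - e) (f # es)) = m (W - f) (f # es) + (\<Sum>e\<in>S W es. m (W - e) (f # es))"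
        using fin \<open>f \<notin> S W es\<close> by simp
      also have "\<dots> = m (W - f) es + (\<Sum>e\<in>S W es. m (W - e) es)"
        by (intro arg_cong2[where f = "(+)"] sum.cong refl eq True) (simp add: S_def)
      finally have s: "(\<Sum>e\<in>S W (f # es). m (W - e) (f # es)) = m (W - f) es + (\<Sum>e\<in>S W es. m (W - e) es)" .
      have "\<not> f \<subseteq> W - {k}" using True by auto
      then have "m (W - {k}) (f # es) = m (W - {k}) es" by (simp add: mC)
      moreover have "m W (f # es) = m W es - r * m (W - f) es" using fW by (simp add: mC)
      ultimately show ?thesis unfolding s IH[OF Cons.prems(1,2)] by (simp add: algebra_simps)
    next
      case False
      have s1: "S W (f # es) = S W es" using False by (auto simp: S_def)
      have s2: "(\<Sum>e\<in>S W es. m (W - e) (f # es)) = (\<Sum>e\<in>S W es. m (W - e) es) - r * (\<Sum>e\<in>S (W - f) es. m (W - f - e) es)"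
      proof -
        have "(\<Sum>e\<in>S W es. m (W - e) (f # es)) = (\<Sum>e\<in>S W es. m (W - e) es) - r * (\<Sum>e\<in>S W es. if f \<subseteq> W - e then m (W - e - f) es else 0)"
          unfolding mC by (simp only: sum_subtractf sum_distrib_left)
        also have "(\<Sum>e\<in>S W es. if f \<subseteq> W - e then m (W - e - f) es else 0) = (\<Sum>e\<in>S (W - f) es. m (W - f - e) es)"
        proof (rule sum.mono_neutral_cong_right[OF fin])
          show "S (W - f) es \<subseteq> S W es" by (auto simp: S_def)
          show "\<forall>e\<in>S W es - S (W - f) es. (if f \<subseteq> W - e then m (W - e - f) es else 0) = 0"
            by (auto simp: S_def)
          fix e assume "e \<in> S (W - f) es"
          moreover have "W - e - f = W - f - e" by auto
          ultimately show "(if f \<subseteq> W - e then m (W - e - f) es else 0) = m (W - f - e) es"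
            using fW by (auto simp: S_def)
        qed
        finally show ?thesis .
      qed
      have "f \<subseteq> W - {k}" using False fW by auto
      have c: "W - {k} - f = W - f - {k}" by auto
      have i2: "m (W - f) es = y * m (W - f - {k}) es - r * (\<Sum>e\<in>S (W - f) es. m (W - f - e) es)"
        by (rule IH) (use Cons.prems(1,2) False in auto)
      have u1: "m W (f # es) = m W es - r * m (W - f) es" using fW by (simp add: mC)
      have u2: "m (W - {k}) (f # es) = m (W - {k}) es - r * m (W - {k} - f) es" using \<open>f \<subseteq> W - {k}\<close> by (simp add: mC)
      show ?thesis unfolding s1 s2 u1 u2 c i2 IH[OF Cons.prems(1,2)] by (simp add: algebra_simps)
    qed
  qed
  then show ?case by (simp only: m_def S_def)
qed

text \<open>Heilmann-Lieb bound for weight 2. If each \<open>m (W - {k})\<close> dominates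
  \<open>y / 2\<close> times the sum with one more vertex deleted, then
  \<open>m W \<ge> (y - 4 * deg / y) * m (W - {k})\<close>, and for degree at most
  \<open>d - 1\<close> the factor is at least \<open>y / 2\<close> exactly when
  \<open>y^2 \<ge> 8 * (d - 1)\<close>. The degree condition is restored automatically after the
  first deletion.\<close>

lemma matching_positive:
  fixes y :: real
  assumes V: "finite V" and es: "distinct es" "\<forall>e\<in>set es. card e = 2"
    and deg: "\<And>v. v \<in> V \<Longrightarrow> card {e \<in> set es. v \<in> e} \<le> d" and d: "d \<ge> 2"
    and y: "y > 0" "y\<^sup>2 > 8 * (real d - 1)"
  shows "W \<subseteq> V \<Longrightarrow> relaxed_sum Z0 (\<lambda>_. 2) W es (\<lambda>_. y) > 0 \<and>
    (\<forall>k\<in>W. card {e \<in> set es. k \<in> e \<and> e \<subseteq> W} \<le> d - 1 \<longrightarrow> relaxed_sum Z0 (\<lambda>_. 2) W es (\<lambda>_. y) \<ge> y / 2 * relaxed_sum Z0 (\<lambda>_. 2) (W - {k}) es (\<lambda>_. y))"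
proof (induction "card W" arbitrary: W rule: less_induct)
  case less
  define m where "m W = relaxed_sum Z0 (\<lambda>_. 2) W es (\<lambda>_. y)" for W
  define S where "S k W = {e. e \<in> set es \<and> k \<in> e \<and> e \<subseteq> W}" for k W
  have fW: "finite W" using less.prems V finite_subset by blast
  have finS: "finite (S k W)" for k W by (simp add: S_def)
  have IH1: "m W' > 0" and IH2: "\<And>j. j \<in> W' \<Longrightarrow> card (S j W') \<le> d - 1 \<Longrightarrow> m W' \<ge> y / 2 * m (W' - {j})"
    if "W' \<subset> W" for W'
    using less.hyps[of W'] psubset_card_mono[OF fW that] that less.prems unfolding m_def S_def by auto
  have bound: "m W \<ge> (y - 4 * real (card (S k W)) / y) * m (W - {k})" if k: "k \<in> W" for k
  proof -
    have sub: "W - {k} \<subset> W" using k by auto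
    have "m (W - e) \<le> 2 / y * m (W - {k})" if e: "e \<in> S k W" for e
    proof -
      have "card e = 2" "k \<in> e" "e \<subseteq> W" using e es by (auto simp: S_def)
      then obtain j where j: "e = {k, j}" "j \<noteq> k" by (auto simp: card_2_iff doubleton_eq_iff)
      have jW: "j \<in> W - {k}" "W - e = W - {k} - {j}" using j e by (auto simp: S_def)
      \<comment> \<open>Deleting \<open>k\<close> costs its neighbour \<open>j\<close> the edge
        \<open>e\<close>, so at most \<open>d - 1\<close> edges remain at \<open>j\<close>.\<close>
      have "S j (W - {k}) \<subseteq> {e' \<in> set es. j \<in> e'} - {e}" using j by (auto simp: S_def)
      then have "card (S j (W - {k})) \<le> card ({e' \<in> set es. j \<in> e'} - {e})" by (intro card_mono) auto
      also have "\<dots> = card {e' \<in> set es. j \<in> e'} - 1"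
        using e j by (subst card_Diff_singleton) (auto simp: S_def)
      also have "\<dots> \<le> d - 1" using deg[of j] jW less.prems by (intro diff_le_mono) auto
      finally have "y / 2 * m (W - {k} - {j}) \<le> m (W - {k})" using IH2[OF sub jW(1)] by simp
      then show ?thesis using y(1) jW(2) by (simp add: field_simps)
    qed
    then have "(\<Sum>e\<in>S k W. m (W - e)) \<le> (\<Sum>e\<in>S k W. 2 / y * m (W - {k}))" by (rule sum_mono)
    moreover have "m W = y * m (W - {k}) - 2 * (\<Sum>e\<in>S k W. m (W - e))"
      using matching_recursion[OF fW k es, of 2 y] by (simp add: m_def S_def)
    ultimately have "m W \<ge> y * m (W - {k}) - 2 * (real (card (S k W)) * (2 / y * m (W - {k})))" by simp
    then show ?thesis by (simp add: algebra_simps)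
  qed
  have pos: "m (W - {k}) > 0" if "k \<in> W" for k using that by (intro IH1) auto
  have "m W > 0"
  proof (cases "W = {}")
    case True
    have "m {} = 1"
    proof -
      have "relaxed_sum Z0 (\<lambda>_. 2) {} fs (\<lambda>_. y) = 1" if "\<forall>e\<in>set fs. card e = 2" for fs
        using that by (induction fs) (auto simp: disjoint_sum_def pair_sum_def)
      then show ?thesis using es by (simp add: m_def)
    qed
    then show ?thesis using True by simp
  next
    case False
    then obtain k where k: "k \<in> W" by auto
    have "card (S k W) \<le> card {e \<in> set es. k \<in> e}" by (rule card_mono) (auto simp: S_def)
    also have "\<dots> \<le> d" using deg[of k] k less.prems by auto
    finally have "real (card (S k W)) \<le> real d" by simp
    \<comment> \<open>\<open>4 * d \<le> 8 * (d - 1)\<close> for \<open>d \<ge> 2\<close>, so full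
      degree at the first vertex does no harm to positivity.\<close>
    moreover have "real d \<ge> 2" using d by simp
    ultimately have "4 * real (card (S k W)) < y\<^sup>2" using y(2) by (smt (verit))
    then have "y - 4 * real (card (S k W)) / y > 0" using y(1) by (simp add: field_simps power2_eq_square)
    then show ?thesis using bound[OF k] pos[OF k] by (meson less_le_trans mult_pos_pos)
  qed
  moreover have "m W \<ge> y / 2 * m (W - {k})" if k: "k \<in> W" "card (S k W) \<le> d - 1" for k
  proof -
    have "real (card (S k W)) \<le> real d - 1" using k(2) d by linarith
    then have "8 * real (card (S k W)) \<le> y\<^sup>2" using y(2) by (smt (verit))
    then have "y / 2 \<le> y - 4 * real (card (S k W)) / y" using y(1) by (simp add: field_simps power2_eq_square)
    then have "y / 2 * m (W - {k}) \<le> (y - 4 * real (card (S k W)) / y) * m (W - {k})"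
      using pos[OF k(1)] by (intro mult_right_mono) auto
    then show ?thesis using bound[OF k(1)] by linarith
  qed
  ultimately show ?case unfolding m_def S_def by (auto simp: Collect_conj_eq)
qed

text \<open>The choice of signs depends on the threshold \<open>y0\<close>, while the claim concerns
  an open condition on \<open>y\<close>. If every signing failed at some point, the least of these
  finitely many points would serve as \<open>y0\<close>, and the signing chosen for it would not
  fail.\<close>

lemma signing_exists:
  assumes V: "finite V" and E: "finite E" "\<And>e. e \<in> E \<Longrightarrow> card e = 2"
    and deg: "\<And>v. v \<in> V \<Longrightarrow> card {e \<in> E. v \<in> e} \<le> d" and d: "d \<ge> 2"
  shows "\<exists>\<sigma>\<in>E \<rightarrow>\<^sub>E {-1, 1}. \<forall>y>0. y\<^sup>2 > 8 * (real d - 1) \<longrightarrow> disjoint_sum (\<lambda>i j. if {i, j} \<in> E then \<sigma> {i, j} else 0) V (\<lambda>_. y) > (0::real)"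
proof (rule ccontr)
  define T where "T \<sigma> y = disjoint_sum (\<lambda>i j. if {i, j} \<in> E then \<sigma> {i, j} else 0) V (\<lambda>_. y)" for \<sigma> :: "nat set \<Rightarrow> real" and y :: real
  assume "\<not> ?thesis"
  then have "\<forall>\<sigma>\<in>E \<rightarrow>\<^sub>E {-1, 1}. \<exists>y>0. y\<^sup>2 > 8 * (real d - 1) \<and> \<not> T \<sigma> y > 0" unfolding T_def by blast
  then obtain Y where Y: "\<And>\<sigma>. \<sigma> \<in> E \<rightarrow>\<^sub>E {-1, 1} \<Longrightarrow> Y \<sigma> > 0 \<and> (Y \<sigma>)\<^sup>2 > 8 * (real d - 1) \<and> \<not> T \<sigma> (Y \<sigma>) > 0"
    unfolding bchoice_iff by auto
  define y0 where "y0 = Min (Y ` (E \<rightarrow>\<^sub>E {-1, 1}))"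
  have fin: "finite (E \<rightarrow>\<^sub>E {-1, 1 :: real})" using E(1) by (intro finite_PiE) auto
  have "E \<rightarrow>\<^sub>E {-1, 1 :: real} \<noteq> {}" by (simp add: PiE_eq_empty_iff)
  then have "y0 \<in> Y ` (E \<rightarrow>\<^sub>E {-1, 1})" unfolding y0_def using fin by (intro Min_in) auto
  then have y0: "y0 > 0" "y0\<^sup>2 > 8 * (real d - 1)" using Y by auto
  obtain es where es: "set es = E" "distinct es" using finite_distinct_list[OF E(1)] by blast
  have es2: "\<forall>f\<in>set es. card f = 2" using E(2) es(1) by auto
  have "\<exists>s. (\<forall>e. s e \<in> {-1, 1}) \<and> (\<forall>y\<ge>y0. disjoint_sum (\<lambda>i j. if {i, j} \<in> set es then s {i, j} else Z0 i j) V (\<lambda>_. y) > (0::real))"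
  proof (rule choose_signs[OF V _ _ es(2) es2])
    fix y assume y: "y \<ge> y0"
    then have "y\<^sup>2 \<ge> y0\<^sup>2" using y0(1) by (intro power_mono) auto
    then have y2: "y\<^sup>2 > 8 * (real d - 1)" "y > 0" using y0 y by linarith+
    have "card {e \<in> set es. v \<in> e} \<le> d" if "v \<in> V" for v unfolding es(1) by (rule deg[OF that])
    from matching_positive[OF V es(2) es2 this d y2(2,1) subset_refl]
    show "relaxed_sum Z0 (\<lambda>_. 2) V es (\<lambda>_. y) > 0" by blast
  qed auto
  then obtain s where s: "\<And>e. s e \<in> {-1, 1}"
    "\<And>y. y \<ge> y0 \<Longrightarrow> disjoint_sum (\<lambda>i j. if {i, j} \<in> E then s {i, j} else 0) V (\<lambda>_. y) > (0::real)" unfolding es(1) by blast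
  define \<sigma> where "\<sigma> = restrict s E"
  have \<sigma>: "\<sigma> \<in> E \<rightarrow>\<^sub>E {-1, 1}" unfolding \<sigma>_def using s(1) by (intro restrict_PiE_iff[THEN iffD2]) blast
  have "(\<lambda>i j. if {i, j} \<in> E then \<sigma> {i, j} else 0) = (\<lambda>i j. if {i, j} \<in> E then s {i, j} else 0)"
    by (auto simp: \<sigma>_def fun_eq_iff)
  moreover have "Y \<sigma> \<ge> y0" unfolding y0_def using fin \<sigma> by (intro Min_le) auto
  ultimately have "T \<sigma> (Y \<sigma>) > 0" unfolding T_def using s(2) by simp
  then show False using Y[OF \<sigma>] by simp
qed

section \<open>Matrices and the main theorem\<close>

lemma pick_bij_betw:
  assumes "finite I"
  shows "bij_betw (pick I) {0..<card I} I"
proof -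
  have sub: "I \<subseteq> pick I ` {0..<card I}"
  proof
    fix i assume i: "i \<in> I"
    have "{a \<in> I. a < i} \<subset> I" using i by auto
    then have "card {a \<in> I. a < i} < card I" using assms by (rule psubset_card_mono[rotated])
    then show "i \<in> pick I ` {0..<card I}" using pick_card_in_set[OF i] by (intro image_eqI[of _ _ "card {a \<in> I. a < i}"]) auto
  qed
  have le: "card (pick I ` {0..<card I}) \<le> card I" using card_image_le[of "{0..<card I}" "pick I"] by simp
  have eq: "I = pick I ` {0..<card I}" by (rule card_seteq[OF _ sub le]) simp
  then have "inj_on (pick I) {0..<card I}" by (intro eq_card_imp_inj_on) auto
  then show ?thesis using eq by (simp add: bij_betw_def)
qed

lemma char_poly_mdet:
  fixes B :: "nat \<Rightarrow> nat \<Rightarrow> 'a :: field"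
  assumes S: "finite S" and f: "bij_betw f {0..<card S} S"
  shows "poly (char_poly (mat (card S) (card S) (\<lambda>(i, j). B (f i) (f j)))) x = mdet S (\<lambda>i j. (if i = j then x else 0) + - B i j)"
proof -
  let ?M = "mat (card S) (card S) (\<lambda>(i, j). B (f i) (f j))"
  have M: "?M \<in> carrier_mat (card S) (card S)" by simp
  have inj: "f i = f j \<longleftrightarrow> i = j" if "i < card S" "j < card S" for i j
    using f that by (auto simp: bij_betw_def inj_on_def)
  have "- char_matrix ?M x = mat (card S) (card S) (\<lambda>(i, j). (if f i = f j then x else 0) + - B (f i) (f j))"
    by (rule eq_matI) (auto simp: char_matrix_def inj)
  then show ?thesis unfolding char_poly_matrix[OF M] mdet_det[OF S f] by simp
qed

lemma char_poly_submatrix: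
  fixes B :: "nat \<Rightarrow> nat \<Rightarrow> 'a :: field"
  assumes I: "I \<subseteq> {..<n}"
  shows "poly (char_poly (submatrix (mat n n (\<lambda>(i, j). B i j)) I I)) x = mdet I (\<lambda>i j. (if i = j then x else 0) + - B i j)"
proof -
  have fI: "finite I" using I finite_subset by blast
  have c: "{i. i < n \<and> i \<in> I} = I" using I by auto
  have p: "pick I i < n" if "i < card I" for i
    using pick_bij_betw[OF fI] that I by (auto simp: bij_betw_def)
  have "submatrix (mat n n (\<lambda>(i, j). B i j)) I I = mat (card I) (card I) (\<lambda>(i, j). B (pick I i) (pick I j))"
    unfolding submatrix_def by (rule eq_matI) (auto simp: c p)
  then show ?thesis using char_poly_mdet[OF fI pick_bij_betw[OF fI], of B x] by simp
qed

lemma char_poly_mat: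
  fixes B :: "nat \<Rightarrow> nat \<Rightarrow> 'a :: field"
  shows "poly (char_poly (mat n n (\<lambda>(i, j). B i j))) x = mdet {..<n} (\<lambda>i j. (if i = j then x else 0) + - B i j)"
  using char_poly_mdet[of "{..<n}" id B x] by (simp add: bij_betw_def atLeast0LessThan)

section \<open>From ordered partitions to sums over disjoint pairs\<close>

lemma sum_ordered_partitions_2:
  fixes g :: "nat \<Rightarrow> nat set \<Rightarrow> 'a :: comm_ring_1"
  shows "(\<Sum>S\<in>ordered_partitions 2 n. \<Prod>j<2. g j (S j)) = (\<Sum>I\<in>Pow {..<n}. g 0 I * g 1 ({..<n} - I))"
proof (rule sum.reindex_bij_witness[where j = "\<lambda>S. S 0" and i = "\<lambda>I. restrict (\<lambda>j. if j = (0 :: nat) then I else {..<n} - I) {..<2}"])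
  have two: "{..<2} = {0, 1 :: nat}" by auto
  fix S assume S: "S \<in> ordered_partitions 2 n"
  have "disjoint_family_on S {..<2}" "(\<Union>j<2. S j) = {..<n}" and ext: "S \<in> extensional {..<2}"
    using S by (simp_all add: ordered_partitions_def PiE_def)
  then have S01: "S 0 \<inter> S 1 = {}" "S 0 \<union> S 1 = {..<n}"
    using disjoint_family_onD[of S "{..<2}" 0 1] by (simp_all add: two)
  then have S1: "S 1 = {..<n} - S 0" by blast
  show "restrict (\<lambda>j. if j = (0 :: nat) then S 0 else {..<n} - S 0) {..<2} = S"
  proof
    fix j show "restrict (\<lambda>j. if j = (0 :: nat) then S 0 else {..<n} - S 0) {..<2} j = S j"
    proof (cases "j < 2")
      case True
      then have "j = 0 \<or> j = 1" by auto
      then show ?thesis using S1 by (elim disjE) simp_all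
    next
      case False
      then show ?thesis using ext by (simp add: extensional_def)
    qed
  qed
  show "S 0 \<in> Pow {..<n}" using S01(2) by blast
  show "g 0 (S 0) * g 1 ({..<n} - S 0) = (\<Prod>j<2. g j (S j))" unfolding two S1[symmetric] by simp
next
  have two: "{..<2} = {0, 1 :: nat}" by auto
  fix I assume I: "I \<in> Pow {..<n}"
  show "restrict (\<lambda>j. if j = (0 :: nat) then I else {..<n} - I) {..<2} 0 = I" by simp
  show "restrict (\<lambda>j. if j = (0 :: nat) then I else {..<n} - I) {..<2} \<in> ordered_partitions 2 n"
  proof -
    have "(\<Union>j<2. restrict (\<lambda>j. if j = (0 :: nat) then I else {..<n} - I) {..<2} j) = {..<n}"
      using I by (auto simp: two)
    moreover have "restrict (\<lambda>j. if j = (0 :: nat) then I else {..<n} - I) {..<2} \<in> {..<2} \<rightarrow>\<^sub>E Pow {..<n}"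
      using I by (intro restrict_PiE_iff[THEN iffD2]) simp
    ultimately show ?thesis
      unfolding ordered_partitions_def by (auto simp: disjoint_family_on_def two)
  qed
qed

lemma subset_poly_insert:
  assumes "finite I" "k \<notin> I"
  shows "subset_poly c (insert k I) (\<lambda>_. x) = x * subset_poly c I (\<lambda>_. x) + subset_poly (\<lambda>K. c (insert k K)) I (\<lambda>_. x)"
proof -
  have "insert k I - K = insert k (I - K)" "k \<notin> I - K" "finite (I - K)" if "K \<in> Pow I" for K using that assms by auto
  moreover have "insert k I - insert k K = I - K" if "K \<in> Pow I" for K using that assms by auto
  ultimately show ?thesis
    unfolding subset_poly_def sum_Pow_insert[OF assms] sum_distrib_left
    by (intro arg_cong2[where f = "(+)"] sum.cong refl) simp_all
qed

text \<open>After expanding both factors, a vertex outside the two chosen sets may lie in either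
  part of the partition and so receives the weight \<open>2 * x\<close>; every other vertex has its
  part determined.\<close>

lemma sum_split_subset_poly:
  fixes x :: "'a :: real_field"
  assumes "finite V"
  shows "(\<Sum>I\<in>Pow V. subset_poly c I (\<lambda>_. x) * subset_poly c' (V - I) (\<lambda>_. x)) = pair_sum c c' V (\<lambda>_. 2 * x) (\<lambda>_. 1) (\<lambda>_. 1) (\<lambda>_. 0)"
  using assms
proof (induction V arbitrary: c c' rule: finite_induct)
  case empty
  show ?case by (simp add: subset_poly_def pair_sum_def)
next
  case (insert k U)
  let ?S = "\<lambda>c c'. \<Sum>I\<in>Pow U. subset_poly c I (\<lambda>_. x) * subset_poly c' (U - I) (\<lambda>_. x)"
  let ?c = "\<lambda>I. c (insert k I)" and ?c' = "\<lambda>I. c' (insert k I)"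
  have a: "insert k U - I = insert k (U - I)" "insert k U - insert k I = U - I" "finite I" "k \<notin> I" "finite (U - I)" "k \<notin> U - I"
    if "I \<in> Pow U" for I using that insert.hyps finite_subset by auto
  have "(\<Sum>I\<in>Pow (insert k U). subset_poly c I (\<lambda>_. x) * subset_poly c' (insert k U - I) (\<lambda>_. x))
    = (\<Sum>I\<in>Pow U. x * (subset_poly c I (\<lambda>_. x) * subset_poly c' (U - I) (\<lambda>_. x)) + subset_poly c I (\<lambda>_. x) * subset_poly ?c' (U - I) (\<lambda>_. x))
     + (\<Sum>I\<in>Pow U. x * (subset_poly c I (\<lambda>_. x) * subset_poly c' (U - I) (\<lambda>_. x)) + subset_poly ?c I (\<lambda>_. x) * subset_poly c' (U - I) (\<lambda>_. x))"
    unfolding sum_Pow_insert[OF insert.hyps]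
    by (intro arg_cong2[where f = "(+)"] sum.cong refl) (simp_all add: a subset_poly_insert[OF a(3,4)] subset_poly_insert[OF a(5,6)] algebra_simps)
  also have "\<dots> = 2 * x * ?S c c' + ?S ?c c' + ?S c ?c'"
    unfolding sum.distrib sum_distrib_left[symmetric] by (simp add: algebra_simps)
  also have "\<dots> = pair_sum c c' (insert k U) (\<lambda>_. 2 * x) (\<lambda>_. 1) (\<lambda>_. 1) (\<lambda>_. 0)"
    unfolding insert.IH pair_sum_insert[OF insert.hyps] by simp
  finally show ?case .
qed

lemma subset_poly_minor:
  assumes "finite S"
  shows "subset_poly (\<lambda>I. mdet I (\<lambda>i j. r * B i j)) S (\<lambda>_. x :: 'a :: real_field)
    = mdet S (\<lambda>i j. (if i = j then x else 0) + of_real (r * B i j))"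
  unfolding mdet_diag_expand[OF assms] subset_poly_def mdet_of_real ..

lemma mixed_det_poly_disjoint_sum:
  fixes x :: "'a :: real_field" and n :: nat and B :: "nat \<Rightarrow> nat \<Rightarrow> real"
  defines "M \<equiv> mat n n (\<lambda>(i, j). of_real (B i j) :: 'a)"
  shows "poly (mixed_det_poly n [M, - M]) x = inverse (2 ^ n) * disjoint_sum B {..<n} (\<lambda>_. 2 * x)"
proof -
  have uM: "- M = mat n n (\<lambda>(i, j). - of_real (B i j) :: 'a)" unfolding M_def by (rule eq_matI) auto
  have len: "length [M, - M] = 2" by simp
  define g where "g j I = poly (char_poly (submatrix ([M, - M] ! j) I I)) x" for j I
  have g: "g 0 I = subset_poly (minor_neg B) I (\<lambda>_. x)" "g 1 I = subset_poly (minor_pos B) I (\<lambda>_. x)" if "I \<subseteq> {..<n}" for I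
  proof -
    have fI: "finite I" using that finite_subset by blast
    show "g 0 I = subset_poly (minor_neg B) I (\<lambda>_. x)"
      unfolding subset_poly_minor[OF fI] g_def using char_poly_submatrix[OF that, of "\<lambda>i j. of_real (B i j) :: 'a" x] by (simp add: M_def)
    show "g 1 I = subset_poly (minor_pos B) I (\<lambda>_. x)"
      unfolding subset_poly_minor[OF fI] g_def using char_poly_submatrix[OF that, of "\<lambda>i j. - of_real (B i j) :: 'a" x] by (simp add: uM)
  qed
  have "poly (mixed_det_poly n [M, - M]) x = inverse (2 ^ n) * (\<Sum>S\<in>ordered_partitions 2 n. \<Prod>j<2. g j (S j))"
    unfolding mixed_det_poly_def len by (simp add: poly_sum poly_prod g_def)
  also have "(\<Sum>S\<in>ordered_partitions 2 n. \<Prod>j<2. g j (S j)) = (\<Sum>I\<in>Pow {..<n}. g 0 I * g 1 ({..<n} - I))"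
    by (rule sum_ordered_partitions_2)
  also have "\<dots> = (\<Sum>I\<in>Pow {..<n}. subset_poly (minor_neg B) I (\<lambda>_. x) * subset_poly (minor_pos B) ({..<n} - I) (\<lambda>_. x))"
    by (rule sum.cong) (auto simp: g[unfolded One_nat_def])
  also have "\<dots> = disjoint_sum B {..<n} (\<lambda>_. 2 * x)"
    unfolding disjoint_sum_def by (rule sum_split_subset_poly) simp
  finally show ?thesis .
qed

lemma subset_poly_uminus:
  assumes "finite S"
  shows "subset_poly (\<lambda>I. mdet I (\<lambda>i j. r * B i j)) S (\<lambda>_. - x :: 'a :: real_field)
    = (- 1) ^ card S * subset_poly (\<lambda>I. mdet I (\<lambda>i j. (- r) * B i j)) S (\<lambda>_. x)"
  unfolding subset_poly_minor[OF assms] mdet_uminus[OF assms, symmetric]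
  by (rule mdet_cong) auto

text \<open>Negating the variable exchanges the minors of \<open>B\<close> and \<open>- B\<close> up
  to sign, and passing to complements exchanges them back. The root set is therefore
  symmetric.\<close>

lemma disjoint_sum_uminus:
  fixes y :: real
  assumes V: "finite V"
  shows "disjoint_sum B V (\<lambda>_. - y) = (- 1) ^ card V * disjoint_sum B V (\<lambda>_. y)"
proof -
  define x where "x = y / 2"
  have "disjoint_sum B V (\<lambda>_. - y) = (\<Sum>I\<in>Pow V. subset_poly (minor_neg B) I (\<lambda>_. - x) * subset_poly (minor_pos B) (V - I) (\<lambda>_. - x))"
    unfolding disjoint_sum_def sum_split_subset_poly[OF V] x_def by simp
  also have "\<dots> = (\<Sum>I\<in>Pow V. (- 1) ^ card V * (subset_poly (minor_pos B) I (\<lambda>_. x) * subset_poly (minor_neg B) (V - I) (\<lambda>_. x)))"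
  proof (rule sum.cong[OF refl])
    fix I assume I: "I \<in> Pow V"
    then have f: "finite I" "finite (V - I)" using V finite_subset by auto
    have "card I + card (V - I) = card V" using I V card_mono[of V I] by (simp add: card_Diff_subset f)
    then have "(- 1 :: real) ^ card I * (- 1) ^ card (V - I) = (- 1) ^ card V" by (simp only: power_add[symmetric])
    then show "subset_poly (minor_neg B) I (\<lambda>_. - x) * subset_poly (minor_pos B) (V - I) (\<lambda>_. - x)
      = (- 1) ^ card V * (subset_poly (minor_pos B) I (\<lambda>_. x) * subset_poly (minor_neg B) (V - I) (\<lambda>_. x))"
      unfolding subset_poly_uminus[OF f(1)] subset_poly_uminus[OF f(2)] by (simp add: mult_ac)
  qed
  also have "\<dots> = (- 1) ^ card V * (\<Sum>I\<in>Pow V. subset_poly (minor_pos B) I (\<lambda>_. x) * subset_poly (minor_neg B) (V - I) (\<lambda>_. x))"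
    by (simp only: sum_distrib_left)
  also have "(\<Sum>I\<in>Pow V. subset_poly (minor_pos B) I (\<lambda>_. x) * subset_poly (minor_neg B) (V - I) (\<lambda>_. x))
    = (\<Sum>I\<in>Pow V. subset_poly (minor_neg B) I (\<lambda>_. x) * subset_poly (minor_pos B) (V - I) (\<lambda>_. x))"
    by (rule sum.reindex_bij_witness[where i = "\<lambda>I. V - I" and j = "\<lambda>I. V - I"]) (auto simp: double_diff)
  also have "\<dots> = disjoint_sum B V (\<lambda>_. y)" unfolding disjoint_sum_def sum_split_subset_poly[OF V] x_def by simp
  finally show ?thesis .
qed

text \<open>\<open>max_root\<close> takes a \<open>Max\<close>, whose set must be nonempty. The
  fundamental theorem of algebra supplies a complex root, and stability in both half-planes forces
  it to be real.\<close>

lemma disjoint_sum_real_root_exists: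
  assumes n: "n \<ge> 1" and sym: "\<And>i j. B i j = B j i" and diag: "\<And>i. B i i = 0"
  shows "\<exists>y. disjoint_sum B {..<n} (\<lambda>_. y) = (0 :: real)"
proof (rule ccontr)
  assume no: "\<not> ?thesis"
  define q where "q = mixed_det_poly n [mat n n (\<lambda>(i, j). complex_of_real (B i j)), - mat n n (\<lambda>(i, j). complex_of_real (B i j))]"
  have q: "poly q z = inverse (2 ^ n) * disjoint_sum B {..<n} (\<lambda>_. 2 * z)" for z unfolding q_def by (rule mixed_det_poly_disjoint_sum)
  have re: "disjoint_sum B {..<n} (\<lambda>_. complex_of_real y) = of_real (disjoint_sum B {..<n} (\<lambda>_. y))" for y
    using relaxed_sum_of_real[of B "\<lambda>_. 0" "{..<n}" "[]" "\<lambda>_. y", where 'a = complex] by simp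
  have cj: "disjoint_sum B {..<n} (\<lambda>_. cnj z) = cnj (disjoint_sum B {..<n} (\<lambda>_. z))" for z
    using relaxed_sum_cnj[of B "\<lambda>_. 0" "{..<n}" "[]" "\<lambda>_. z"] by simp
  have "disjoint_sum B {..<n} (\<lambda>_. z) \<noteq> 0" for z :: complex
  proof -
    consider "Im z > 0" | "Im (cnj z) > 0" | "z = of_real (Re z)" by (force simp: complex_eq_iff)
    then show ?thesis
    proof cases
      case 1
      then show ?thesis using disjoint_sum_nonzero[of "{..<n}" B "\<lambda>_. z"] sym diag by simp
    next
      case 2
      then have "disjoint_sum B {..<n} (\<lambda>_. cnj z) \<noteq> 0" using disjoint_sum_nonzero[of "{..<n}" B "\<lambda>_. cnj z"] sym diag by simp
      then show ?thesis unfolding cj by simp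
    next
      case 3
      have "disjoint_sum B {..<n} (\<lambda>_. complex_of_real (Re z)) \<noteq> 0" unfolding re using no by simp
      then show ?thesis using 3 by simp
    qed
  qed
  then have "constant (poly q)" using fundamental_theorem_of_algebra[of q] unfolding q by fastforce
  then have "poly q (of_real (y / 2)) = poly q 0" for y unfolding constant_def by blast
  then have "disjoint_sum B {..<n} (\<lambda>_. 2 * complex_of_real (y / 2)) = disjoint_sum B {..<n} (\<lambda>_. 2 * 0)" for y unfolding q by simp
  then have "complex_of_real (disjoint_sum B {..<n} (\<lambda>_. y)) = of_real (disjoint_sum B {..<n} (\<lambda>_. 0))" for y
    using re[of y] re[of 0] by simp
  then have const: "disjoint_sum B {..<n} (\<lambda>_. y) = disjoint_sum B {..<n} (\<lambda>_. 0)" for y :: real by (simp only: of_real_eq_iff)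
  have "((\<lambda>y. disjoint_sum B {..<n} (\<lambda>_. y) / y ^ n) \<longlongrightarrow> 1) (at_top :: real filter)"
    using disjoint_sum_limit[of "{..<n}" "minor_neg B" "minor_pos B"] by (simp add: disjoint_sum_def)
  also have "(\<lambda>y :: real. disjoint_sum B {..<n} (\<lambda>_. y) / y ^ n) = (\<lambda>y. disjoint_sum B {..<n} (\<lambda>_. 0) / y ^ n)"
    by (intro ext arg_cong2[where f = "(/)"] const refl)
  finally have "((\<lambda>y. disjoint_sum B {..<n} (\<lambda>_. 0) / y ^ n) \<longlongrightarrow> 1) (at_top :: real filter)" .
  moreover have "((\<lambda>y. disjoint_sum B {..<n} (\<lambda>_. 0) / y ^ n) \<longlongrightarrow> 0) (at_top :: real filter)"
    using n by (intro real_tendsto_divide_at_top tendsto_const filterlim_pow_at_top filterlim_ident) auto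
  ultimately show False using tendsto_unique[OF trivial_limit_at_top_linorder] zero_neq_one by blast
qed

text \<open>Roots of the mixed polynomial are halves of roots of \<open>disjoint_sum\<close>, whence
  \<open>4 * b\<close>. The second direction uses the symmetry of the roots: the largest one is
  nonnegative, so a bound on it also bounds its square.\<close>

lemma mixed_root_bounds:
  fixes B :: "nat \<Rightarrow> nat \<Rightarrow> real" and n :: nat
  defines "M \<equiv> mat n n (\<lambda>(i, j). B i j)"
  assumes n: "n \<ge> 1" and sym: "\<And>i j. B i j = B j i" and diag: "\<And>i. B i i = 0" and b: "b \<ge> 0"
  shows "(mixed_root n M)\<^sup>2 \<le> b \<Longrightarrow> y > 0 \<Longrightarrow> y\<^sup>2 > 4 * b \<Longrightarrow> disjoint_sum B {..<n} (\<lambda>_. y) > 0"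
    and "(\<And>y. y > 0 \<Longrightarrow> y\<^sup>2 > 4 * b \<Longrightarrow> disjoint_sum B {..<n} (\<lambda>_. y) > 0) \<Longrightarrow> (mixed_root n M)\<^sup>2 \<le> b"
proof -
  define q where "q = mixed_det_poly n [M, - M]"
  define T where "T y = disjoint_sum B {..<n} (\<lambda>_. y)" for y :: real
  have q: "poly q x = inverse (2 ^ n) * T (2 * x)" for x
    using mixed_det_poly_disjoint_sum[of n B x] by (simp add: q_def M_def T_def)
  have ev: "\<forall>\<^sub>F y in at_top. T y > 0"
    using relaxed_sum_eventually_pos[of "{..<n}" "[]" B "\<lambda>_. 0"] by (simp add: T_def)
  then obtain N where N: "\<And>y. y \<ge> N \<Longrightarrow> T y > 0" by (auto simp: eventually_at_top_linorder)
  have "poly q (N / 2) \<noteq> 0" using N[of N] unfolding q by simp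
  then have fin: "finite {x. poly q x = 0}" by (intro poly_roots_finite) auto
  have r: "mixed_root n M = Max {x. poly q x = 0}" by (simp add: mixed_root_def max_root_def q_def)
  have cont: "continuous_on S T" for S
  proof -
    have "T y = 2 ^ n * poly q (y / 2)" for y using q[of "y / 2"] by simp
    then have "T = (\<lambda>y. 2 ^ n * poly q (y / 2))" by auto
    then show ?thesis by (simp only:) (intro continuous_intros, simp)
  qed
  show "disjoint_sum B {..<n} (\<lambda>_. y) > 0" if r2: "(mixed_root n M)\<^sup>2 \<le> b" and y: "y > 0" "y\<^sup>2 > 4 * b"
  proof (rule ccontr)
    assume "\<not> ?thesis"
    then have "T y \<le> 0" by (simp add: T_def)
    moreover have "0 \<le> T (max y N)" using N[of "max y N"] by simp
    ultimately have "\<exists>x\<ge>y. x \<le> max y N \<and> T x = 0" using cont by (intro IVT') auto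
    then obtain x where x: "x \<ge> y" "T x = 0" by blast
    then have "x / 2 \<in> {x. poly q x = 0}" by (simp add: q)
    then have "x / 2 \<le> mixed_root n M" unfolding r using fin by (intro Max_ge) auto
    then have "y / 2 \<le> mixed_root n M" using x(1) by simp
    then have "(y / 2)\<^sup>2 \<le> (mixed_root n M)\<^sup>2" using y(1) by (intro power_mono) auto
    then have "y\<^sup>2 \<le> 4 * b" using r2 by (simp add: power_divide)
    then show False using y(2) by simp
  qed
  show "(mixed_root n M)\<^sup>2 \<le> b" if pos: "\<And>y. y > 0 \<Longrightarrow> y\<^sup>2 > 4 * b \<Longrightarrow> disjoint_sum B {..<n} (\<lambda>_. y) > 0"
  proof -
    have "\<exists>y. T y = 0" unfolding T_def by (rule disjoint_sum_real_root_exists[OF n]) (rule sym, rule diag)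
    then obtain y where y: "T y = 0" by blast
    have "T (- y) = 0" using y disjoint_sum_uminus[of "{..<n}" B y] by (simp add: T_def)
    then have "T \<bar>y\<bar> = 0" using y by (auto simp: abs_if)
    then have y2: "\<bar>y\<bar> / 2 \<in> {x. poly q x = 0}" by (simp add: q)
    have mem: "mixed_root n M \<in> {x. poly q x = 0}" unfolding r by (rule Max_in[OF fin]) (use y2 in blast)
    have "\<bar>y\<bar> / 2 \<le> mixed_root n M" unfolding r by (rule Max_ge[OF fin y2])
    then have r0: "mixed_root n M \<ge> 0" using abs_ge_zero[of y] by linarith
    define \<rho> where "\<rho> = mixed_root n M"
    have z: "T (2 * \<rho>) = 0" using mem by (simp add: q \<rho>_def)
    have "\<not> (2 * \<rho> > 0 \<and> (2 * \<rho>)\<^sup>2 > 4 * b)" using pos[of "2 * \<rho>"] z by (auto simp: T_def)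
    then have "\<rho>\<^sup>2 \<le> b" using r0 b by (cases "\<rho> = 0") (auto simp: \<rho>_def power_mult_distrib)
    then show ?thesis by (simp add: \<rho>_def)
  qed
qed

text \<open>\<open>((3 + sqrt 5) / 2)^2 = (7 + 3 * sqrt 5) / 2\<close>, which exceeds 6.854 as soon
  as \<open>sqrt 5 > 2.236\<close>.\<close>

lemma less_golden_bound:
  assumes x: "x\<^sup>2 \<le> 68538 / 10000 * t" and t: "t > 0"
  shows "x < (3 + sqrt 5) / 2 * sqrt t"
proof -
  have "sqrt 5 > 2236 / 1000" by (rule real_less_rsqrt) (simp add: power2_eq_square)
  then have "((3 + sqrt 5) / 2)\<^sup>2 > 68538 / 10000" by (simp add: power2_eq_square field_simps)
  then have "x\<^sup>2 < ((3 + sqrt 5) / 2)\<^sup>2 * t" using x t by (meson le_less_trans mult_strict_right_mono)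
  also have "\<dots> = ((3 + sqrt 5) / 2 * sqrt t)\<^sup>2" unfolding power_mult_distrib using t by simp
  finally show ?thesis by (rule power2_less_imp_less) (use t in simp)
qed

section \<open>Eigenvalues of the signed adjacency matrix\<close>

context signed_regular
begin

lemma cm_minor: "cm = minor_neg A" "cp = minor_pos A"
  by (auto simp: cm_def cp_def fun_eq_iff)

lemma pX_0: "pX 0 y = y ^ card V * disjoint_sum A V (\<lambda>_. y)"
proof -
  have "(\<Prod>i\<in>V. pair_wt (\<lambda>_. y\<^sup>2) (\<lambda>_. y) (\<lambda>_. y) (\<lambda>_. of_real 0) I J i)
    = y ^ card V * (\<Prod>i\<in>V. pair_wt (\<lambda>_. y) (\<lambda>_. 1) (\<lambda>_. 1) (\<lambda>_. 0) I J i)" for I J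
  proof -
    have "(\<Prod>i\<in>V. pair_wt (\<lambda>_. y\<^sup>2) (\<lambda>_. y) (\<lambda>_. y) (\<lambda>_. of_real 0) I J i) = (\<Prod>i\<in>V. y * pair_wt (\<lambda>_. y) (\<lambda>_. 1) (\<lambda>_. 1) (\<lambda>_. 0) I J i)"
      by (rule prod.cong) (auto simp: pair_wt_def power2_eq_square)
    then show ?thesis by (simp add: prod.distrib)
  qed
  then show ?thesis
    unfolding pair_poly_def disjoint_sum_def pair_sum_def cm_minor sum_distrib_left by (intro sum.cong refl) simp
qed

lemma pX_1: "pX 1 y = mdet V (\<lambda>i j. (if i = j then y else 0) + - A i j) * mdet V (\<lambda>i j. (if i = j then y else 0) + A i j)"
proof -
  have "pX 1 y = pair_sum cm cp V (\<lambda>i. y * y) (\<lambda>_. y) (\<lambda>_. y) (\<lambda>_. 1)"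
    by (simp add: pair_poly_def power2_eq_square)
  also have "\<dots> = subset_poly cm V (\<lambda>_. y) * subset_poly cp V (\<lambda>_. y)" by (rule pair_sum_product[OF finV])
  finally show ?thesis
    unfolding cm_minor using subset_poly_minor[OF finV, of "- 1" A y] subset_poly_minor[OF finV, of 1 A y] by simp
qed

text \<open>Stability excludes roots in the upper half-plane for \<open>- A\<close>, and those in
  the lower one by applying it to \<open>- l\<close> and \<open>A\<close>.\<close>

lemma eigenvalue_real:
  assumes l: "mdet V (\<lambda>i j. (if i = j then l else 0) + - complex_of_real (A i j)) = 0"
  obtains x where "l = of_real x" "mdet V (\<lambda>i j. (if i = j then x else 0) + - A i j) = 0"
proof -
  have st: "mdet V (\<lambda>i j. (if i = j then z else 0) + complex_of_real (r * A i j)) \<noteq> 0" if "Im z > 0" for z r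
    by (rule mdet_stable[OF finV, where k = 0]) (use that sym in \<open>auto simp: complex_eq_iff\<close>)
  have "\<not> Im l > 0" using st[of l "- 1"] l by auto
  moreover have "\<not> Im l < 0"
  proof
    assume "Im l < 0"
    then have "mdet V (\<lambda>i j. (if i = j then - l else 0) + complex_of_real (1 * A i j)) \<noteq> 0" by (intro st) simp
    moreover have "mdet V (\<lambda>i j. (if i = j then - l else 0) + complex_of_real (1 * A i j))
      = mdet V (\<lambda>i j. - ((if i = j then l else 0) + - complex_of_real (A i j)))" by (rule mdet_cong) auto
    ultimately show False unfolding mdet_uminus[OF finV] l by simp
  qed
  ultimately have x: "l = of_real (Re l)" by (simp add: complex_eq_iff)
  have "mdet V (\<lambda>i j. (if i = j then l else 0) + - complex_of_real (A i j))
      = mdet V (\<lambda>i j. complex_of_real ((if i = j then Re l else 0) + - A i j))"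
    by (rule mdet_cong) (subst x, auto)
  then have "mdet V (\<lambda>i j. (if i = j then Re l else 0) + - A i j) = 0" using l unfolding mdet_of_real by simp
  with x show ?thesis by (rule that)
qed

lemma eigenvalue_bound:
  assumes D: "D \<ge> 6" and l: "mdet V (\<lambda>i j. (if i = j then l else 0) + - A i j) = 0"
    and T: "\<And>y. y > 0 \<Longrightarrow> y\<^sup>2 > 8 * (D - 1) \<Longrightarrow> disjoint_sum A V (\<lambda>_. y) > 0"
  shows "\<bar>l\<bar>\<^sup>2 \<le> 68538 / 10000 * (D - 1)"
proof (rule ccontr)
  assume "\<not> ?thesis"
  then have big: "\<bar>l\<bar>\<^sup>2 > 68538 / 10000 * (D - 1)" by simp
  define t where "t = 5 / (D - 1)"
  \<comment> \<open>At \<open>X = 0\<close> the flow inequality allows \<open>fA\<close> up to about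
    \<open>5714 / (1 + t / 5)\<close>; the linear choice \<open>5695 * (1 - t / 5)\<close> stays
    below.\<close>
  define fA where "fA = 5695 - 1139 * t"
  define fB where "fB = 90 + 2270 * t"
  \<comment> \<open>\<open>fq 0 = 80010\<close> starts the curve just above
    \<open>8 * (D - 1)\<close>. At the end \<open>fq 1 = 68530 + 8 * t \<le> 68538\<close>, below
    \<open>10000 * ((3 + sqrt 5) / 2)^2 = 68541.0...\<close>.\<close>
  define fq where "fq X = 80010 - 2 * fA * X - fB * (X * X)" for X
  define Y where "Y X = sqrt ((D - 1) * fq X / 10000)" for X
  have t: "0 \<le> t" "t \<le> 1" using D by (auto simp: t_def field_simps)
  have "pX 1 \<bar>l\<bar> > 0"
  proof (rule flow[OF D t_def fA_def fB_def fq_def Y_def])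
    fix y assume y: "y \<ge> Y 0"
    have Y0: "(Y 0)\<^sup>2 = 80010 / 10000 * (D - 1)" "Y 0 > 0" using D by (auto simp: Y_def fq_def)
    have "y\<^sup>2 \<ge> (Y 0)\<^sup>2" using y Y0(2) by (intro power_mono) auto
    moreover have "8 * (D - 1) < (Y 0)\<^sup>2" unfolding Y0(1) using D by simp
    ultimately have "y\<^sup>2 > 8 * (D - 1)" by (rule less_le_trans[rotated])
    moreover have "y > 0" using y Y0(2) by linarith
    ultimately show "pX 0 y > 0" unfolding pX_0 using T by simp
  next
    have "fq 1 \<le> 68538" using t by (simp add: fq_def fA_def fB_def)
    then have "(D - 1) * fq 1 / 10000 \<le> \<bar>l\<bar>\<^sup>2"
      using big D mult_left_mono[of "fq 1" 68538 "D - 1"] by simp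
    then show "Y 1 \<le> \<bar>l\<bar>" unfolding Y_def by (intro real_le_lsqrt) auto
  qed simp_all
  \<comment> \<open>The factor for \<open>A\<close> in \<open>pX 1\<close> takes care of negative
    eigenvalues.\<close>
  moreover have "pX 1 \<bar>l\<bar> = 0"
  proof (cases "l \<ge> 0")
    case True
    show ?thesis unfolding pX_1 abs_of_nonneg[OF True] l by simp
  next
    case False
    have "mdet V (\<lambda>i j. (if i = j then \<bar>l\<bar> else 0) + A i j) = mdet V (\<lambda>i j. - ((if i = j then l else 0) + - A i j))"
      using False by (intro mdet_cong) auto
    also have "\<dots> = 0" unfolding mdet_uminus[OF finV] l by simp
    finally show ?thesis unfolding pX_1 by simp
  qed
  ultimately show False by simp
qed

end

text \<open>Compare the eigenvalue equation at a coordinate of maximal modulus with the row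
  sum.\<close>

lemma eigenvalue_le_degree:
  fixes B :: "nat \<Rightarrow> nat \<Rightarrow> real"
  assumes ev: "eigenvalue (mat n n (\<lambda>(i, j). complex_of_real (B i j))) l"
    and row: "\<And>i. i < n \<Longrightarrow> (\<Sum>j<n. \<bar>B i j\<bar>) \<le> D"
  shows "norm l \<le> D"
proof -
  let ?M = "mat n n (\<lambda>(i, j). complex_of_real (B i j))"
  obtain v where v: "v \<in> carrier_vec n" "v \<noteq> 0\<^sub>v n" "?M *\<^sub>v v = l \<cdot>\<^sub>v v"
    using ev unfolding eigenvalue_def eigenvector_def by auto
  obtain i0 where i0: "i0 < n" "vec_index v i0 \<noteq> 0"
  proof -
    have "\<exists>i<n. vec_index v i \<noteq> 0"
    proof (rule ccontr)
      assume "\<not> ?thesis"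
      then have "v = 0\<^sub>v n" using v(1) by (intro eq_vecI) auto
      then show False using v(2) by simp
    qed
    then show ?thesis using that by blast
  qed
  define m where "m = Max ((\<lambda>i. norm (vec_index v i)) ` {..<n})"
  have fin: "finite ((\<lambda>i. norm (vec_index v i)) ` {..<n})" "(\<lambda>i. norm (vec_index v i)) ` {..<n} \<noteq> {}" using i0 by auto
  have mle: "norm (vec_index v j) \<le> m" if "j < n" for j unfolding m_def using fin that by (intro Max_ge) auto
  have "m \<in> (\<lambda>i. norm (vec_index v i)) ` {..<n}" unfolding m_def using fin by (rule Max_in)
  then obtain i where i: "i < n" "m = norm (vec_index v i)" by auto
  have m0: "m > 0" using mle[OF i0(1)] i0(2) by (metis less_le_trans zero_less_norm_iff)
  have "l * vec_index v i = vec_index (?M *\<^sub>v v) i" unfolding v(3) using v(1) i(1) by simp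
  also have "\<dots> = (\<Sum>j<n. of_real (B i j) * vec_index v j)"
    using v(1) i(1) by (simp add: scalar_prod_def atLeast0LessThan)
  finally have "norm l * m = norm (\<Sum>j<n. of_real (B i j) * vec_index v j)" by (simp add: i(2) norm_mult[symmetric])
  also have "\<dots> \<le> (\<Sum>j<n. \<bar>B i j\<bar> * m)"
    by (rule sum_norm_le) (auto simp: norm_mult intro!: mult_left_mono mle)
  also have "\<dots> = (\<Sum>j<n. \<bar>B i j\<bar>) * m" by (simp add: sum_distrib_right)
  also have "\<dots> \<le> D * m" using row[OF i(1)] m0 by (intro mult_right_mono) auto
  finally show ?thesis using m0 by simp
qed

lemma signed_regular_graph:
  assumes G: "regular_graph d n E" and \<sigma>: "\<sigma> \<in> edge_signings E"
  shows "signed_regular (\<lambda>i j. if {i, j} \<in> E then \<sigma> {i, j} else 0) {..<n} (real d)"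
proof
  let ?A = "\<lambda>i j. if {i, j} \<in> E then \<sigma> {i, j} else 0"
  have E: "e \<subseteq> {..<n}" "card e = 2" if "e \<in> E" for e using G that by (auto simp: regular_graph_def simple_graph_def)
  have s: "\<sigma> e \<in> {-1, 1}" if "e \<in> E" for e using \<sigma> that by (auto simp: edge_signings_def)
  show "finite {..<n}" by simp
  show "?A i j = ?A j i" for i j by (simp add: insert_commute)
  show "?A i i = 0" for i using E(2)[of "{i}"] by auto
  show "?A i j \<in> {-1, 0, 1}" for i j using s[of "{i, j}"] by auto
  fix i assume i: "i \<in> {..<n}"
  have "(\<Sum>j<n. (?A i j)\<^sup>2) = (\<Sum>j<n. if {i, j} \<in> E then 1 else 0)"
    by (rule sum.cong) (use s in fastforce)+
  also have "\<dots> = real (card {j. j < n \<and> {i, j} \<in> E})" by (simp add: sum.If_cases lessThan_def Collect_conj_eq[symmetric])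
  also have "card {j. j < n \<and> {i, j} \<in> E} = card {e \<in> E. i \<in> e}"
  proof (rule bij_betw_same_card[of "\<lambda>j. {i, j}"])
    show "bij_betw (\<lambda>j. {i, j}) {j. j < n \<and> {i, j} \<in> E} {e \<in> E. i \<in> e}"
    proof (rule bij_betw_imageI)
      show "inj_on (\<lambda>j. {i, j}) {j. j < n \<and> {i, j} \<in> E}" by (auto simp: inj_on_def doubleton_eq_iff)
      show "(\<lambda>j. {i, j}) ` {j. j < n \<and> {i, j} \<in> E} = {e \<in> E. i \<in> e}"
      proof (intro equalityI subsetI)
        fix e assume e: "e \<in> {e \<in> E. i \<in> e}"
        then obtain j where "e = {i, j}" using E(2)[of e] by (auto simp: card_2_iff)
        then show "e \<in> (\<lambda>j. {i, j}) ` {j. j < n \<and> {i, j} \<in> E}" using e E(1)[of e] by auto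
      qed auto
    qed
  qed
  also have "real \<dots> = real d" using G i by (simp add: regular_graph_def)
  finally show "(\<Sum>j<n. (?A i j)\<^sup>2) = real d" .
qed

lemma spectral_radius_signing:
  assumes n: "n \<ge> 1" and d: "d \<ge> 2" and G: "regular_graph d n E" and \<sigma>: "\<sigma> \<in> edge_signings E"
    and r: "(mixed_root n (signed_adj_mat n E \<sigma>))\<^sup>2 \<le> 2 * (real d - 1)"
  shows "real_spectral_radius (signed_adj_mat n E \<sigma>) < (3 + sqrt 5) / 2 * sqrt (real d - 1)"
proof -
  define A where "A i j = (if {i, j} \<in> E then \<sigma> {i, j} else 0)" for i j
  interpret signed_regular A "{..<n}" "real d"
    unfolding A_def[abs_def] by (rule signed_regular_graph[OF G \<sigma>])
  have Am: "signed_adj_mat n E \<sigma> = mat n n (\<lambda>(i, j). A i j)" by (simp add: signed_adj_mat_def A_def)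
  define C where "C = mat n n (\<lambda>(i, j). complex_of_real (A i j))"
  have C: "map_mat complex_of_real (signed_adj_mat n E \<sigma>) = C" unfolding Am C_def by (rule eq_matI) auto
  have Cc: "C \<in> carrier_mat n n" by (simp add: C_def)
  obtain l where l: "l \<in> spectrum C" "real_spectral_radius (signed_adj_mat n E \<sigma>) = norm l"
    using spectral_radius_mem_max(1)[OF Cc] n unfolding real_spectral_radius_def C by auto
  have ev: "eigenvalue C l" using l(1) by (simp add: spectrum_def)
  have t: "real d - 1 > 0" using d by simp
  have "(norm l)\<^sup>2 \<le> 68538 / 10000 * (real d - 1)"
  \<comment> \<open>For \<open>d\<close> from 2 to 5 the trivial bound
    \<open>d^2 \<le> 6.8538 * (d - 1)\<close> is enough; it fails at 6.\<close>
  proof (cases "d \<ge> 6")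
    case True
    have "poly (char_poly C) l = 0" using ev eigenvalue_root_char_poly[OF Cc] by simp
    then have "mdet {..<n} (\<lambda>i j. (if i = j then l else 0) + - complex_of_real (A i j)) = 0"
      unfolding C_def char_poly_mat .
    then obtain x where x: "l = of_real x" "mdet {..<n} (\<lambda>i j. (if i = j then x else 0) + - A i j) = 0"
      by (rule eigenvalue_real) (rule that)
    have "\<bar>x\<bar>\<^sup>2 \<le> 68538 / 10000 * (real d - 1)"
    proof (rule eigenvalue_bound[OF _ x(2)])
      fix y :: real assume "y > 0" "y\<^sup>2 > 8 * (real d - 1)"
      then show "disjoint_sum A {..<n} (\<lambda>_. y) > 0"
        using mixed_root_bounds(1)[where B = A and b = "2 * (real d - 1)" and y = y, OF n sym diag] r t unfolding Am by simp
    qed (use True in simp)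
    then show ?thesis using x(1) by simp
  next
    case False
    have "norm l \<le> real d"
    proof (rule eigenvalue_le_degree[OF ev[unfolded C_def]])
      fix i assume i: "i < n"
      have "(\<Sum>j<n. \<bar>A i j\<bar>) = (\<Sum>j<n. (A i j)\<^sup>2)"
      proof (rule sum.cong[OF refl])
        fix j show "\<bar>A i j\<bar> = (A i j)\<^sup>2" using signs[of i j] by auto
      qed
      then show "(\<Sum>j<n. \<bar>A i j\<bar>) \<le> real d" using row[of i] i by simp
    qed
    then have "(norm l)\<^sup>2 \<le> (real d)\<^sup>2" by (intro power_mono) auto
    moreover from False d have "d = 2 \<or> d = 3 \<or> d = 4 \<or> d = 5" by auto
    then have "(real d)\<^sup>2 \<le> 68538 / 10000 * (real d - 1)" by (elim disjE) simp_all
    ultimately show ?thesis by linarith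
  qed
  then show ?thesis unfolding l(2) using t by (rule less_golden_bound)
qed

theorem theorem1p2:
  fixes n d :: nat and E :: "nat set set"
  assumes "n \<ge> 1" and "d \<ge> 2" and "regular_graph d n E"
  shows "{\<sigma> \<in> edge_signings E. (mixed_root n (signed_adj_mat n E \<sigma>))\<^sup>2 \<le> 2 * (real d - 1)} \<noteq> {}
    \<and> Max {real_spectral_radius (signed_adj_mat n E \<sigma>) | \<sigma>.
             \<sigma> \<in> edge_signings E \<and> (mixed_root n (signed_adj_mat n E \<sigma>))\<^sup>2 \<le> 2 * (real d - 1)}
        < (3 + sqrt 5) / 2 * sqrt (real d - 1)
    \<and> (\<exists>\<sigma> \<in> edge_signings E.
         real_spectral_radius (signed_adj_mat n E \<sigma>) < (3 + sqrt 5) / 2 * sqrt (real d - 1))"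
proof -
  let ?P = "\<lambda>\<sigma>. \<sigma> \<in> edge_signings E \<and> (mixed_root n (signed_adj_mat n E \<sigma>))\<^sup>2 \<le> 2 * (real d - 1)"
  have E: "e \<subseteq> {..<n}" "card e = 2" if "e \<in> E" for e
    using assms(3) that by (auto simp: regular_graph_def simple_graph_def)
  have finE: "finite E" by (rule finite_subset[of _ "Pow {..<n}"]) (use E(1) in auto)
  have "\<exists>\<sigma>\<in>E \<rightarrow>\<^sub>E {-1, 1}. \<forall>y>0. y\<^sup>2 > 8 * (real d - 1) \<longrightarrow> disjoint_sum (\<lambda>i j. if {i, j} \<in> E then \<sigma> {i, j} else 0) {..<n} (\<lambda>_. y) > (0::real)"
    by (rule signing_exists[OF _ finE E(2)]) (use assms in \<open>auto simp: regular_graph_def\<close>)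
  then obtain \<sigma> where \<sigma>: "\<sigma> \<in> edge_signings E"
    "\<And>y. y > 0 \<Longrightarrow> y\<^sup>2 > 8 * (real d - 1) \<Longrightarrow> disjoint_sum (\<lambda>i j. if {i, j} \<in> E then \<sigma> {i, j} else 0) {..<n} (\<lambda>_. y) > (0::real)"
    unfolding edge_signings_def by blast
  interpret signed_regular "\<lambda>i j. if {i, j} \<in> E then \<sigma> {i, j} else 0" "{..<n}" "real d"
    by (rule signed_regular_graph[OF assms(3) \<sigma>(1)])
  have "(mixed_root n (signed_adj_mat n E \<sigma>))\<^sup>2 \<le> 2 * (real d - 1)"
    unfolding signed_adj_mat_def
    by (rule mixed_root_bounds(2)[OF assms(1) sym diag]) (use \<sigma>(2) assms(2) in auto)
  then have P: "?P \<sigma>" using \<sigma>(1) by simp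
  have bound: "real_spectral_radius (signed_adj_mat n E \<sigma>) < (3 + sqrt 5) / 2 * sqrt (real d - 1)" if "?P \<sigma>" for \<sigma>
    using spectral_radius_signing[OF assms] that by blast
  have "finite (edge_signings E)" unfolding edge_signings_def using finE by (intro finite_PiE) auto
  then have "finite {\<sigma>. ?P \<sigma>}" by (rule finite_subset[rotated]) auto
  then have fin: "finite {real_spectral_radius (signed_adj_mat n E \<sigma>) | \<sigma>. ?P \<sigma>}" by simp
  have "Max {real_spectral_radius (signed_adj_mat n E \<sigma>) | \<sigma>. ?P \<sigma>} < (3 + sqrt 5) / 2 * sqrt (real d - 1)"
    using fin P bound by (subst Max_less_iff) auto
  then show ?thesis using P bound by blast
qed

end
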